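(* Let $\mathfrak a>0$. For each $i$ let $\{Y_\ell^i\}$ be an orthonormal basis of $\mathcal H_i^d$, and let $$\mathbf Q_{j,k,\ell}^n(x,t)=C_{n-k}^{(\beta+\frac12,\ k+\alpha+\gamma+\theta+\frac d2)}(t)\;t^{2j}\,P_j^{(\gamma,\ k-2j+\alpha+\frac{d-2}2)}\Big(\frac{2\|x\|^2}{t^2}-1\Big)Y_\ell^{k-2j}(x).$$ Then the space $\mathcal V_n^E(\mathbf W^{\mathfrak a}_{\alpha,\beta,\gamma,\theta},\mathbb X_{\mathfrak a}^{d+1})$ has an orthogonal basis $$\mathbf Q^{\mathfrak a,n}_{j,n-2m,\ell}(x,t)=P_j^{2m+2j}\Big(W^{(2(n-2m-2j))};\|x\|,\sqrt{\|x\|^2+\tfrac1{\mathfrak a}(t^2-\|x\|^2)}\Big)Y_\ell^{n-2m-2j}(x)$$ $$=\mathbf Q^n_{j,n-2m,\ell}\Big(x,\sqrt{\|x\|^2+\tfrac1{\mathfrak a}(t^2-\|x\|^2)}\Big),$$ with $0\le m\le n/2$, $0\le j\le(n-2m)/2$, $1\le\ell\le\dim\mathcal H_{n-2m-2j}^d$. Moreover, the norm of $\mathbf Q^{\mathfrak a,n}_{j,n-2m,\ell}$ in $L^2(\mathbf W^{\mathfrak a}_{\alpha,\beta,\gamma,\theta},\mathbb X_{\mathfrak a}^{d+1})$ is equal to the norm of $\mathbf Q^{n}_{j,n-2m,\ell}$ in $L^2(\mathbf W_{\alpha,\beta,\gamma,\theta},\mathbb X^{d+1})$.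
   Context: Here $\alpha,\beta,\gamma,\theta>-1$. $\mathbb X^{d+1}=\{(x,t)\in\mathbb R^d\times\mathbb R:\|x\|\le|t|\le1\}$ with $\mathbf W_{\alpha,\beta,\gamma,\theta}(x,t)=\|x\|^{2\alpha}(1-t^2)^\beta(t^2-\|x\|^2)^\gamma|t|^{2\theta}$. $\mathbb X_{\mathfrak a}^{d+1}=\{(x,t)\in\mathbb R^d\times\mathbb R:(\|x\|^2,t^2)\in\nabla_{\mathfrak a}\}$, where $\nabla_{\mathfrak a}$ is the triangle with vertices $(0,0)$, $(0,\mathfrak a)$, $(1,1)$ (that is, $\|x\|^2\le t^2\le(1-\mathfrak a)\|x\|^2+\mathfrak a$), with $$\mathbf W^{\mathfrak a}_{\alpha,\beta,\gamma,\theta}(x,t)=\|x\|^{2\alpha}\big(\mathfrak a+(1-\mathfrak a)\|x\|^2-t^2\big)^\beta\big(t^2-\|x\|^2\big)^\gamma\big(t^2-(1-\mathfrak a)\|x\|^2\big)^{\theta}.$$ Norms are taken with both weights normalized to have unit integral. For integers $i\ge0$ and $0\le j\le N/2$, $$P_j^N(W^{(2i)};s,t)=C_{N-2j}^{(\beta+\frac12,\ 2j+i+\alpha+\gamma+\theta+\frac d2)}(t)\,t^{2j}P_j^{(\gamma,\ i+\alpha+\frac{d-2}2)}\Big(\frac{2s^2}{t^2}-1\Big).$$ For a weight $U$ on a domain $D$, $\mathcal V_n(U,D)$ is the space of polynomials of total degree at most $n$ orthogonal in $L^2(U,D)$ to all polynomials of degree $<n$, and $\mathcal V_n^E(U,D)$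 its subspace of polynomials even in $t$. $\mathcal H_i^d$ is the space of homogeneous harmonic polynomials of degree $i$ in $d$ variables, with inner product $\frac1{\omega_d}\int_{\mathbb S^{d-1}}fg\,d\sigma$. $P_n^{(a,b)}$ is the Jacobi polynomial orthogonal with respect to $(1-t)^a(1+t)^b$ on $[-1,1]$. The generalized Gegenbauer polynomials are $$C_{2m}^{(\lambda,\mu)}(t)=\frac{(\lambda+\mu)_m}{(\mu+\frac12)_m}P_m^{(\lambda-\frac12,\mu-\frac12)}(2t^2-1),\qquad C_{2m+1}^{(\lambda,\mu)}(t)=\frac{(\lambda+\mu)_{m+1}}{(\mu+\frac12)_{m+1}}\,t\,P_m^{(\lambda-\frac12,\mu+\frac12)}(2t^2-1),$$ with $(a)_n=a(a+1)\cdots(a+n-1)$.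
   Formalization: In W^a the last factor is taken as |t|(t²−(1−a)‖x‖²)^{θ−1/2} (the claim fails as printed for a≠1); both weights are assumed integrable (2α+d>0, 2(α+γ+θ)+d+1>0); for even n>0 the case α+β+γ+θ+(d+1)/2=0, where a basis element vanishes, is excluded. *)

theory Defs
  imports "HOL-Analysis.Analysis" "HOL-Library.Function_Algebras"
begin

text \<open>
  Real-valued functions are made a real vector space under the pointwise operations, so that
  \<open>span\<close>, \<open>independent\<close> and \<open>dim\<close> apply to spaces of polynomial functions.
  Throughout, $d$ is \<open>DIM('a)\<close> and the point $(x,t)$ of $R^{d+1}$ has type \<open>'a \<times> real\<close>.
\<close>

instantiation "fun" :: (type, real_vector) real_vector
begin

definition scaleR_fun :: "real \<Rightarrow> ('a \<Rightarrow> 'b) \<Rightarrow> 'a \<Rightarrow> 'b" where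
  "scaleR_fun c f = (\<lambda>x. c *\<^sub>R f x)"

instance
  by standard (simp_all add: scaleR_fun_def plus_fun_def fun_eq_iff algebra_simps)

end


section \<open>Polynomials and spherical harmonics\<close>

definition monomial_fun :: "('e::euclidean_space \<Rightarrow> nat) \<Rightarrow> 'e \<Rightarrow> real" where
  "monomial_fun e = (\<lambda>x. \<Prod>b\<in>Basis. (x \<bullet> b) ^ e b)"

text \<open>
  \<open>poly_space {..n}\<close>, \<open>poly_space {..<n}\<close> and \<open>poly_space {n}\<close> are the polynomials of total degree
  at most $n$, of total degree less than $n$, and the homogeneous ones of degree $n$ (zero included).
\<close>

definition poly_space :: "nat set \<Rightarrow> ('e::euclidean_space \<Rightarrow> real) set" where
  "poly_space S = span {monomial_fun e | e. (\<Sum>b\<in>Basis. e b) \<in> S}"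

definition laplacian :: "('a::euclidean_space \<Rightarrow> real) \<Rightarrow> 'a \<Rightarrow> real" where
  "laplacian f x = (\<Sum>b\<in>Basis. (deriv ^^ 2) (\<lambda>s. f (x + s *\<^sub>R b)) 0)"

definition harmonics :: "nat \<Rightarrow> ('a::euclidean_space \<Rightarrow> real) set" where
  "harmonics i = {f \<in> poly_space {i}. \<forall>x. laplacian f x = 0}"

text \<open>
  Surface measure $\sigma$ on the unit sphere, as the cone measure:
  $\sigma(A) = d \cdot \mathrm{vol} \{x : \|x\| < 1,\ x/\|x\| \in A\}$.
  (The origin is a null set; for $d = 1$ this is counting measure on the two points $1$ and $-1$.)
\<close>

definition sphere_measure :: "'a::euclidean_space measure" where
  "sphere_measure = scale_measure (ennreal (real DIM('a)))
     (distr (restrict_space lborel (ball 0 1)) borel (\<lambda>x. x /\<^sub>R norm x))"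

definition sphere_inner :: "('a::euclidean_space \<Rightarrow> real) \<Rightarrow> ('a \<Rightarrow> real) \<Rightarrow> real" where
  "sphere_inner f g =
     (1 / measure (sphere_measure :: 'a measure) UNIV) * (\<integral>x. f x * g x \<partial>sphere_measure)"


section \<open>Orthogonal bases and spaces of orthogonal polynomials\<close>

definition orthogonal_basis ::
  "('v::real_vector \<Rightarrow> 'v \<Rightarrow> real) \<Rightarrow> 'i set \<Rightarrow> ('i \<Rightarrow> 'v) \<Rightarrow> 'v set \<Rightarrow> bool" where
  "orthogonal_basis ip I v V \<longleftrightarrow>
     inj_on v I \<and> independent (v ` I) \<and> span (v ` I) = V \<and>
     (\<forall>i\<in>I. \<forall>j\<in>I. i \<noteq> j \<longrightarrow> ip (v i) (v j) = 0)"

definition orthonormal_basis ::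
  "('v::real_vector \<Rightarrow> 'v \<Rightarrow> real) \<Rightarrow> 'i set \<Rightarrow> ('i \<Rightarrow> 'v) \<Rightarrow> 'v set \<Rightarrow> bool" where
  "orthonormal_basis ip I v V \<longleftrightarrow> orthogonal_basis ip I v V \<and> (\<forall>i\<in>I. ip (v i) (v i) = 1)"

definition L2_inner ::
  "('e::euclidean_space \<Rightarrow> real) \<Rightarrow> 'e set \<Rightarrow> ('e \<Rightarrow> real) \<Rightarrow> ('e \<Rightarrow> real) \<Rightarrow> real" where
  "L2_inner U D f g =
     (LINT z:D|lborel. f z * g z * U z) / (LINT z:D|lborel. U z)"

definition L2_norm ::
  "('e::euclidean_space \<Rightarrow> real) \<Rightarrow> 'e set \<Rightarrow> ('e \<Rightarrow> real) \<Rightarrow> real" where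
  "L2_norm U D f = sqrt (L2_inner U D f f)"

definition orth_polys ::
  "nat \<Rightarrow> ('e::euclidean_space \<Rightarrow> real) \<Rightarrow> 'e set \<Rightarrow> ('e \<Rightarrow> real) set" where
  "orth_polys n U D = {f \<in> poly_space {..n}. \<forall>g \<in> poly_space {..<n}. L2_inner U D f g = 0}"

definition orth_polys_even ::
  "nat \<Rightarrow> ('a::euclidean_space \<times> real \<Rightarrow> real) \<Rightarrow> ('a \<times> real) set \<Rightarrow> ('a \<times> real \<Rightarrow> real) set" where
  "orth_polys_even n U D = {f \<in> orth_polys n U D. \<forall>x t. f (x, - t) = f (x, t)}"


section \<open>Jacobi and generalized Gegenbauer polynomials\<close>

text \<open>
  Jacobi polynomials in the standard normalization
  $P_n^{(a,b)}(t) = \frac{(a+1)_n}{n!}\, {}_2F_1(-n, n+a+b+1; a+1; \frac{1-t}{2})$.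
\<close>

definition jacobi_P :: "real \<Rightarrow> real \<Rightarrow> nat \<Rightarrow> real \<Rightarrow> real" where
  "jacobi_P a b n t = pochhammer (a + 1) n / fact n *
     (\<Sum>k\<le>n. pochhammer (- real n) k * pochhammer (real n + a + b + 1) k /
        (pochhammer (a + 1) k * fact k) * ((1 - t) / 2) ^ k)"

definition gen_gegenbauer :: "real \<Rightarrow> real \<Rightarrow> nat \<Rightarrow> real \<Rightarrow> real" where
  "gen_gegenbauer lam mu n t =
     (let m = n div 2 in
      if even n
      then pochhammer (lam + mu) m / pochhammer (mu + 1/2) m *
             jacobi_P (lam - 1/2) (mu - 1/2) m (2 * t^2 - 1)
      else pochhammer (lam + mu) (m + 1) / pochhammer (mu + 1/2) (m + 1) *
             t * jacobi_P (lam - 1/2) (mu + 1/2) m (2 * t^2 - 1))"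


section \<open>The two domains and their weights\<close>

definition cone_X :: "('a::euclidean_space \<times> real) set" where
  "cone_X = {(x, t). norm x \<le> \<bar>t\<bar> \<and> \<bar>t\<bar> \<le> 1}"

fun weight_W ::
  "real \<Rightarrow> real \<Rightarrow> real \<Rightarrow> real \<Rightarrow> 'a::euclidean_space \<times> real \<Rightarrow> real" where
  "weight_W \<alpha> \<beta> \<gamma> \<theta> (x, t) =
     norm x powr (2 * \<alpha>) * (1 - t^2) powr \<beta> * (t^2 - (norm x)^2) powr \<gamma> * \<bar>t\<bar> powr (2 * \<theta>)"

definition triangle_a :: "real \<Rightarrow> (real \<times> real) set" where
  "triangle_a a = convex hull {(0, 0), (0, a), (1, 1)}"

definition cone_Xa :: "real \<Rightarrow> ('a::euclidean_space \<times> real) set" where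
  "cone_Xa a = {(x, t). ((norm x)^2, t^2) \<in> triangle_a a}"

text \<open>
  The last factor of the weight on the second domain is $|t|\,(t^2-(1-a)\|x\|^2)^{\theta-1/2}$ where
  the source prints $(t^2-(1-a)\|x\|^2)^{\theta}$; for $a = 1$ both are $|t|^{2\theta}$ (off $t=0$).
  Put $\tau^2 = \|x\|^2 + \frac1a(t^2-\|x\|^2)$, so that $a\tau^2 = t^2-(1-a)\|x\|^2$ and
  $|t|\,dt = a\,|\tau|\,d\tau$: with the factor used here, $(x,t) \mapsto (x,\tau)$ carries this weight to
  a multiple of \<open>weight_W\<close>. With the printed factor the orthogonality fails for every $a \neq 1$:
  when $d = 2$ and all four exponents are $0$, the integral over the domain of the quadratic
  basis element $2\|x\|^2-\tau^2$ is a nonzero multiple of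
  $\int_0^1 (2r-1)(a+(1-a)r)^{-1/2}\,dr \neq 0$.
\<close>

fun weight_Wa ::
  "real \<Rightarrow> real \<Rightarrow> real \<Rightarrow> real \<Rightarrow> real \<Rightarrow> 'a::euclidean_space \<times> real \<Rightarrow> real" where
  "weight_Wa a \<alpha> \<beta> \<gamma> \<theta> (x, t) =
     norm x powr (2 * \<alpha>) * (a + (1 - a) * (norm x)^2 - t^2) powr \<beta> *
     (t^2 - (norm x)^2) powr \<gamma> *
     (\<bar>t\<bar> * (t^2 - (1 - a) * (norm x)^2) powr (\<theta> - 1/2))"


section \<open>The explicit polynomials\<close>

text \<open>
  Here \<open>d\<close> is the dimension. The formulas divide by $t^2$; on the domains $t = 0$ forces $x = 0$,
  and there they evaluate (with \<open>y / 0 = 0\<close>) to the value of the polynomial that they denote.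
\<close>

definition P_tri ::
  "nat \<Rightarrow> real \<Rightarrow> real \<Rightarrow> real \<Rightarrow> real \<Rightarrow> nat \<Rightarrow> nat \<Rightarrow> nat \<Rightarrow> real \<Rightarrow> real \<Rightarrow> real" where
  "P_tri d \<alpha> \<beta> \<gamma> \<theta> i N j s t =
     gen_gegenbauer (\<beta> + 1/2) (real (2 * j + i) + \<alpha> + \<gamma> + \<theta> + real d / 2) (N - 2 * j) t *
     t ^ (2 * j) *
     jacobi_P \<gamma> (real i + \<alpha> + (real d - 2) / 2) j (2 * s^2 / t^2 - 1)"

fun Q_cone ::
  "real \<Rightarrow> real \<Rightarrow> real \<Rightarrow> real \<Rightarrow> (nat \<Rightarrow> nat \<Rightarrow> 'a::euclidean_space \<Rightarrow> real) \<Rightarrow>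
   nat \<Rightarrow> nat \<Rightarrow> nat \<Rightarrow> nat \<Rightarrow> 'a \<times> real \<Rightarrow> real" where
  "Q_cone \<alpha> \<beta> \<gamma> \<theta> Y n j k l (x, t) =
     gen_gegenbauer (\<beta> + 1/2) (real k + \<alpha> + \<gamma> + \<theta> + real DIM('a) / 2) (n - k) t *
     t ^ (2 * j) *
     jacobi_P \<gamma> (real (k - 2 * j) + \<alpha> + (real DIM('a) - 2) / 2) j (2 * (norm x)^2 / t^2 - 1) *
     Y (k - 2 * j) l x"

definition tau :: "real \<Rightarrow> 'a::euclidean_space \<Rightarrow> real \<Rightarrow> real" where
  "tau a x t = sqrt ((norm x)^2 + 1 / a * (t^2 - (norm x)^2))"

text \<open>\<open>Qa_cone a \<alpha> \<beta> \<gamma> \<theta> Y n j m l\<close> has second lower index $n - 2m$.\<close>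

fun Qa_cone ::
  "real \<Rightarrow> real \<Rightarrow> real \<Rightarrow> real \<Rightarrow> real \<Rightarrow> (nat \<Rightarrow> nat \<Rightarrow> 'a::euclidean_space \<Rightarrow> real) \<Rightarrow>
   nat \<Rightarrow> nat \<Rightarrow> nat \<Rightarrow> nat \<Rightarrow> 'a \<times> real \<Rightarrow> real" where
  "Qa_cone a \<alpha> \<beta> \<gamma> \<theta> Y n j m l (x, t) =
     P_tri DIM('a) \<alpha> \<beta> \<gamma> \<theta> (n - 2 * m - 2 * j) (2 * m + 2 * j) j (norm x) (tau a x t) *
     Y (n - 2 * m - 2 * j) l x"

definition basis_index :: "'a::euclidean_space itself \<Rightarrow> nat \<Rightarrow> (nat \<times> nat \<times> nat) set" where
  "basis_index _ n = {(m, j, l). 2 * m \<le> n \<and> 2 * j \<le> n - 2 * m \<and>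
     1 \<le> l \<and> l \<le> dim (harmonics (n - 2 * m - 2 * j) :: ('a \<Rightarrow> real) set)}"

end

theory Submission
  imports Defs "HOL-Probability.Probability"
begin

text \<open>
  Put $u = \|x\|^2 + (t^2 - \|x\|^2)/a$. In polar coordinates $x = \sqrt{uv}\,\omega$ the weighted
  measure on the domain, seen by functions of $(x, u)$, is a constant times the product of the surface
  measure in $\omega$ and of the beta weights $u^p(1-u)^\beta$ and $v^q(1-v)^\gamma$ on $[0,1]$,
  where $p = \alpha+\gamma+\theta+(d-1)/2$ and $q = \alpha+(d-2)/2$. Only the constant depends on $a$,
  and the first domain is the case $a = 1$, so the norms agree. Each basis function is a product of a
  Jacobi polynomial in $u$, a Jacobi polynomial in $v$, a spherical harmonic in $\omega$ and powers of
  $u$ and $v$; hence orthogonality reduces to that of Jacobi polynomials and of spherical harmonics.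

  For completeness, a polynomial even in $t$ is a polynomial in $x$ and $u$. By the harmonic
  decomposition and triangularity in the degrees of the two Jacobi factors, the basis functions of degree
  at most $n$ span the even polynomials of degree at most $n$, and those orthogonal to all lower degrees
  are exactly the span of the basis functions of degree $n$.
\<close>

text \<open>The printed formulas are polynomials only on the domain: they divide by u and take its
  square root. The proof therefore works with \<open>sep_fun\<close>, a polynomial in x and u that
  is defined everywhere and meets the printed formula on the domain; a homogenization takes the
  place of the division.

  Harmonics of different degrees are shown orthogonal on the whole space, for a Gaussian weight, and
  homogeneity carries this to the sphere. A Gaussian is both a product over the coordinates and a
  function of |x|: the product form makes integration by parts a recursion between one-variable
  moments, the radial form splits off the sphere.

  The separation of the weight is proved as an identity of measures through nonnegative integrals,
  so no integrability has to be known in advance; it comes out as a consequence. The substitutions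
  involved are affine maps, polar coordinates and s = r^2, and the last two are verified by the
  masses that they give to half-lines.\<close>

section \<open>Polynomial functions as spans of monomials\<close>

lemma subspace_poly_space: "subspace (poly_space S)"
  by (simp add: poly_space_def)

lemma monomial_in_poly_space: "(\<Sum>b\<in>Basis. e b) \<in> S \<Longrightarrow> monomial_fun e \<in> poly_space S"
  unfolding poly_space_def by (rule span_base) blast

lemma poly_space_mono: "S \<subseteq> T \<Longrightarrow> poly_space S \<subseteq> poly_space T"
  unfolding poly_space_def by (rule span_mono) blast

text \<open>Takes the place of induction over polynomials: a property closed under linear
  combinations has to be checked on monomials only.\<close>

lemma poly_space_subset:
  assumes "\<And>e. (\<Sum>b\<in>Basis. e b) \<in> S \<Longrightarrow> monomial_fun e \<in> V" "subspace V"
  shows "poly_space S \<subseteq> V"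
  unfolding poly_space_def using assms by (intro span_minimal) auto

lemma subspace_funI:
  assumes "(\<lambda>x. 0) \<in> V"
    and "\<And>f g. f \<in> V \<Longrightarrow> g \<in> V \<Longrightarrow> (\<lambda>x. f x + g x) \<in> V"
    and "\<And>c f. f \<in> V \<Longrightarrow> (\<lambda>x. c * f x) \<in> V"
  shows "subspace (V :: ('a \<Rightarrow> real) set)"
  using assms unfolding subspace_def by (simp add: zero_fun_def plus_fun_def scaleR_fun_def)

lemma subspace_fun_zero: "subspace V \<Longrightarrow> (\<lambda>x. 0 :: real) \<in> V"
  using subspace_0[of V] by (simp add: zero_fun_def)

lemma subspace_fun_add: "subspace V \<Longrightarrow> f \<in> V \<Longrightarrow> g \<in> V \<Longrightarrow> (\<lambda>x. f x + g x :: real) \<in> V"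
  using subspace_add[of V f g] by (simp add: plus_fun_def)

lemma subspace_fun_scale: "subspace V \<Longrightarrow> f \<in> V \<Longrightarrow> (\<lambda>x. c * f x :: real) \<in> V"
  using subspace_scale[of V f c] by (simp add: scaleR_fun_def)

lemma subspace_fun_diff: "subspace V \<Longrightarrow> f \<in> V \<Longrightarrow> g \<in> V \<Longrightarrow> (\<lambda>x. f x - g x :: real) \<in> V"
  using subspace_fun_add[OF _ _ subspace_fun_scale[where c = "-1" and f = g], of V f] by simp

lemma subspace_fun_sum:
  assumes "subspace V" "\<And>i. i \<in> I \<Longrightarrow> f i \<in> V"
  shows "(\<lambda>x. \<Sum>i\<in>I. f i x :: real) \<in> V"
  using assms(2)
  by (induction I rule: infinite_finite_induct)
     (auto intro: subspace_fun_zero subspace_fun_add assms(1))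

lemmas poly_space_zero = subspace_fun_zero[OF subspace_poly_space]
  and poly_space_add = subspace_fun_add[OF subspace_poly_space]
  and poly_space_scale = subspace_fun_scale[OF subspace_poly_space]
  and poly_space_diff = subspace_fun_diff[OF subspace_poly_space]
  and poly_space_sum = subspace_fun_sum[OF subspace_poly_space]

text \<open>Lets a span argument prove that multiplication by a fixed g maps one space of functions
  into another.\<close>

lemma subspace_mult_vimage:
  assumes "subspace V"
  shows "subspace {f. (\<lambda>x. f x * g x :: real) \<in> V}"
proof (rule subspace_funI)
  fix c f assume "f \<in> {f. (\<lambda>x. f x * g x) \<in> V}"
  then show "(\<lambda>x. c * f x) \<in> {f. (\<lambda>x. f x * g x) \<in> V}"
    using subspace_fun_scale[OF assms, of "\<lambda>x. f x * g x" c] by (simp add: mult.assoc)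
qed (auto simp: distrib_right intro: subspace_fun_zero subspace_fun_add assms)

lemma monomial_mult: "monomial_fun e x * monomial_fun e' x = monomial_fun (\<lambda>b. e b + e' b) x"
  by (simp add: monomial_fun_def power_add prod.distrib)

text \<open>By bilinearity two monomials suffice, and their exponents add; the span argument is run
  once in each factor. Degree sets instead of single degrees cover the homogeneous and the bounded
  case together.\<close>

lemma poly_space_mult:
  assumes f: "f \<in> poly_space S" and g: "g \<in> poly_space T"
    and U: "\<And>s t. s \<in> S \<Longrightarrow> t \<in> T \<Longrightarrow> s + t \<in> U"
  shows "(\<lambda>x. f x * g x) \<in> poly_space U"
proof -
  have "poly_space T \<subseteq> {g. (\<lambda>x. g x * f x) \<in> poly_space U}"
  proof (rule poly_space_subset)
    fix e' :: "'a \<Rightarrow> nat" assume e': "sum e' Basis \<in> T"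
    have "poly_space S \<subseteq> {f. (\<lambda>x. f x * monomial_fun e' x) \<in> poly_space U}"
    proof (rule poly_space_subset)
      fix e :: "'a \<Rightarrow> nat" assume "sum e Basis \<in> S"
      then show "monomial_fun e \<in> {f. (\<lambda>x. f x * monomial_fun e' x) \<in> poly_space U}"
        using U e' by (auto simp: monomial_mult sum.distrib intro!: monomial_in_poly_space)
    qed (rule subspace_mult_vimage[OF subspace_poly_space])
    then show "monomial_fun e' \<in> {g. (\<lambda>x. g x * f x) \<in> poly_space U}"
      using f by (auto simp: mult.commute)
  qed (rule subspace_mult_vimage[OF subspace_poly_space])
  then show ?thesis using g by (auto simp: mult.commute)
qed

lemma poly_space_const: "0 \<in> S \<Longrightarrow> (\<lambda>x. c) \<in> poly_space S"
  using poly_space_scale[OF monomial_in_poly_space[of "\<lambda>_. 0" S], of c]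
  by (simp add: monomial_fun_def)

lemma poly_space_inner:
  assumes "b \<in> Basis" shows "(\<lambda>x. x \<bullet> b) \<in> poly_space {1}"
proof -
  have "monomial_fun (\<lambda>c. if c = b then 1 else 0) = (\<lambda>x. x \<bullet> b)"
  proof
    fix x :: 'a
    have "monomial_fun (\<lambda>c. if c = b then 1 else 0) x = (\<Prod>c\<in>Basis. if c = b then x \<bullet> c else 1)"
      unfolding monomial_fun_def by (rule prod.cong) auto
    then show "monomial_fun (\<lambda>c. if c = b then 1 else 0) x = x \<bullet> b" using assms by simp
  qed
  then show ?thesis
    using monomial_in_poly_space[of "\<lambda>c. if c = b then 1 else 0" "{1}"] assms by simp
qed

lemma poly_space_power:
  assumes "f \<in> poly_space {n}" shows "(\<lambda>x. f x ^ k) \<in> poly_space {k * n}"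
  by (induction k) (auto intro!: poly_space_const poly_space_mult[OF assms])

lemma norm_power2_eq_sum: "(norm (x::'a::euclidean_space))\<^sup>2 = (\<Sum>b\<in>Basis. (x \<bullet> b)\<^sup>2)"
  unfolding power2_norm_eq_inner by (subst euclidean_inner) (simp add: power2_eq_square)

lemma poly_space_norm_power2: "(\<lambda>x. (norm x)\<^sup>2) \<in> poly_space {2}"
  unfolding norm_power2_eq_sum
  using poly_space_power[OF poly_space_inner, of _ 2] by (intro poly_space_sum) simp

lemma poly_space_norm_power: "(\<lambda>x. (norm x) ^ (2 * p)) \<in> poly_space {2 * p}"
  using poly_space_power[OF poly_space_norm_power2, of p]
  unfolding power_mult by (simp only: mult.commute)

lemma continuous_on_poly_space: "f \<in> poly_space S \<Longrightarrow> continuous_on A f"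
proof -
  have "poly_space S \<subseteq> {f. continuous_on A f}"
    by (rule poly_space_subset)
       (auto simp: monomial_fun_def intro!: continuous_intros subspace_funI)
  then show "f \<in> poly_space S \<Longrightarrow> continuous_on A f" by blast
qed

lemma borel_measurable_poly_space: "f \<in> poly_space S \<Longrightarrow> f \<in> borel_measurable borel"
  using continuous_on_poly_space by (rule borel_measurable_continuous_onI)

lemma poly_space_homogeneous: "f \<in> poly_space {n} \<Longrightarrow> f (c *\<^sub>R x) = c ^ n * f x"
proof -
  have "poly_space {n} \<subseteq> {f. f (c *\<^sub>R x) = c ^ n * f x}"
  proof (rule poly_space_subset)
    fix e :: "'a \<Rightarrow> nat" assume "sum e Basis \<in> {n}"
    then show "monomial_fun e \<in> {f. f (c *\<^sub>R x) = c ^ n * f x}"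
      by (auto simp: monomial_fun_def power_mult_distrib prod.distrib power_sum)
  qed (auto intro!: subspace_funI simp: algebra_simps)
  then show "f \<in> poly_space {n} \<Longrightarrow> f (c *\<^sub>R x) = c ^ n * f x" by blast
qed


section \<open>Harmonic decomposition\<close>

text \<open>The first-order companion of \<open>laplacian\<close>, which is built from one-variable
  derivatives along the coordinate lines.\<close>

definition dir_deriv :: "'a::euclidean_space \<Rightarrow> ('a \<Rightarrow> real) \<Rightarrow> 'a \<Rightarrow> real" where
  "dir_deriv b f x = deriv (\<lambda>s. f (x + s *\<^sub>R b)) 0"

text \<open>Along the line x + s b only the factor of index b varies. For \<open>e b = 0\<close> the
  truncated exponent \<open>e b - 1\<close> is harmless, since its coefficient vanishes.\<close>

lemma monomial_has_dir_deriv: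
  assumes "b \<in> Basis"
  shows "((\<lambda>s. monomial_fun e (x + s *\<^sub>R b)) has_field_derivative
            real (e b) * monomial_fun (e(b := e b - 1)) x) (at 0)"
proof -
  have split: "monomial_fun e' (x + s *\<^sub>R b) =
      (x \<bullet> b + s) ^ e' b * (\<Prod>c\<in>Basis - {b}. (x \<bullet> c) ^ e' c)" for s e'
  proof -
    have "(\<Prod>c\<in>Basis - {b}. ((x + s *\<^sub>R b) \<bullet> c) ^ e' c) = (\<Prod>c\<in>Basis - {b}. (x \<bullet> c) ^ e' c)"
      using assms by (intro prod.cong) (auto simp: inner_add_left inner_Basis)
    then show ?thesis
      using assms by (simp add: monomial_fun_def prod.remove[OF _ assms] inner_add_left)
  qed
  have "((\<lambda>s. (x \<bullet> b + s) ^ e b * (\<Prod>c\<in>Basis - {b}. (x \<bullet> c) ^ e c)) has_field_derivative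
      real (e b) * (x \<bullet> b) ^ (e b - 1) * (\<Prod>c\<in>Basis - {b}. (x \<bullet> c) ^ e c)) (at 0)"
    by (auto intro!: derivative_eq_intros)
  moreover have "monomial_fun (e(b := e b - 1)) x =
      (x \<bullet> b) ^ (e b - 1) * (\<Prod>c\<in>Basis - {b}. (x \<bullet> c) ^ e c)"
    using split[of "e(b := e b - 1)" 0] by simp
  ultimately show ?thesis by (simp add: split mult.assoc)
qed

lemma poly_has_dir_deriv:
  assumes "f \<in> poly_space S" "b \<in> Basis"
  shows "((\<lambda>s. f (x + s *\<^sub>R b)) has_field_derivative dir_deriv b f x) (at 0)"
proof -
  have "poly_space S \<subseteq> {f. (\<lambda>s. f (x + s *\<^sub>R b)) field_differentiable (at 0)}"
    using monomial_has_dir_deriv[OF assms(2)]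
    by (intro poly_space_subset subspace_funI)
       (auto intro!: derivative_intros simp: field_differentiable_def)
  then show ?thesis
    using assms(1) unfolding dir_deriv_def by (auto simp: field_differentiable_derivI)
qed

lemma dir_deriv_eqI:
  "((\<lambda>s. f (x + s *\<^sub>R b)) has_field_derivative D) (at 0) \<Longrightarrow> dir_deriv b f x = D"
  unfolding dir_deriv_def by (rule DERIV_imp_deriv)

lemma dir_deriv_monomial:
  "b \<in> Basis \<Longrightarrow> dir_deriv b (monomial_fun e) x = real (e b) * monomial_fun (e(b := e b - 1)) x"
  by (rule dir_deriv_eqI) (rule monomial_has_dir_deriv)

lemma dir_deriv_zero: "dir_deriv b (\<lambda>x. 0) x = 0"
  by (rule dir_deriv_eqI) simp

lemma dir_deriv_inner:
  "b \<in> Basis \<Longrightarrow> c \<in> Basis \<Longrightarrow> dir_deriv b (\<lambda>x. x \<bullet> c) x = (if b = c then 1 else 0)"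
  by (rule dir_deriv_eqI) (auto intro!: derivative_eq_intros simp: inner_add_left inner_Basis)

context
  fixes b :: "'a::euclidean_space"
  assumes b: "b \<in> Basis"
begin

lemma dir_deriv_add:
  "f \<in> poly_space S \<Longrightarrow> g \<in> poly_space T \<Longrightarrow>
    dir_deriv b (\<lambda>x. f x + g x) x = dir_deriv b f x + dir_deriv b g x"
  by (rule dir_deriv_eqI) (auto intro!: derivative_eq_intros poly_has_dir_deriv b)

lemma dir_deriv_scale:
  "f \<in> poly_space S \<Longrightarrow> dir_deriv b (\<lambda>x. c * f x) x = c * dir_deriv b f x"
  by (rule dir_deriv_eqI) (auto intro!: derivative_eq_intros poly_has_dir_deriv b)

lemma dir_deriv_mult:
  "f \<in> poly_space S \<Longrightarrow> g \<in> poly_space T \<Longrightarrow>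
    dir_deriv b (\<lambda>x. f x * g x) x = dir_deriv b f x * g x + f x * dir_deriv b g x"
  by (rule dir_deriv_eqI) (auto intro!: derivative_eq_intros poly_has_dir_deriv b)

text \<open>Membership in \<open>poly_space S\<close> is kept in the set because
  \<open>deriv\<close> is additive only where the derivatives exist.\<close>

lemma subspace_dir_deriv_vimage:
  assumes "subspace V" shows "subspace {f \<in> poly_space S. dir_deriv b f \<in> V}"
proof (rule subspace_funI)
  show "(\<lambda>x. 0) \<in> {f \<in> poly_space S. dir_deriv b f \<in> V}"
    using subspace_fun_zero[OF assms] by (simp add: poly_space_zero dir_deriv_zero[abs_def])
next
  fix f g assume *: "f \<in> {f \<in> poly_space S. dir_deriv b f \<in> V}" "g \<in> {f \<in> poly_space S. dir_deriv b f \<in> V}"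
  then have "dir_deriv b (\<lambda>x. f x + g x) = (\<lambda>x. dir_deriv b f x + dir_deriv b g x)"
    by (intro ext dir_deriv_add) auto
  with * show "(\<lambda>x. f x + g x) \<in> {f \<in> poly_space S. dir_deriv b f \<in> V}"
    by (auto intro: poly_space_add subspace_fun_add[OF assms])
next
  fix c f assume *: "f \<in> {f \<in> poly_space S. dir_deriv b f \<in> V}"
  then have "dir_deriv b (\<lambda>x. c * f x) = (\<lambda>x. c * dir_deriv b f x)"
    by (intro ext dir_deriv_scale) auto
  with * show "(\<lambda>x. c * f x) \<in> {f \<in> poly_space S. dir_deriv b f \<in> V}"
    by (auto intro: poly_space_scale subspace_fun_scale[OF assms])
qed

text \<open>If S contains no positive degree, T may be empty, and membership in
  \<open>poly_space {}\<close> then says that the derivative is 0. The same device yields the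
  vanishing of the Laplacian below degree 2.\<close>

lemma dir_deriv_poly_space:
  assumes f: "f \<in> poly_space S" and ST: "\<And>n. Suc n \<in> S \<Longrightarrow> n \<in> T"
  shows "dir_deriv b f \<in> poly_space T"
proof -
  have "poly_space S \<subseteq> {f \<in> poly_space S. dir_deriv b f \<in> poly_space T}"
  proof (rule poly_space_subset)
    fix e :: "'a \<Rightarrow> nat" assume e: "sum e Basis \<in> S"
    have "(\<lambda>x. real (e b) * monomial_fun (e(b := e b - 1)) x) \<in> poly_space T"
    proof (cases "e b = 0")
      case False
      have "sum (e(b := e b - 1)) (Basis - {b}) = sum e (Basis - {b})"
        by (intro sum.cong) auto
      then have "Suc (sum (e(b := e b - 1)) Basis) = sum e Basis"
        using False by (simp add: sum.remove[OF _ b])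
      then show ?thesis using ST e by (intro poly_space_scale monomial_in_poly_space) metis
    qed (simp add: poly_space_zero)
    then show "monomial_fun e \<in> {f \<in> poly_space S. dir_deriv b f \<in> poly_space T}"
      using e by (simp add: monomial_in_poly_space dir_deriv_monomial[OF b, abs_def])
  qed (rule subspace_dir_deriv_vimage[OF subspace_poly_space])
  then show ?thesis using f by blast
qed

end

text \<open>On a monomial the exponents add up to n. The identity serves twice: for the cross term
  in the Laplacian of |x|^2 f, and for the first-order operator that tells harmonics of different
  degrees apart.\<close>

lemma euler_homogeneous:
  assumes "f \<in> poly_space {n}"
  shows "(\<Sum>b\<in>Basis. (x \<bullet> b) * dir_deriv b f x) = real n * f x"
proof -
  have "poly_space {n} \<subseteq> {f \<in> poly_space {n}. (\<Sum>b\<in>Basis. (x \<bullet> b) * dir_deriv b f x) = real n * f x}"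
    (is "_ \<subseteq> ?V")
  proof (rule poly_space_subset)
    fix e :: "'a \<Rightarrow> nat" assume e: "sum e Basis \<in> {n}"
    have "(x \<bullet> b) * dir_deriv b (monomial_fun e) x = real (e b) * monomial_fun e x"
      if b: "b \<in> Basis" for b
    proof (cases "e b = 0")
      case False
      have "(\<Prod>c\<in>Basis - {b}. (x \<bullet> c) ^ (e(b := e b - 1)) c) = (\<Prod>c\<in>Basis - {b}. (x \<bullet> c) ^ e c)"
        by (rule prod.cong) auto
      moreover have "(x \<bullet> b) ^ e b = (x \<bullet> b) * (x \<bullet> b) ^ (e b - 1)"
        using False by (metis power_minus_mult mult.commute bot_nat_0.not_eq_extremum)
      ultimately have "(x \<bullet> b) * monomial_fun (e(b := e b - 1)) x = monomial_fun e x"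
        using b by (simp add: monomial_fun_def prod.remove[OF _ b])
      then show ?thesis by (simp add: dir_deriv_monomial[OF b])
    qed (simp add: dir_deriv_monomial[OF b])
    then have "(\<Sum>b\<in>Basis. (x \<bullet> b) * dir_deriv b (monomial_fun e) x) =
        (\<Sum>b\<in>Basis. real (e b)) * monomial_fun e x"
      by (simp add: sum_distrib_right)
    then show "monomial_fun e \<in> ?V" using e by (auto intro: monomial_in_poly_space)
  next
    show "subspace ?V"
    proof (rule subspace_funI)
      fix f g assume "f \<in> ?V" "g \<in> ?V"
      then show "(\<lambda>x. f x + g x) \<in> ?V"
        by (simp add: poly_space_add dir_deriv_add[of _ f "{n}" g "{n}"] algebra_simps sum.distrib)
    next
      fix c f assume "f \<in> ?V"
      moreover from this have "(\<Sum>b\<in>Basis. (x \<bullet> b) * dir_deriv b (\<lambda>x. c * f x) x) =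
          c * (\<Sum>b\<in>Basis. (x \<bullet> b) * dir_deriv b f x)"
        unfolding sum_distrib_left
        by (intro sum.cong) (auto simp: dir_deriv_scale[of _ f "{n}"])
      ultimately show "(\<lambda>x. c * f x) \<in> ?V" by (simp add: poly_space_scale)
    qed (simp add: poly_space_zero dir_deriv_zero)
  qed
  then show ?thesis using assms by blast
qed

text \<open>The second derivative at 0 needs the first one along the whole line; it is obtained at
  the parameter s by moving the base point to x + s b.\<close>

lemma laplacian_eq_sum:
  assumes "f \<in> poly_space S"
  shows "laplacian f x = (\<Sum>b\<in>Basis. dir_deriv b (dir_deriv b f) x)"
proof -
  have "deriv (\<lambda>s. f (x + s *\<^sub>R b)) = (\<lambda>s. dir_deriv b f (x + s *\<^sub>R b))" if b: "b \<in> Basis" for b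
  proof
    fix s
    have "((\<lambda>h. f (x + s *\<^sub>R b + h *\<^sub>R b)) has_field_derivative dir_deriv b f (x + s *\<^sub>R b)) (at 0)"
      by (rule poly_has_dir_deriv[OF assms b])
    moreover have "x + s *\<^sub>R b + h *\<^sub>R b = x + (h + s) *\<^sub>R b" for h by (simp add: algebra_simps)
    ultimately have "((\<lambda>h. f (x + h *\<^sub>R b)) has_field_derivative dir_deriv b f (x + s *\<^sub>R b)) (at (0 + s))"
      by (subst DERIV_shift) simp
    then show "deriv (\<lambda>s. f (x + s *\<^sub>R b)) s = dir_deriv b f (x + s *\<^sub>R b)"
      by (simp add: DERIV_imp_deriv)
  qed
  then show ?thesis
    by (simp add: laplacian_def numeral_2_eq_2 dir_deriv_def)
qed

lemma laplacian_poly_space: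
  assumes f: "f \<in> poly_space S" and ST: "\<And>n. Suc (Suc n) \<in> S \<Longrightarrow> n \<in> T"
  shows "laplacian f \<in> poly_space T"
proof -
  have "(\<lambda>x. \<Sum>b\<in>Basis. dir_deriv b (dir_deriv b f) x) \<in> poly_space T"
  proof (rule poly_space_sum)
    fix b :: 'a assume b: "b \<in> Basis"
    show "dir_deriv b (dir_deriv b f) \<in> poly_space T"
      by (rule dir_deriv_poly_space[OF b dir_deriv_poly_space[OF b f, of "{n. Suc n \<in> S}"]])
         (use ST in auto)
  qed
  then show ?thesis using laplacian_eq_sum[OF f, abs_def] by simp
qed

lemma dir_deriv_in_UNIV: "f \<in> poly_space S \<Longrightarrow> b \<in> Basis \<Longrightarrow> dir_deriv b f \<in> poly_space UNIV"
  by (rule dir_deriv_poly_space) auto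

lemma laplacian_add:
  fixes f g :: "'a::euclidean_space \<Rightarrow> real"
  assumes f: "f \<in> poly_space S" and g: "g \<in> poly_space T"
  shows "laplacian (\<lambda>x. f x + g x) x = laplacian f x + laplacian g x"
proof -
  have fg: "f \<in> poly_space UNIV" "g \<in> poly_space UNIV"
    using assms poly_space_mono[OF subset_UNIV] by auto
  show ?thesis
    unfolding laplacian_eq_sum[OF fg(1)] laplacian_eq_sum[OF fg(2)]
      laplacian_eq_sum[OF poly_space_add[OF fg]] sum.distrib[symmetric]
  proof (rule sum.cong[OF refl])
    fix b :: 'a assume b: "b \<in> Basis"
    show "dir_deriv b (dir_deriv b (\<lambda>x. f x + g x)) x =
        dir_deriv b (dir_deriv b f) x + dir_deriv b (dir_deriv b g) x"
      unfolding dir_deriv_add[OF b fg, abs_def]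
      by (rule dir_deriv_add[OF b dir_deriv_in_UNIV dir_deriv_in_UNIV]) (use fg b in auto)
  qed
qed

lemma laplacian_scale:
  fixes f :: "'a::euclidean_space \<Rightarrow> real"
  assumes f: "f \<in> poly_space S"
  shows "laplacian (\<lambda>x. c * f x) x = c * laplacian f x"
  unfolding laplacian_eq_sum[OF f] laplacian_eq_sum[OF poly_space_scale[OF f]] sum_distrib_left
proof (rule sum.cong[OF refl])
  fix b :: 'a assume b: "b \<in> Basis"
  show "dir_deriv b (dir_deriv b (\<lambda>x. c * f x)) x = c * dir_deriv b (dir_deriv b f) x"
    unfolding dir_deriv_scale[OF b f, abs_def]
    by (rule dir_deriv_scale[OF b dir_deriv_in_UNIV[OF f b]])
qed

lemma laplacian_diff:
  assumes f: "f \<in> poly_space S" and g: "g \<in> poly_space T"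
  shows "laplacian (\<lambda>x. f x - g x) x = laplacian f x - laplacian g x"
  using laplacian_add[OF f poly_space_scale[OF g, of "-1"], of x] laplacian_scale[OF g, of "-1" x]
  by simp

lemma laplacian_mult:
  assumes f: "f \<in> poly_space S" and g: "g \<in> poly_space T"
  shows "laplacian (\<lambda>x. f x * g x) x =
    laplacian f x * g x + 2 * (\<Sum>b\<in>Basis. dir_deriv b f x * dir_deriv b g x) + f x * laplacian g x"
proof -
  have fg: "f \<in> poly_space UNIV" "g \<in> poly_space UNIV"
    using assms poly_space_mono[OF subset_UNIV] by auto
  have "dir_deriv b (dir_deriv b (\<lambda>x. f x * g x)) x =
      dir_deriv b (dir_deriv b f) x * g x + 2 * (dir_deriv b f x * dir_deriv b g x) +
      f x * dir_deriv b (dir_deriv b g) x" if b: "b \<in> Basis" for b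
  proof -
    note D = dir_deriv_in_UNIV[OF fg(1) b] dir_deriv_in_UNIV[OF fg(2) b]
    have "dir_deriv b (\<lambda>x. dir_deriv b f x * g x + f x * dir_deriv b g x) x =
      dir_deriv b (\<lambda>x. dir_deriv b f x * g x) x + dir_deriv b (\<lambda>x. f x * dir_deriv b g x) x"
      by (rule dir_deriv_add[OF b poly_space_mult[OF D(1) fg(2), of UNIV]
            poly_space_mult[OF fg(1) D(2), of UNIV]]) auto
    then show ?thesis
      by (simp add: dir_deriv_mult[OF b fg, abs_def] dir_deriv_mult[OF b D(1) fg(2)]
          dir_deriv_mult[OF b fg(1) D(2)])
  qed
  moreover have "(\<lambda>x. f x * g x) \<in> poly_space UNIV"
    using poly_space_mult[OF fg] by auto
  ultimately show ?thesis
    by (simp add: laplacian_eq_sum[where S = UNIV] fg sum.distrib sum_distrib_left sum_distrib_right)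
qed

lemma dir_deriv_norm_power2:
  assumes b: "b \<in> Basis"
  shows "dir_deriv b (\<lambda>x. (norm x)\<^sup>2) x = 2 * (x \<bullet> b)"
proof (rule dir_deriv_eqI)
  have "(norm (x + s *\<^sub>R b))\<^sup>2 = (norm x)\<^sup>2 + 2 * s * (x \<bullet> b) + s\<^sup>2" for s
  proof -
    have "b \<bullet> b = 1" using b by simp
    then show ?thesis
      unfolding power2_norm_eq_inner inner_add_left inner_add_right inner_scaleR_left
        inner_scaleR_right inner_commute[of b x] by (simp add: algebra_simps power2_eq_square)
  qed
  then show "((\<lambda>s. (norm (x + s *\<^sub>R b))\<^sup>2) has_field_derivative 2 * (x \<bullet> b)) (at 0)"
    by (auto intro!: derivative_eq_intros)
qed

lemma laplacian_norm_power2: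
  "laplacian (\<lambda>x. (norm x)\<^sup>2) (x::'a::euclidean_space) = 2 * real DIM('a)"
proof -
  have "dir_deriv b (\<lambda>x. 2 * (x \<bullet> b)) x = 2" if b: "b \<in> Basis" for b :: 'a
    using dir_deriv_scale[OF b poly_space_inner[OF b], of 2] dir_deriv_inner[OF b b] by simp
  moreover have "dir_deriv b (\<lambda>x. (norm x)\<^sup>2) = (\<lambda>x. 2 * (x \<bullet> b))" if b: "b \<in> Basis" for b :: 'a
    using dir_deriv_norm_power2[OF b] by (intro ext) simp
  ultimately show ?thesis
    by (simp add: laplacian_eq_sum[OF poly_space_norm_power2])
qed

text \<open>The gradient of |x|^2 is 2x, so the cross term is four times the Euler operator applied
  to f, that is 4 r f.\<close>

lemma laplacian_norm_mult:
  fixes x :: "'a::euclidean_space"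
  assumes f: "f \<in> poly_space {r}"
  shows "laplacian (\<lambda>x. norm x ^ 2 * f x) x =
    (2 * real DIM('a) + 4 * real r) * f x + norm x ^ 2 * laplacian f x"
proof -
  have "(\<Sum>b\<in>Basis. dir_deriv b (\<lambda>x. norm x ^ 2) x * dir_deriv b f x) = 2 * (real r * f x)"
    unfolding euler_homogeneous[OF f, of x, symmetric] sum_distrib_left
    by (intro sum.cong) (auto simp: dir_deriv_norm_power2)
  then show ?thesis
    unfolding laplacian_mult[OF poly_space_norm_power2 f] laplacian_norm_power2
    by (simp only:) (simp add: algebra_simps)
qed

text \<open>One factor |x|^2 is added at a time. The coefficient A(s) = 2 (s + 1) (2 s + d + 2 r)
  grows by 2 d + 4 (2 (s + 1) + r), the contribution of the new factor.\<close>

lemma laplacian_norm_power_mult: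
  fixes x :: "'a::euclidean_space"
  assumes f: "f \<in> poly_space {r}"
  shows "laplacian (\<lambda>x. norm x ^ (2 * Suc s) * f x) x =
    2 * real (Suc s) * (2 * real s + real DIM('a) + 2 * real r) * norm x ^ (2 * s) * f x +
    norm x ^ (2 * Suc s) * laplacian f x"
proof (induction s arbitrary: x)
  case 0
  show ?case using laplacian_norm_mult[OF f, of x] by (simp add: algebra_simps power2_eq_square)
next
  case (Suc s)
  have g: "(\<lambda>x. norm x ^ (2 * Suc s) * f x) \<in> poly_space {2 * Suc s + r}"
    by (rule poly_space_mult[OF poly_space_norm_power f]) simp
  have "laplacian (\<lambda>x. norm x ^ (2 * Suc (Suc s)) * f x) x =
      laplacian (\<lambda>x. norm x ^ 2 * (norm x ^ (2 * Suc s) * f x)) x"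
    by (simp add: power2_eq_square mult_ac)
  also have "\<dots> = (2 * real DIM('a) + 4 * real (2 * Suc s + r)) * (norm x ^ (2 * Suc s) * f x) +
      norm x ^ 2 * laplacian (\<lambda>x. norm x ^ (2 * Suc s) * f x) x"
    by (rule laplacian_norm_mult[OF g])
  finally show ?case unfolding Suc.IH by (simp add: algebra_simps power2_eq_square)
qed

text \<open>Up to the factor A, the Laplacian of |x|^(2s+2) f is the desired right-hand side, with
  the error |x|^(2s+2) \<Delta>f. As \<Delta>f has degree r - 2, induction removes the error, but
  with s + 1 in place of s; hence the general power although only s = 0 is used later.\<close>

lemma laplacian_norm_mult_surj:
  fixes f :: "'a::euclidean_space \<Rightarrow> real"
  assumes "f \<in> poly_space {r}"
  shows "\<exists>q \<in> poly_space {r}. \<forall>x. laplacian (\<lambda>x. norm x ^ (2 * Suc s) * q x) x = norm x ^ (2 * s) * f x"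
  using assms
proof (induction r arbitrary: s f rule: less_induct)
  case (less r)
  define A where "A = 2 * real (Suc s) * (2 * real s + real DIM('a) + 2 * real r)"
  have "A \<noteq> 0" using DIM_positive[where 'a='a] unfolding A_def
    by (smt (verit) DIM_positive of_nat_0_le_iff of_nat_0_less_iff mult_pos_pos of_nat_Suc)
  have lap: "laplacian (\<lambda>x. norm x ^ (2 * Suc s) * f x) x =
      A * norm x ^ (2 * s) * f x + norm x ^ (2 * Suc s) * laplacian f x" for x
    using laplacian_norm_power_mult[OF less.prems, of s x] by (simp add: A_def)
  \<comment> \<open>The degree set is {r - 2}, or empty when r < 2; in the latter case \<Delta>f = 0
    and q = 0 will do. Written in this way both cases continue alike.\<close>
  obtain q where q: "q \<in> poly_space {n. n + 2 = r}"
    "\<And>x. laplacian (\<lambda>x. norm x ^ (2 * Suc (Suc s)) * q x) x = norm x ^ (2 * Suc s) * laplacian f x"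
  proof (cases "r < 2")
    case True
    have "laplacian f \<in> poly_space {}"
      by (rule laplacian_poly_space[OF less.prems]) (use True in auto)
    then have "laplacian f x = 0" for x by (simp add: poly_space_def)
    then show ?thesis
      using that[of "\<lambda>x. 0"] by (simp add: poly_space_zero laplacian_eq_sum[OF poly_space_zero]
          dir_deriv_zero[abs_def])
  next
    case False
    have eq: "{n. n + 2 = r} = {r - 2}" using False by auto
    have "laplacian f \<in> poly_space {r - 2}"
      by (rule laplacian_poly_space[OF less.prems]) auto
    moreover have "r - 2 < r" using False by simp
    ultimately show ?thesis using less.IH[of "r - 2" "laplacian f" "Suc s"] that unfolding eq by blast
  qed
  have q': "(\<lambda>x. norm x ^ 2 * q x) \<in> poly_space {r}"
    by (rule poly_space_mult[OF poly_space_norm_power2 q(1)]) auto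
  \<comment> \<open>Subtracting |x|^(2s+4) q cancels the error term and leaves A |x|^(2s) f.\<close>
  define Q where "Q = (\<lambda>x. 1 / A * (f x - norm x ^ 2 * q x))"
  have "Q \<in> poly_space {r}"
    unfolding Q_def by (intro poly_space_scale poly_space_diff less.prems q')
  moreover have "laplacian (\<lambda>x. norm x ^ (2 * Suc s) * Q x) x = norm x ^ (2 * s) * f x" for x
  proof -
    have 1: "(\<lambda>x. norm x ^ (2 * Suc s) * f x) \<in> poly_space UNIV"
      by (rule poly_space_mult[OF poly_space_norm_power less.prems]) simp
    have 2: "(\<lambda>x. norm x ^ (2 * Suc (Suc s)) * q x) \<in> poly_space UNIV"
      by (rule poly_space_mult[OF poly_space_norm_power q(1)]) simp
    have "(\<lambda>x. norm x ^ (2 * Suc s) * Q x) =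
        (\<lambda>x. 1 / A * (norm x ^ (2 * Suc s) * f x - norm x ^ (2 * Suc (Suc s)) * q x))"
      by (simp add: Q_def fun_eq_iff algebra_simps power2_eq_square)
    then show ?thesis
      using \<open>A \<noteq> 0\<close>
      by (simp only: laplacian_scale[OF poly_space_diff[OF 1 2]] laplacian_diff[OF 1 2] lap q(2))
         simp
  qed
  ultimately show ?case by blast
qed

text \<open>Surjectivity supplies q of degree n - 2 for which |x|^2 q has the same Laplacian as f.
  Then f - |x|^2 q is harmonic, and the decomposition of q gains one factor |x|^2.\<close>

lemma harmonic_decomposition:
  "(poly_space {n} :: ('a::euclidean_space \<Rightarrow> real) set) \<subseteq> span {\<lambda>x. norm x ^ (2 * p) * h x | p h i.
     h \<in> harmonics i \<and> 2 * p + i = n}"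
proof (induction n rule: less_induct)
  case (less n)
  show ?case
  proof
    fix f :: "'a \<Rightarrow> real" assume f: "f \<in> poly_space {n}"
    let ?G = "\<lambda>n. {\<lambda>x::'a. norm x ^ (2 * p) * h x | p h i. h \<in> harmonics i \<and> 2 * p + i = n}"
    show "f \<in> span (?G n)"
    proof (cases "n < 2")
      case True
      have "laplacian f \<in> poly_space {}"
        by (rule laplacian_poly_space[OF f]) (use True in auto)
      then have "f \<in> harmonics n" using f by (simp add: harmonics_def poly_space_def)
      then have "f \<in> ?G n" by (intro CollectI exI[of _ 0] exI[of _ f] exI[of _ n]) simp
      then show ?thesis by (rule span_base)
    next
      case False
      have "laplacian f \<in> poly_space {n - 2}" by (rule laplacian_poly_space[OF f]) auto
      from laplacian_norm_mult_surj[OF this, of 0] obtain q where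
        q: "q \<in> poly_space {n - 2}" "\<And>x. laplacian (\<lambda>x. norm x ^ 2 * q x) x = laplacian f x"
        by auto
      have q': "(\<lambda>x. norm x ^ 2 * q x) \<in> poly_space {n}"
        by (rule poly_space_mult[OF poly_space_norm_power2 q(1)]) (use False in auto)
      define h where "h = (\<lambda>x. f x - norm x ^ 2 * q x)"
      have "h \<in> harmonics n"
        using laplacian_diff[OF f q'] q(2) poly_space_diff[OF f q'] by (simp add: h_def harmonics_def)
      then have "h \<in> ?G n" by (intro CollectI exI[of _ 0] exI[of _ h] exI[of _ n]) simp
      then have h: "h \<in> span (?G n)" by (rule span_base)
      have "span (?G (n - 2)) \<subseteq> {g. (\<lambda>x. g x * norm x ^ 2) \<in> span (?G n)}"
      proof (rule span_minimal)
        show "?G (n - 2) \<subseteq> {g. (\<lambda>x. g x * norm x ^ 2) \<in> span (?G n)}"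
        proof clarify
          fix p i and h :: "'a \<Rightarrow> real" assume *: "h \<in> harmonics i" "2 * p + i = n - 2"
          have "(\<lambda>x. norm x ^ (2 * p) * h x * norm x ^ 2) = (\<lambda>x. norm x ^ (2 * Suc p) * h x)"
            by (simp add: fun_eq_iff power2_eq_square)
          moreover have "2 * Suc p + i = n" using * False by simp
          ultimately show "(\<lambda>x. norm x ^ (2 * p) * h x * norm x ^ 2) \<in> span (?G n)"
            using *(1) by (intro span_base CollectI exI[of _ "Suc p"] exI[of _ h] exI[of _ i]) simp
        qed
      qed (rule subspace_mult_vimage[OF subspace_span])
      then have "(\<lambda>x. q x * norm x ^ 2) \<in> span (?G n)"
        using less.IH[of "n - 2"] q(1) False by auto
      from subspace_fun_add[OF subspace_span h this] show ?thesis
        by (simp add: h_def mult.commute)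
    qed
  qed
qed

section \<open>Polar coordinates\<close>

text \<open>Used for image measures under x \<mapsto> |x| and r \<mapsto> r^2, where the mass of a
  half-line is easily computed. Finiteness on half-lines provides the exhausting sequence for
  uniqueness on an intersection-stable generator.\<close>

lemma measure_eqI_lessThan_finite:
  fixes M N :: "real measure"
  assumes sets: "sets M = sets borel" "sets N = sets borel"
    and fin: "\<And>R. emeasure M {..<R} < \<infinity>"
    and eq: "\<And>R. emeasure M {..<R} = emeasure N {..<R}"
  shows "M = N"
proof (rule measure_eqI_generator_eq[where E = "range lessThan" and \<Omega> = UNIV
      and A = "\<lambda>i. {..<real i}"])
  show "Int_stable (range lessThan :: real set set)"
    by (auto simp: Int_stable_def lessThan_Int_lessThan image_iff intro: exI[of _ "min _ _"])
  have "sets borel = sigma_sets UNIV (range lessThan :: real set set)"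
  proof -
    have "(borel :: real measure) = sigma UNIV (range lessThan)"
      by (rule borel_eq_sigmaI1[OF borel_eq_lessThan[unfolded eucl_less_def]])
        (auto simp: lessThan_def)
    then have "sets (borel :: real measure) = sets (sigma UNIV (range lessThan))" by (rule arg_cong)
    also have "\<dots> = sigma_sets UNIV (range lessThan)" by (rule sets_measure_of) auto
    finally show ?thesis .
  qed
  then show "sets M = sigma_sets UNIV (range lessThan)" "sets N = sigma_sets UNIV (range lessThan)"
    using sets by auto
  show "(\<Union>i. {..<real i}) = UNIV"
    using reals_Archimedean2 by auto
qed (use fin eq in \<open>auto simp: less_top\<close>)

lemma sphere_measure_sets [simp, measurable_cong]: "sets sphere_measure = sets borel"
  by (simp add: sphere_measure_def)

lemma space_sphere_measure [simp]: "space sphere_measure = UNIV"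
  using sets_eq_imp_space_eq[OF sphere_measure_sets] by simp

lemma emeasure_sphere_measure:
  assumes A: "A \<in> sets borel"
  shows "emeasure (sphere_measure :: 'a::euclidean_space measure) A =
    ennreal (real DIM('a)) * emeasure lborel {x::'a. norm x < 1 \<and> x /\<^sub>R norm x \<in> A}"
proof -
  have [measurable]: "(\<lambda>x::'a. x /\<^sub>R norm x) \<in> borel_measurable borel" by measurable
  note [measurable] = A
  have "emeasure (distr (restrict_space lborel (ball 0 1)) borel (\<lambda>x::'a. x /\<^sub>R norm x)) A =
      emeasure (restrict_space lborel (ball 0 1)) ((\<lambda>x::'a. x /\<^sub>R norm x) -` A \<inter> ball 0 1)"
    by (subst emeasure_distr) (auto simp: space_restrict_space intro: measurable_restrict_space1)
  also have "\<dots> = emeasure lborel ((\<lambda>x::'a. x /\<^sub>R norm x) -` A \<inter> ball 0 1)"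
    by (rule emeasure_restrict_space) auto
  also have "(\<lambda>x::'a. x /\<^sub>R norm x) -` A \<inter> ball 0 1 = {x::'a. norm x < 1 \<and> x /\<^sub>R norm x \<in> A}"
    by auto
  finally show ?thesis by (simp add: sphere_measure_def)
qed

lemma finite_measure_sphere_measure: "finite_measure (sphere_measure :: 'a::euclidean_space measure)"
proof
  have "{x::'a. norm x < 1} = ball 0 1" by auto
  then show "emeasure (sphere_measure :: 'a measure) (space sphere_measure) \<noteq> \<infinity>"
    using emeasure_bounded_finite[of "ball (0::'a) 1"]
    by (simp add: emeasure_sphere_measure ennreal_mult_eq_top_iff)
qed

lemma AE_sphere_measure_norm:
  "AE x in (sphere_measure :: 'a::euclidean_space measure). norm x = 1"
proof (rule AE_I')
  show "{x::'a. norm x \<noteq> 1} \<in> null_sets sphere_measure"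
  proof -
    \<comment> \<open>The origin is mapped to 0 by the convention for division by zero, and it is
      the only point whose image leaves the sphere.\<close>
    have "{x::'a. norm x < 1 \<and> x /\<^sub>R norm x \<in> {x. norm x \<noteq> 1}} = {0}"
      by (auto simp: field_simps)
    moreover have "{x::'a. norm x \<noteq> 1} \<in> sets borel" by measurable
    ultimately show ?thesis by (simp add: null_sets_def emeasure_sphere_measure)
  qed
qed auto

text \<open>Besides d = \<open>DIM('a)\<close> for polar coordinates, the cases d = 1 and d = 2
  occur in the substitution s = r^2.\<close>

definition radial_measure :: "nat \<Rightarrow> real measure" where
  "radial_measure d = density lborel (\<lambda>r. ennreal (r ^ (d - 1)) * indicator {0<..} r)"

lemma radial_measure_sets [simp, measurable_cong]: "sets (radial_measure d) = sets borel"
  by (simp add: radial_measure_def)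

lemma emeasure_radial_measure:
  assumes "d > 0"
  shows "emeasure (radial_measure d) {..<R} = ennreal ((max 0 R) ^ d / real d)"
proof -
  have "emeasure (radial_measure d) {..<R} =
      (\<integral>\<^sup>+r. ennreal (r ^ (d - 1)) * indicator {0<..} r * indicator {..<R} r \<partial>lborel)"
    by (simp add: radial_measure_def emeasure_density)
  also have "\<dots> = (\<integral>\<^sup>+r. ennreal (r ^ (d - 1)) * indicator {0..max 0 R} r \<partial>lborel)"
  proof (rule nn_integral_cong_AE)
    show "AE r in lborel. ennreal (r ^ (d - 1)) * indicator {0<..} r * indicator {..<R} r =
        ennreal (r ^ (d - 1)) * indicator {0..max 0 R} r"
      using AE_lborel_singleton[of 0] AE_lborel_singleton[of R]
      by eventually_elim (auto simp: indicator_def max_def)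
  qed
  also have "\<dots> = ennreal ((max 0 R) ^ d / real d - 0 ^ d / real d)"
    by (rule nn_integral_FTC_Icc[where F = "\<lambda>r. r ^ d / real d"])
      (use assms in \<open>auto intro!: derivative_eq_intros\<close>)
  finally show ?thesis using assms by (simp add: zero_power)
qed

lemma sigma_finite_radial_measure: "sigma_finite_measure (radial_measure d)"
  unfolding radial_measure_def
  by (rule sigma_finite_measure.sigma_finite_iff_density_finite[OF sigma_finite_lborel, THEN iffD2])
     (auto simp: ennreal_mult_eq_top_iff split: split_indicator)

text \<open>Fix the set A of directions. Dilation by R multiplies the volume of the truncated cone
  over A by R^d, and \<open>sphere_measure\<close> is d times the volume for R = 1. This determines
  the distribution of |x| on the cone from its half-lines, and rectangles determine the product
  measure.\<close>

lemma polar_coordinates: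
  "distr (lborel :: 'a::euclidean_space measure) (borel \<Otimes>\<^sub>M borel) (\<lambda>x. (x /\<^sub>R norm x, norm x)) =
    sphere_measure \<Otimes>\<^sub>M radial_measure DIM('a)"
proof (rule pair_measure_eqI[symmetric])
  let ?D = "distr (lborel :: 'a measure) (borel \<Otimes>\<^sub>M borel) (\<lambda>x. (x /\<^sub>R norm x, norm x))"
  interpret S: finite_measure "sphere_measure :: 'a measure" by (rule finite_measure_sphere_measure)
  show "sigma_finite_measure (sphere_measure :: 'a measure)" ..
  show "sigma_finite_measure (radial_measure DIM('a))" by (rule sigma_finite_radial_measure)
  show "sets (sphere_measure \<Otimes>\<^sub>M radial_measure DIM('a)) = sets ?D"
    by (simp cong: sets_pair_measure_cong)
  fix A :: "'a set" and B :: "real set"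
  assume "A \<in> sets sphere_measure" "B \<in> sets (radial_measure DIM('a))"
  then have [measurable]: "A \<in> sets borel" "B \<in> sets borel" by auto
  \<comment> \<open>M is the distribution of |x| over the points with direction in A, and N is what
    the product formula predicts for it. Equality of the two gives every B at once.\<close>
  define M where "M = distr (density lborel (\<lambda>x::'a. indicator A (x /\<^sub>R norm x))) borel norm"
  define N where "N = scale_measure (emeasure (sphere_measure :: 'a measure) A) (radial_measure DIM('a))"
  have emM: "emeasure M C = emeasure lborel {x::'a. norm x \<in> C \<and> x /\<^sub>R norm x \<in> A}"
    if [measurable]: "C \<in> sets borel" for C
  proof -
    have [measurable]: "(norm :: 'a \<Rightarrow> real) -` C \<in> sets borel"
      by (rule measurable_sets_borel[OF _ that]) simp
    have "emeasure M C = (\<integral>\<^sup>+x. indicator A (x /\<^sub>R norm x) * indicator (norm -` C) x \<partial>lborel)"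
      unfolding M_def by (subst emeasure_distr; simp add: emeasure_density)
    also have "\<dots> = (\<integral>\<^sup>+x. indicator {x::'a. norm x \<in> C \<and> x /\<^sub>R norm x \<in> A} x \<partial>lborel)"
      by (intro nn_integral_cong) (auto split: split_indicator)
    also have "\<dots> = emeasure lborel {x::'a. norm x \<in> C \<and> x /\<^sub>R norm x \<in> A}" by simp
    finally show ?thesis .
  qed
  have eq: "emeasure M {..<R} = ennreal ((max 0 R) ^ DIM('a) / real DIM('a)) * emeasure (sphere_measure :: 'a measure) A" for R
  proof (cases "R > 0")
    case False
    then have "\<not> norm x < R" for x :: 'a
      using norm_ge_zero[of x] by linarith
    then have "emeasure M {..<R} = 0" by (simp add: emM)
    moreover have "max 0 R = 0" using False by simp
    ultimately show ?thesis by (simp add: zero_power)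
  next
    case True
    have "emeasure M {..<R} = emeasure lborel {x::'a. norm x < R \<and> x /\<^sub>R norm x \<in> A}"
      by (simp add: emM)
    also have "\<dots> = emeasure (density (distr lborel borel (\<lambda>x. 0 + R *\<^sub>R x)) (\<lambda>_. \<bar>R\<bar> ^ DIM('a)))
        {x::'a. norm x < R \<and> x /\<^sub>R norm x \<in> A}"
      using True lborel_affine[of R "0::'a"] by simp
    also have "\<dots> = ennreal (R ^ DIM('a)) *
        emeasure lborel ((\<lambda>x. R *\<^sub>R x) -` {x::'a. norm x < R \<and> x /\<^sub>R norm x \<in> A})"
      using True by (simp add: emeasure_density_const emeasure_distr)
    also have "(\<lambda>x. R *\<^sub>R x) -` {x::'a. norm x < R \<and> x /\<^sub>R norm x \<in> A} =
        {x::'a. norm x < 1 \<and> x /\<^sub>R norm x \<in> A}"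
      using True by (auto simp: field_simps)
    finally show ?thesis
      using True by (simp add: emeasure_sphere_measure max_def mult.assoc[symmetric]
          ennreal_mult'[symmetric] mult.commute)
  qed
  have "M = N"
  proof (rule measure_eqI_lessThan_finite)
    show "emeasure M {..<R} < \<infinity>" for R
      unfolding eq
      by (simp add: ennreal_mult_eq_top_iff less_top[symmetric])
    show "emeasure M {..<R} = emeasure N {..<R}" for R
      unfolding eq by (simp add: N_def emeasure_radial_measure mult.commute)
  qed (auto simp: M_def N_def)
  moreover have "emeasure ?D (A \<times> B) = emeasure lborel {x::'a. norm x \<in> B \<and> x /\<^sub>R norm x \<in> A}"
    by (subst emeasure_distr) (auto intro!: arg_cong[where f = "emeasure lborel"])
  ultimately show "emeasure sphere_measure A * emeasure (radial_measure DIM('a)) B = emeasure ?D (A \<times> B)"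
    using emM[of B] by (simp add: N_def)
qed

lemma nn_integral_polar:
  fixes f :: "'a::euclidean_space \<Rightarrow> ennreal"
  assumes [measurable]: "f \<in> borel_measurable borel"
  shows "(\<integral>\<^sup>+x. f x \<partial>lborel) =
    (\<integral>\<^sup>+\<omega>. \<integral>\<^sup>+r. ennreal (r ^ (DIM('a) - 1)) * indicator {0<..} r * f (r *\<^sub>R \<omega>) \<partial>lborel \<partial>sphere_measure)"
proof -
  interpret R: sigma_finite_measure "radial_measure DIM('a)" by (rule sigma_finite_radial_measure)
  have "(\<integral>\<^sup>+x. f x \<partial>lborel) = (\<integral>\<^sup>+x. (\<lambda>(\<omega>, r). f (r *\<^sub>R \<omega>)) (x /\<^sub>R norm x, norm x) \<partial>lborel)"
  proof (intro nn_integral_cong)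
    fix x :: 'a
    show "f x = (\<lambda>(\<omega>, r). f (r *\<^sub>R \<omega>)) (x /\<^sub>R norm x, norm x)" by (cases "x = 0") auto
  qed
  also have "\<dots> = (\<integral>\<^sup>+z. (\<lambda>(\<omega>, r). f (r *\<^sub>R \<omega>)) z
      \<partial>distr (lborel :: 'a measure) (borel \<Otimes>\<^sub>M borel) (\<lambda>x. (x /\<^sub>R norm x, norm x)))"
    by (subst nn_integral_distr) auto
  also have "\<dots> = (\<integral>\<^sup>+\<omega>. \<integral>\<^sup>+r. f (r *\<^sub>R \<omega>) \<partial>radial_measure DIM('a) \<partial>sphere_measure)"
    unfolding polar_coordinates by (subst R.nn_integral_fst[symmetric]) auto
  also have "\<dots> = (\<integral>\<^sup>+\<omega>. \<integral>\<^sup>+r. ennreal (r ^ (DIM('a) - 1)) * indicator {0<..} r * f (r *\<^sub>R \<omega>) \<partial>lborel \<partial>sphere_measure)"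
    by (simp add: radial_measure_def nn_integral_density)
  finally show ?thesis .
qed

section \<open>Orthogonality of harmonics of different degrees\<close>

definition gauss :: "'a::euclidean_space \<Rightarrow> real" where
  "gauss x = (\<Prod>b\<in>Basis. std_normal_density (x \<bullet> b))"

definition normal_moment :: "nat \<Rightarrow> real" where
  "normal_moment k = (\<integral>x. std_normal_density x * x ^ k \<partial>lborel)"

text \<open>One of the d normalising constants is absorbed into the one-dimensional density at |x|,
  which explains the exponent d - 1.\<close>

lemma gauss_radial:
  "gauss (x::'a::euclidean_space) = (1 / sqrt (2 * pi)) ^ (DIM('a) - 1) * std_normal_density (norm x)"
proof -
  have "gauss x = (\<Prod>b\<in>(Basis::'a set). 1 / sqrt (2 * pi)) * (\<Prod>b\<in>Basis. exp (- (x \<bullet> b)\<^sup>2 / 2))"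
    unfolding gauss_def std_normal_density_def prod.distrib ..
  also have "(\<Prod>b\<in>Basis. exp (- (x \<bullet> b)\<^sup>2 / 2)) = exp (- (norm x)\<^sup>2 / 2)"
    by (simp add: exp_sum[symmetric] norm_power2_eq_sum sum_negf sum_divide_distrib)
  also have "(\<Prod>b\<in>(Basis::'a set). 1 / sqrt (2 * pi)) = (1 / sqrt (2 * pi)) ^ (DIM('a) - 1) * (1 / sqrt (2 * pi))"
    using DIM_positive[where 'a = 'a] by (metis prod_constant power_minus_mult)
  finally show ?thesis by (simp add: std_normal_density_def mult.assoc)
qed

text \<open>One-variable integration by parts, read off from the closed formulas for even and odd
  moments. For k = 0 the truncated index is multiplied by 0.\<close>

lemma normal_moment_Suc: "normal_moment (Suc k) = real k * normal_moment (k - 1)"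
proof (cases "even k")
  case True
  then obtain j where k: "k = 2 * j" by blast
  have "normal_moment (Suc k) = 0"
    using integral_std_normal_moment_odd[of j] by (simp add: normal_moment_def k)
  moreover have "normal_moment (k - 1) = 0" if "j > 0"
  proof -
    have "k - 1 = 2 * (j - 1) + 1" using that by (simp add: k)
    then show ?thesis
      using integral_std_normal_moment_odd[of "j - 1"] unfolding normal_moment_def by simp
  qed
  ultimately show ?thesis by (cases "j = 0") (auto simp: k)
next
  case False
  then obtain j where k: "k = 2 * j + 1" using oddE by blast
  have "normal_moment (Suc k) = fact (2 * Suc j) / (2 ^ Suc j * fact (Suc j))"
    using integral_std_normal_moment_even[of "Suc j"] by (simp add: normal_moment_def k)
  also have "\<dots> = real k * (fact (2 * j) / (2 ^ j * fact j))"
  proof -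
    have "(fact (2 * Suc j) :: real) = real (2 * j + 2) * (real (2 * j + 1) * fact (2 * j))"
      by (simp add: algebra_simps)
    moreover have "(fact (Suc j) :: real) = real (Suc j) * fact j" by simp
    ultimately show ?thesis by (simp add: k divide_simps del: fact_Suc)
  qed
  also have "fact (2 * j) / (2 ^ j * fact j) = normal_moment (k - 1)"
    using integral_std_normal_moment_even[of j] by (simp add: normal_moment_def k)
  finally show ?thesis .
qed

lemma monomial_gauss_integral:
  fixes e :: "'a::euclidean_space \<Rightarrow> nat"
  shows "integrable lborel (\<lambda>x. monomial_fun e x * gauss x)"
    and "(\<integral>x. monomial_fun e x * gauss x \<partial>lborel) = (\<Prod>b\<in>Basis. normal_moment (e b))"
proof -
  interpret product_sigma_finite "\<lambda>_::'a. lborel :: real measure" ..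
  let ?P = "\<Pi>\<^sub>M b\<in>(Basis::'a set). (lborel :: real measure)"
  let ?T = "\<lambda>f. \<Sum>b\<in>Basis. f b *\<^sub>R b :: 'a"
  have lborel: "(lborel :: 'a measure) = distr ?P borel ?T" by (rule lborel_eq)
  have T[measurable]: "?T \<in> measurable ?P borel" by measurable
  have meas[measurable]: "(\<lambda>x. monomial_fun e x * gauss x) \<in> borel_measurable borel"
    unfolding monomial_fun_def gauss_def by measurable
  have eq: "monomial_fun e (?T f) * gauss (?T f) = (\<Prod>b\<in>Basis. std_normal_density (f b) * f b ^ e b)" for f
    by (simp add: monomial_fun_def gauss_def prod.distrib[symmetric] mult.commute inner_sum_left_Basis)
  have "integrable ?P (\<lambda>f. \<Prod>b\<in>Basis. std_normal_density (f b) * f b ^ e b)"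
    by (rule product_integrable_prod) (auto intro: integrable_std_normal_moment)
  then show "integrable lborel (\<lambda>x. monomial_fun e x * gauss x)"
    unfolding lborel by (subst integrable_distr_eq) (auto simp: eq)
  have "(\<integral>x. monomial_fun e x * gauss x \<partial>lborel) =
      (\<integral>f. (\<Prod>b\<in>Basis. std_normal_density (f b) * f b ^ e b) \<partial>?P)"
    unfolding lborel by (subst integral_distr) (auto simp: eq)
  also have "\<dots> = (\<Prod>b\<in>Basis. \<integral>x. std_normal_density x * x ^ e b \<partial>lborel)"
    by (rule product_integral_prod) (auto intro: integrable_std_normal_moment)
  finally show "(\<integral>x. monomial_fun e x * gauss x \<partial>lborel) = (\<Prod>b\<in>Basis. normal_moment (e b))"
    by (simp add: normal_moment_def)
qed

lemma integrable_poly_gauss: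
  assumes "f \<in> poly_space S"
  shows "integrable lborel (\<lambda>x. f x * gauss x)"
proof -
  have "poly_space S \<subseteq> {f. integrable lborel (\<lambda>x. f x * gauss x)}"
    by (rule poly_space_subset)
       (auto simp: monomial_gauss_integral(1) distrib_right mult.assoc intro!: subspace_funI)
  then show ?thesis using assms by blast
qed

text \<open>For a monomial both integrals factor over the coordinates and differ only in the moment
  of index b, where the recursion between moments applies.\<close>

lemma gauss_integration_by_parts:
  fixes b :: "'a::euclidean_space"
  assumes f: "f \<in> poly_space S" and b: "b \<in> Basis"
  shows "(\<integral>x. dir_deriv b f x * gauss x \<partial>lborel) = (\<integral>x. (x \<bullet> b) * f x * gauss x \<partial>lborel)"
proof -
  have "poly_space S \<subseteq> {f \<in> poly_space S. (\<integral>x. dir_deriv b f x * gauss x \<partial>lborel) =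
      (\<integral>x. (x \<bullet> b) * f x * gauss x \<partial>lborel)}" (is "_ \<subseteq> ?V")
  proof (rule poly_space_subset)
    fix e :: "'a \<Rightarrow> nat" assume e: "sum e Basis \<in> S"
    define R where "R = (\<Prod>c\<in>Basis - {b}. normal_moment (e c))"
    have R: "(\<Prod>c\<in>Basis. normal_moment ((e(b := k)) c)) = normal_moment k * R" for k
    proof -
      have "(\<Prod>c\<in>Basis - {b}. normal_moment ((e(b := k)) c)) = R"
        unfolding R_def by (rule prod.cong) auto
      then show ?thesis by (simp add: prod.remove[OF _ b])
    qed
    have "(\<integral>x. dir_deriv b (monomial_fun e) x * gauss x \<partial>lborel) =
        real (e b) * (\<integral>x. monomial_fun (e(b := e b - 1)) x * gauss x \<partial>lborel)"
      by (simp add: dir_deriv_monomial[OF b] mult.assoc)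
    also have "\<dots> = normal_moment (Suc (e b)) * R"
      unfolding monomial_gauss_integral(2) R normal_moment_Suc by simp
    also have "\<dots> = (\<integral>x. monomial_fun (e(b := Suc (e b))) x * gauss x \<partial>lborel)"
      unfolding monomial_gauss_integral(2) R by simp
    also have "(\<lambda>x. monomial_fun (e(b := Suc (e b))) x * gauss x) =
        (\<lambda>x. (x \<bullet> b) * monomial_fun e x * gauss x)"
    proof
      fix x
      have "(\<Prod>c\<in>Basis - {b}. (x \<bullet> c) ^ (e(b := Suc (e b))) c) = (\<Prod>c\<in>Basis - {b}. (x \<bullet> c) ^ e c)"
        by (rule prod.cong) auto
      then show "monomial_fun (e(b := Suc (e b))) x * gauss x = (x \<bullet> b) * monomial_fun e x * gauss x"
        by (simp add: monomial_fun_def prod.remove[OF _ b])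
    qed
    finally show "monomial_fun e \<in> ?V" using e by (auto intro: monomial_in_poly_space)
  next
    have int: "integrable lborel (\<lambda>x. (x \<bullet> b) * f x * gauss x)"
      "integrable lborel (\<lambda>x. dir_deriv b f x * gauss x)" if "f \<in> poly_space S" for f
      using poly_space_mult[OF poly_space_inner[OF b] that, of UNIV] dir_deriv_in_UNIV[OF that b]
      by (auto intro: integrable_poly_gauss)
    show "subspace ?V"
    proof (rule subspace_funI)
      fix f g assume "f \<in> ?V" "g \<in> ?V"
      then show "(\<lambda>x. f x + g x) \<in> ?V"
        using int[of f] int[of g]
        by (simp add: poly_space_add dir_deriv_add[OF b, of f S g S] distrib_left distrib_right)
    next
      fix c f assume "f \<in> ?V"
      then show "(\<lambda>x. c * f x) \<in> ?V"
        by (simp add: poly_space_scale dir_deriv_scale[OF b, of f S] mult.assoc mult.left_commute[of _ c])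
    qed (simp add: poly_space_zero dir_deriv_zero)
  qed
  then show ?thesis using f by blast
qed

lemma harmonics_poly_space: "h \<in> harmonics i \<Longrightarrow> h \<in> poly_space {i}"
  by (simp add: harmonics_def)

text \<open>
  On a homogeneous harmonic polynomial of degree \<open>i\<close> the operator $x\cdot\nabla - \Delta$, symmetric
  for the Gaussian weight, acts as multiplication by \<open>i\<close>.
\<close>

lemma harmonics_gauss_orthogonal:
  fixes f g :: "'a::euclidean_space \<Rightarrow> real"
  assumes f: "f \<in> harmonics i" and g: "g \<in> harmonics j" and "i \<noteq> j"
  shows "(\<integral>x. f x * g x * gauss x \<partial>lborel) = 0"
proof -
  \<comment> \<open>Euler's identity produces the factor i, integration by parts turns it into
    second derivatives of f plus a product of gradients, and the former add up to \<Delta>f = 0.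
    What remains is symmetric in f and g, so i and j times the integral coincide.\<close>
  have *: "real i * (\<integral>x. f x * g x * gauss x \<partial>lborel) =
      (\<Sum>b\<in>Basis. \<integral>x. dir_deriv b f x * dir_deriv b g x * gauss x \<partial>lborel)"
    if f: "f \<in> harmonics i" and g: "g \<in> harmonics j" for f g :: "'a \<Rightarrow> real" and i j
  proof -
    note F = harmonics_poly_space[OF f] and G = harmonics_poly_space[OF g]
    have mult: "(\<lambda>x. p x * q x) \<in> poly_space UNIV"
      if "p \<in> poly_space S" "q \<in> poly_space T" for p q :: "'a \<Rightarrow> real" and S T
      using that by (rule poly_space_mult) simp
    have DF: "dir_deriv b f \<in> poly_space UNIV" and DG: "dir_deriv b g \<in> poly_space UNIV"
      and DDF: "dir_deriv b (dir_deriv b f) \<in> poly_space UNIV" if "b \<in> Basis" for b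
      using dir_deriv_in_UNIV that F G by blast+
    have "real i * (\<integral>x. f x * g x * gauss x \<partial>lborel) =
        (\<integral>x. (\<Sum>b\<in>Basis. (x \<bullet> b) * (dir_deriv b f x * g x) * gauss x) \<partial>lborel)"
    proof -
      have "real i * (f x * g x * gauss x) =
          (\<Sum>b\<in>Basis. (x \<bullet> b) * (dir_deriv b f x * g x) * gauss x)" for x
      proof -
        have "real i * f x * (g x * gauss x) =
            (\<Sum>b\<in>Basis. (x \<bullet> b) * dir_deriv b f x) * (g x * gauss x)"
          by (simp only: euler_homogeneous[OF F])
        then show ?thesis by (simp only: sum_distrib_right mult.assoc)
      qed
      then show ?thesis by (simp only: integral_mult_right_zero[symmetric])
    qed
    also have "\<dots> = (\<Sum>b\<in>Basis. \<integral>x. (x \<bullet> b) * (dir_deriv b f x * g x) * gauss x \<partial>lborel)"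
      by (rule Bochner_Integration.integral_sum)
         (rule integrable_poly_gauss[OF mult[OF poly_space_inner mult[OF DF G]]])
    also have "\<dots> = (\<Sum>b\<in>Basis. \<integral>x. dir_deriv b (\<lambda>x. dir_deriv b f x * g x) x * gauss x \<partial>lborel)"
      by (rule sum.cong[OF refl], rule gauss_integration_by_parts[symmetric])
         (rule mult[OF DF G])
    also have "\<dots> = (\<Sum>b\<in>Basis. \<integral>x. dir_deriv b (dir_deriv b f) x * g x * gauss x +
        dir_deriv b f x * dir_deriv b g x * gauss x \<partial>lborel)"
      by (intro sum.cong refl Bochner_Integration.integral_cong)
         (simp add: dir_deriv_mult[OF _ DF G] distrib_right)
    also have "\<dots> = (\<Sum>b\<in>Basis. (\<integral>x. dir_deriv b (dir_deriv b f) x * g x * gauss x \<partial>lborel) +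
        (\<integral>x. dir_deriv b f x * dir_deriv b g x * gauss x \<partial>lborel))"
      by (intro sum.cong refl Bochner_Integration.integral_add
          integrable_poly_gauss[OF mult[OF DDF G]] integrable_poly_gauss[OF mult[OF DF DG]])
    also have "\<dots> = (\<integral>x. (\<Sum>b\<in>Basis. dir_deriv b (dir_deriv b f) x * g x * gauss x) \<partial>lborel) +
        (\<Sum>b\<in>Basis. \<integral>x. dir_deriv b f x * dir_deriv b g x * gauss x \<partial>lborel)"
      unfolding sum.distrib
      by (subst Bochner_Integration.integral_sum) (auto intro!: integrable_poly_gauss[OF mult[OF DDF G]])
    also have "(\<lambda>x. \<Sum>b\<in>Basis. dir_deriv b (dir_deriv b f) x * g x * gauss x) = (\<lambda>x. 0)"
      using f by (simp add: sum_distrib_right[symmetric] laplacian_eq_sum[OF F, symmetric] harmonics_def)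
    finally show ?thesis by simp
  qed
  have "real i * (\<integral>x. f x * g x * gauss x \<partial>lborel) = real j * (\<integral>x. f x * g x * gauss x \<partial>lborel)"
    using *[OF f g] *[OF g f] by (simp add: mult.commute)
  then show ?thesis using \<open>i \<noteq> j\<close> by simp
qed

text \<open>In polar coordinates f contributes r^p times its value in the direction \<omega>, and
  the Gaussian depends on r alone. The radial factor involves f only through p and is positive, so
  the integral over the space vanishes exactly when the one over the sphere does.\<close>

lemma integral_gauss_homogeneous:
  fixes f :: "'a::euclidean_space \<Rightarrow> real"
  assumes f: "f \<in> poly_space {p}"
  shows "(\<integral>x. f x * gauss x \<partial>lborel) = (\<integral>\<omega>. f \<omega> \<partial>sphere_measure) *
    ((1 / sqrt (2 * pi)) ^ (DIM('a) - 1) * (\<integral>r. r ^ p * std_normal_density r \<partial>radial_measure DIM('a)))"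
proof -
  let ?S = "sphere_measure :: 'a measure" and ?R = "radial_measure DIM('a)"
  let ?C = "(1 / sqrt (2 * pi)) ^ (DIM('a) - 1) :: real"
  let ?h = "\<lambda>(\<omega>, r). f \<omega> * (?C * (r ^ p * std_normal_density r))"
  interpret S: finite_measure ?S by (rule finite_measure_sphere_measure)
  interpret R: sigma_finite_measure ?R by (rule sigma_finite_radial_measure)
  interpret pair_sigma_finite ?S ?R ..
  have [measurable]: "f \<in> borel_measurable borel" by (rule borel_measurable_poly_space[OF f])
  have h: "?h (x /\<^sub>R norm x, norm x) = f x * gauss x" for x
  proof -
    have "f x = norm x ^ p * f (x /\<^sub>R norm x)"
      using poly_space_homogeneous[OF f, of "norm x" "x /\<^sub>R norm x"] by (cases "x = 0") auto
    then show ?thesis by (simp add: gauss_radial)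
  qed
  have "(\<integral>x. f x * gauss x \<partial>lborel) = (\<integral>z. ?h z \<partial>(?S \<Otimes>\<^sub>M ?R))"
    unfolding polar_coordinates[symmetric] h[symmetric] by (subst integral_distr) auto
  moreover have "integrable (?S \<Otimes>\<^sub>M ?R) ?h"
    unfolding polar_coordinates[symmetric]
    by (subst integrable_distr_eq) (auto simp: h[simplified] intro: integrable_poly_gauss[OF f])
  ultimately show ?thesis
    by (simp add: integral_fst'[symmetric])
qed

lemma radial_normal_moment_pos:
  assumes "d > 0"
  shows "(\<integral>r. r ^ p * std_normal_density r \<partial>radial_measure d) > 0"
proof -
  have "(\<integral>r. r ^ p * std_normal_density r \<partial>radial_measure d) =
      (\<integral>r. r ^ (d - 1) * indicator {0<..} r * (r ^ p * std_normal_density r) \<partial>lborel)"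
  proof -
    have "radial_measure d = density lborel (\<lambda>r. ennreal (r ^ (d - 1) * indicator {0<..} r))"
      unfolding radial_measure_def by (intro density_cong) (auto split: split_indicator)
    then show ?thesis by (simp add: integral_density split: split_indicator)
  qed
  also have "\<dots> = (\<integral>r. indicator {0<..} r *\<^sub>R (std_normal_density r * r ^ (d - 1 + p)) \<partial>lborel)"
    by (simp add: power_add mult_ac)
  also have "\<dots> > 0"
  proof -
    let ?f = "\<lambda>r::real. indicator {0<..} r *\<^sub>R (std_normal_density r * r ^ (d - 1 + p))"
    have int: "integrable lborel ?f"
      by (intro integrable_mult_indicator integrable_std_normal_moment) simp
    have nonneg: "AE r in lborel. 0 \<le> ?f r" by (auto split: split_indicator)
    have "integral\<^sup>L lborel ?f \<noteq> 0"
    proof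
      assume "integral\<^sup>L lborel ?f = 0"
      then have "AE r in lborel. ?f r = 0"
        using integral_nonneg_eq_0_iff_AE[OF int nonneg] by simp
      then have "AE r in lborel. r \<notin> {0<..<1::real}"
        by eventually_elim (auto simp: std_normal_density_def split: split_indicator_asm)
      then have "emeasure lborel {0<..<1::real} = 0"
        by (subst (asm) AE_iff_measurable[where N = "{0<..<1}"]) auto
      then show False by simp
    qed
    then show ?thesis using integral_nonneg_AE[OF nonneg] by linarith
  qed
  finally show ?thesis .
qed

lemma harmonics_sphere_orthogonal:
  fixes f g :: "'a::euclidean_space \<Rightarrow> real"
  assumes "f \<in> harmonics i" "g \<in> harmonics j" "i \<noteq> j"
  shows "(\<integral>\<omega>. f \<omega> * g \<omega> \<partial>sphere_measure) = 0"
proof -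
  have "(\<lambda>x. f x * g x) \<in> poly_space {i + j}"
    by (rule poly_space_mult[OF assms(1,2)[THEN harmonics_poly_space]]) simp
  from integral_gauss_homogeneous[OF this] show ?thesis
    using harmonics_gauss_orthogonal[OF assms] radial_normal_moment_pos[of "DIM('a)" "i + j"]
    by simp
qed

section \<open>Jacobi polynomials on the unit interval\<close>

text \<open>The exponents at 0 and at 1, not shifted by one as in the Beta function. Under t = 2v -
  1 the Jacobi weight (1-t)^a (1+t)^b becomes a multiple of \<open>beta_measure b a\<close>, with
  the parameters exchanged.\<close>

definition beta_measure :: "real \<Rightarrow> real \<Rightarrow> real measure" where
  "beta_measure p q = density lborel (\<lambda>v. ennreal (v powr p * (1 - v) powr q * indicator {0..1} v))"

lemma beta_measure_sets [simp, measurable_cong]: "sets (beta_measure p q) = sets borel"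
  by (simp add: beta_measure_def)

lemma space_beta_measure [simp]: "space (beta_measure p q) = UNIV"
  by (simp add: beta_measure_def)

lemma integral_powr_Beta:
  fixes p q :: real
  assumes "p > -1" "q > -1"
  shows "integrable lborel (\<lambda>v. v powr p * (1 - v) powr q * indicator {0..1} v)"
    and "(\<integral>v. v powr p * (1 - v) powr q * indicator {0..1} v \<partial>lborel) = Beta (p + 1) (q + 1)"
proof -
  have si: "set_integrable lborel {0..1} (\<lambda>v. v powr p * (1 - v) powr q)"
    using integrable_Beta[of "p + 1" "q + 1"] assms by simp
  then show "integrable lborel (\<lambda>v. v powr p * (1 - v) powr q * indicator {0..1} v)"
    by (simp add: set_integrable_def mult.commute)
  have "integral {0..1} (\<lambda>v. v powr p * (1 - v) powr q) = Beta (p + 1) (q + 1)"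
    using has_integral_Beta_real[of "p + 1" "q + 1"] assms by (simp add: integral_unique)
  with set_borel_integral_eq_integral(2)[OF si]
  show "(\<integral>v. v powr p * (1 - v) powr q * indicator {0..1} v \<partial>lborel) = Beta (p + 1) (q + 1)"
    by (simp add: set_lebesgue_integral_def mult.commute)
qed

lemma AE_beta_measure: "AE v in beta_measure p q. 0 < v \<and> v < 1"
proof -
  have "AE v in lborel. 0 < ennreal (v powr p * (1 - v) powr q * indicator {0..1} v) \<longrightarrow> 0 < v \<and> v < 1"
    using AE_lborel_singleton[of 0] AE_lborel_singleton[of 1]
    by eventually_elim (auto split: split_indicator)
  then show ?thesis unfolding beta_measure_def by (subst AE_density) auto
qed

lemma emeasure_beta_measure:
  fixes p q :: real
  assumes "p > -1" "q > -1"
  shows "emeasure (beta_measure p q) UNIV = ennreal (Beta (p + 1) (q + 1))"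
proof -
  have "emeasure (beta_measure p q) UNIV =
      (\<integral>\<^sup>+v. ennreal (v powr p * (1 - v) powr q * indicator {0..1} v) \<partial>lborel)"
    by (simp add: beta_measure_def emeasure_density)
  then show ?thesis
    by (subst (asm) nn_integral_eq_integral[OF integral_powr_Beta(1)[OF assms]])
       (auto simp: integral_powr_Beta(2)[OF assms])
qed

lemma finite_measure_beta_measure:
  "p > -1 \<Longrightarrow> q > -1 \<Longrightarrow> finite_measure (beta_measure p q)"
  by standard (simp add: emeasure_beta_measure)

lemma integral_beta_measure:
  fixes f :: "real \<Rightarrow> real"
  assumes "f \<in> borel_measurable borel"
  shows "(\<integral>v. f v \<partial>beta_measure p q) =
    (\<integral>v. v powr p * (1 - v) powr q * indicator {0..1} v * f v \<partial>lborel)"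
  unfolding beta_measure_def using assms by (subst integral_density) auto

lemma integral_beta_measure_power:
  fixes p q :: real
  assumes "p > -1" "q > -1"
  shows "(\<integral>v. v ^ s * (1 - v) ^ k \<partial>beta_measure p q) = Beta (p + 1 + real s) (q + 1 + real k)"
proof -
  have "(\<integral>v. v ^ s * (1 - v) ^ k \<partial>beta_measure p q) =
      (\<integral>v. v powr p * (1 - v) powr q * indicator {0..1} v * (v ^ s * (1 - v) ^ k) \<partial>lborel)"
    by (rule integral_beta_measure) simp
  also have "\<dots> = (\<integral>v. v powr (p + real s) * (1 - v) powr (q + real k) * indicator {0..1} v \<partial>lborel)"
  proof (intro Bochner_Integration.integral_cong refl)
    fix v :: real
    show "v powr p * (1 - v) powr q * indicator {0..1} v * (v ^ s * (1 - v) ^ k) =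
        v powr (p + real s) * (1 - v) powr (q + real k) * indicator {0..1} v"
    \<comment> \<open>At an end point one of the bases is 0, and 0 to any real power is 0 here, so
      both sides vanish; in the interior the exponents add.\<close>
    proof (cases "v \<in> {0<..<1}")
      case True
      then show ?thesis by (simp add: powr_add powr_realpow)
    qed (auto split: split_indicator)
  qed
  also have "\<dots> = Beta (p + real s + 1) (q + real k + 1)"
    using assms by (intro integral_powr_Beta(2)) auto
  finally show ?thesis by (simp add: add_ac)
qed

lemma integrable_beta_measure:
  fixes f :: "real \<Rightarrow> real"
  assumes "p > -1" "q > -1" and f: "continuous_on UNIV f"
  shows "integrable (beta_measure p q) f"
proof -
  interpret finite_measure "beta_measure p q" by (rule finite_measure_beta_measure) fact+
  have "compact (f ` {0..1})"
    using f by (intro compact_continuous_image) (auto intro: continuous_on_subset)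
  then obtain B where B: "\<And>v. v \<in> {0..1} \<Longrightarrow> norm (f v) \<le> B"
    using compact_imp_bounded bounded_iff[of "f ` {0..1}"] by blast
  have "f \<in> borel_measurable borel" using f by (rule borel_measurable_continuous_onI)
  moreover have "AE v in beta_measure p q. norm (f v) \<le> B"
    using AE_beta_measure by eventually_elim (use B in auto)
  ultimately show ?thesis by (intro integrable_const_bound) auto
qed

lemma Beta_add_nat:
  fixes x y :: real
  assumes "x > 0" "y > 0"
  shows "Beta x (y + real k) = Beta x y * pochhammer y k / pochhammer (x + y) k"
proof -
  have nz: "y \<notin> \<int>\<^sub>\<le>\<^sub>0" "x + y \<notin> \<int>\<^sub>\<le>\<^sub>0" using assms by (auto elim!: nonpos_Ints_cases)
  have "Gamma y > 0" "Gamma (x + y) > 0" "Gamma (x + y + real k) > 0" "Gamma (y + real k) > 0"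
    using assms by (auto intro!: Gamma_real_pos)
  then show ?thesis
    unfolding Beta_def pochhammer_Gamma[OF nz(1)] pochhammer_Gamma[OF nz(2)]
    by (simp add: field_simps)
qed

definition jacobi_coeff :: "real \<Rightarrow> real \<Rightarrow> nat \<Rightarrow> nat \<Rightarrow> real" where
  "jacobi_coeff a b n k = pochhammer (a + 1) n / fact n *
     (pochhammer (- real n) k * pochhammer (real n + a + b + 1) k / (pochhammer (a + 1) k * fact k))"

lemma jacobi_P_unit: "jacobi_P a b n (2 * v - 1) = (\<Sum>k\<le>n. jacobi_coeff a b n k * (1 - v) ^ k)"
  by (simp add: jacobi_P_def jacobi_coeff_def sum_distrib_left mult.assoc)
     (simp add: diff_divide_distrib)

text \<open>Expanded in powers of 1 - v, each term integrates to a Beta value, and the sum is of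
  Chu-Vandermonde type. Its numerator is the rising factorial of length n starting at -(n - 1 - s),
  which runs through 0 because s < n.\<close>

lemma jacobi_orthogonal_power:
  assumes ab: "a > -1" "b > -1" and s: "s < n"
  shows "(\<integral>v. jacobi_P a b n (2 * v - 1) * v ^ s \<partial>beta_measure b a) = 0"
proof -
  define x where "x = b + 1 + real s"
  have x: "x > 0" "a + 1 > 0" using ab by (auto simp: x_def)
  have "(\<integral>v. jacobi_P a b n (2 * v - 1) * v ^ s \<partial>beta_measure b a) =
      (\<integral>v. (\<Sum>k\<le>n. jacobi_coeff a b n k * (v ^ s * (1 - v) ^ k)) \<partial>beta_measure b a)"
    unfolding jacobi_P_unit sum_distrib_right by (simp only: mult_ac)
  also have "\<dots> = (\<Sum>k\<le>n. jacobi_coeff a b n k * Beta x (a + 1 + real k))"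
    by (subst Bochner_Integration.integral_sum)
       (auto intro!: integrable_beta_measure continuous_intros
             simp: ab integral_beta_measure_power x_def)
  also have "\<dots> = (\<Sum>k\<le>n. pochhammer (a + 1) n / fact n * Beta x (a + 1) *
      (pochhammer (real n + a + b + 1) k * pochhammer (- real n) k /
        (of_nat (fact k) * pochhammer (x + (a + 1)) k)))"
  proof (rule sum.cong[OF refl])
    fix k
    have "pochhammer (a + 1) k > 0" "pochhammer (x + (a + 1)) k > 0"
      using x by (auto intro!: pochhammer_pos)
    then show "jacobi_coeff a b n k * Beta x (a + 1 + real k) =
      pochhammer (a + 1) n / fact n * Beta x (a + 1) *
      (pochhammer (real n + a + b + 1) k * pochhammer (- real n) k /
        (of_nat (fact k) * pochhammer (x + (a + 1)) k))"
      unfolding Beta_add_nat[OF x] jacobi_coeff_def by (simp add: mult_ac)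
  qed
  also have "\<dots> = pochhammer (a + 1) n / fact n * Beta x (a + 1) *
      (\<Sum>k\<in>{0..n}. pochhammer (real n + a + b + 1) k * pochhammer (- of_nat n) k /
        (of_nat (fact k) * pochhammer (x + (a + 1)) k))"
    by (simp add: sum_distrib_left atMost_atLeast0)
  also have "(\<Sum>k\<in>{0..n}. pochhammer (real n + a + b + 1) k * pochhammer (- of_nat n) k /
        (of_nat (fact k) * pochhammer (x + (a + 1)) k)) =
      pochhammer (x + (a + 1) - (real n + a + b + 1)) n / pochhammer (x + (a + 1)) n"
    by (rule Vandermonde_pochhammer) (use x in auto)
  also have "x + (a + 1) - (real n + a + b + 1) = - real (n - 1 - s)"
    using s by (simp add: x_def of_nat_diff)
  also have "pochhammer (- real (n - 1 - s)) n = 0"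
    using s by (intro pochhammer_of_nat_eq_0_lemma) auto
  finally show ?thesis by simp
qed

definition jacobi_unit_poly :: "real \<Rightarrow> real \<Rightarrow> nat \<Rightarrow> real poly" where
  "jacobi_unit_poly a b n = (\<Sum>k\<le>n. smult (jacobi_coeff a b n k) ([:1, -1:] ^ k))"

lemma poly_jacobi_unit_poly: "poly (jacobi_unit_poly a b n) v = jacobi_P a b n (2 * v - 1)"
  by (simp add: jacobi_unit_poly_def jacobi_P_unit poly_sum)

lemma degree_jacobi_unit_poly:
  assumes "a > -1" "b > -1"
  shows "degree (jacobi_unit_poly a b n) = n"
proof (rule antisym)
  have deg: "degree ([:1, -1 :: real:] ^ k) = k" for k
    by (simp add: degree_power_eq)
  show "degree (jacobi_unit_poly a b n) \<le> n"
    unfolding jacobi_unit_poly_def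
    by (intro degree_sum_le) (auto intro!: order.trans[OF degree_smult_le] simp: deg)
  have "coeff (jacobi_unit_poly a b n) n =
      (\<Sum>k\<le>n. if k = n then jacobi_coeff a b n k * (-1) ^ n else 0)"
    unfolding jacobi_unit_poly_def coeff_sum
  proof (rule sum.cong[OF refl])
    fix k assume "k \<in> {..n}"
    moreover have "coeff ([:1, -1 :: real:] ^ n) n = (-1) ^ n"
      using lead_coeff_power[of "[:1, -1 :: real:]" n] by (simp add: deg)
    ultimately show "coeff (smult (jacobi_coeff a b n k) ([:1, -1:] ^ k)) n =
        (if k = n then jacobi_coeff a b n k * (-1) ^ n else 0)"
      using deg[of k] by (auto intro!: coeff_eq_0)
  qed
  also have "\<dots> = jacobi_coeff a b n n * (-1) ^ n" by simp
  also have "\<dots> \<noteq> 0"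
  proof -
    have "pochhammer (a + 1) n > 0" using assms by (intro pochhammer_pos) auto
    \<comment> \<open>The number a + b + 1 can be zero or negative, but it exceeds -1. For n > 0 the
      first factor is then positive, and for n = 0 the product is empty.\<close>
    moreover have "pochhammer (real n + a + b + 1) n \<noteq> 0"
    proof (cases n)
      case (Suc m)
      then have "real n + a + b + 1 > 0" using assms by simp
      then show ?thesis using pochhammer_pos[of "real n + a + b + 1" n] by linarith
    qed simp
    ultimately show ?thesis by (simp add: jacobi_coeff_def pochhammer_same)
  qed
  finally show "n \<le> degree (jacobi_unit_poly a b n)" by (rule le_degree)
qed

lemma jacobi_unit_poly_orthogonal:
  assumes ab: "a > -1" "b > -1" and "n \<noteq> m"
  shows "(\<integral>v. poly (jacobi_unit_poly a b n) v * poly (jacobi_unit_poly a b m) v \<partial>beta_measure b a) = 0"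
proof -
  have *: "(\<integral>v. poly (jacobi_unit_poly a b n) v * poly r v \<partial>beta_measure b a) = 0"
    if r: "degree r < n" for n and r :: "real poly"
  proof -
    have "(\<integral>v. poly (jacobi_unit_poly a b n) v * poly r v \<partial>beta_measure b a) =
        (\<integral>v. (\<Sum>i\<le>degree r. coeff r i * (jacobi_P a b n (2 * v - 1) * v ^ i)) \<partial>beta_measure b a)"
      by (simp add: poly_jacobi_unit_poly poly_altdef[of r] sum_distrib_left mult_ac)
    also have "\<dots> = (\<Sum>i\<le>degree r. coeff r i *
        (\<integral>v. jacobi_P a b n (2 * v - 1) * v ^ i \<partial>beta_measure b a))"
      by (subst Bochner_Integration.integral_sum)
         (auto intro!: integrable_beta_measure continuous_intros ab simp: jacobi_P_unit)
    also have "\<dots> = 0"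
      using r by (intro sum.neutral) (auto simp: jacobi_orthogonal_power[OF ab])
    finally show ?thesis .
  qed
  show ?thesis
  proof (cases "m < n")
    case True
    then show ?thesis using *[of "jacobi_unit_poly a b m" n] ab by (simp add: degree_jacobi_unit_poly)
  next
    case False
    then show ?thesis using *[of "jacobi_unit_poly a b n" m] ab \<open>n \<noteq> m\<close>
      by (simp add: degree_jacobi_unit_poly mult.commute)
  qed
qed

lemma integral_beta_measure_poly_square_pos:
  assumes pq: "p > -1" "q > -1" and r: "r \<noteq> 0"
  shows "(\<integral>v. poly r v * poly r v \<partial>beta_measure p q) > 0"
proof -
  have int: "integrable (beta_measure p q) (\<lambda>v. poly r v * poly r v)"
    by (intro integrable_beta_measure pq continuous_intros)
  have "(\<integral>v. poly r v * poly r v \<partial>beta_measure p q) \<noteq> 0"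
  proof
    assume "(\<integral>v. poly r v * poly r v \<partial>beta_measure p q) = 0"
    then have "AE v in beta_measure p q. poly r v * poly r v = 0"
      using integral_nonneg_eq_0_iff_AE[OF int] by simp
    moreover have "countable {v. poly r v = 0}"
      using poly_roots_finite[OF r] by (rule countable_finite)
    then have "AE v in lborel. v \<notin> {v. poly r v = 0}"
      by (intro AE_not_in countable_imp_null_set_lborel)
    moreover have "(\<lambda>v. poly r v) \<in> borel_measurable borel"
      by (intro borel_measurable_continuous_onI continuous_intros)
    ultimately have "AE v in lborel. v powr p * (1 - v) powr q * indicator {0..1} v \<le> 0"
      unfolding beta_measure_def by (subst (asm) AE_density) auto
    then have "AE v in lborel. v \<notin> {0<..<1::real}"
    proof eventually_elim
      fix v :: real assume "v powr p * (1 - v) powr q * indicator {0..1} v \<le> 0"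
      moreover have "v powr p * (1 - v) powr q > 0" if "v \<in> {0<..<1}" using that by simp
      ultimately show "v \<notin> {0<..<1}"
        by (cases "v \<in> {0<..<1}") (simp_all add: not_le[symmetric])
    qed
    then have "emeasure lborel {0<..<1::real} = 0"
      by (subst (asm) AE_iff_measurable[where N = "{0<..<1}"]) auto
    then show False by simp
  qed
  moreover have "(\<integral>v. poly r v * poly r v \<partial>beta_measure p q) \<ge> 0" by simp
  ultimately show ?thesis by linarith
qed

section \<open>Separation of the weighted cone measure\<close>

text \<open>The coordinate u. Unlike its root \<open>tau\<close> it is a quadratic polynomial in (x,
  t), and it is meaningful off the domain, where it may be negative.\<close>

definition tau_sq :: "real \<Rightarrow> 'a::euclidean_space \<times> real \<Rightarrow> real" where
  "tau_sq a z = (norm (fst z))\<^sup>2 + ((snd z)\<^sup>2 - (norm (fst z))\<^sup>2) / a"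

text \<open>The barycentric coordinates of (r, s) in the triangle are r at (1, 1), (s - r)/a at (0,
  a) and the remaining 1 - u at the origin; the inequalities are their nonnegativity.\<close>

lemma cone_Xa_eq:
  assumes a: "a > 0"
  shows "cone_Xa a = {z. (norm (fst z))\<^sup>2 \<le> (snd z)\<^sup>2 \<and> tau_sq a z \<le> 1}"
proof -
  have "(r, s) \<in> triangle_a a \<longleftrightarrow> 0 \<le> r \<and> r \<le> s \<and> r + (s - r) / a \<le> 1" for r s
  proof
    assume "(r, s) \<in> triangle_a a"
    then obtain u v w where "0 \<le> u" "0 \<le> v" "0 \<le> w" "u + v + w = 1"
      "(r, s) = u *\<^sub>R (0, 0) + v *\<^sub>R (0, a) + w *\<^sub>R (1, 1)"
      unfolding triangle_a_def convex_hull_3 by auto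
    then show "0 \<le> r \<and> r \<le> s \<and> r + (s - r) / a \<le> 1" using a by simp
  next
    assume *: "0 \<le> r \<and> r \<le> s \<and> r + (s - r) / a \<le> 1"
    show "(r, s) \<in> triangle_a a"
      unfolding triangle_a_def convex_hull_3
      by (rule CollectI, rule exI[of _ "1 - (r + (s - r) / a)"], rule exI[of _ "(s - r) / a"],
          rule exI[of _ r]) (use * a in \<open>simp add: field_simps\<close>)
  qed
  then show ?thesis by (auto simp: cone_Xa_def tau_sq_def)
qed

lemma weight_Wa_eq:
  "weight_Wa a \<alpha> \<beta> \<gamma> \<theta> z = norm (fst z) powr (2 * \<alpha>) *
     (a + (1 - a) * (norm (fst z))\<^sup>2 - (snd z)\<^sup>2) powr \<beta> *
     ((snd z)\<^sup>2 - (norm (fst z))\<^sup>2) powr \<gamma> *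
     (\<bar>snd z\<bar> * ((snd z)\<^sup>2 - (1 - a) * (norm (fst z))\<^sup>2) powr (\<theta> - 1/2))"
  by (cases z) simp

lemma weight_Wa_nonneg: "weight_Wa a \<alpha> \<beta> \<gamma> \<theta> z \<ge> 0"
  by (simp add: weight_Wa_eq)

lemma tau_sq_measurable [measurable]: "tau_sq a \<in> borel_measurable borel"
  unfolding tau_sq_def[abs_def] borel_prod[symmetric] by measurable

lemma weight_Wa_measurable [measurable]: "weight_Wa a \<alpha> \<beta> \<gamma> \<theta> \<in> borel_measurable borel"
  unfolding weight_Wa_eq[abs_def] borel_prod[symmetric] by measurable

lemma cone_Xa_measurable: "a > 0 \<Longrightarrow> cone_Xa a \<in> sets borel"
  unfolding cone_Xa_eq tau_sq_def
  by (intro borel_closed closed_Collect_conj closed_Collect_le continuous_intros) auto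

text \<open>The substitution s = r^2: the image of 2 r dr on the positive half-line gives {..<S} the
  mass \<open>max 0 S\<close>, as Lebesgue measure on the positive half-line does. The 2 stays on
  the left so that no halves occur among extended nonnegative numbers.\<close>

lemma nn_integral_square_half_line:
  fixes H :: "real \<Rightarrow> ennreal"
  assumes [measurable]: "H \<in> borel_measurable borel"
  shows "2 * (\<integral>\<^sup>+r. ennreal r * indicator {0<..} r * H (r\<^sup>2) \<partial>lborel) =
    (\<integral>\<^sup>+s. indicator {0<..} s * H s \<partial>lborel)"
proof -
  let ?N = "distr (density lborel (\<lambda>r::real. 2 * (ennreal r * indicator {0<..} r))) borel (\<lambda>r. r\<^sup>2)"
  have em: "emeasure ?N {..<S} = emeasure (radial_measure 1) {..<S}" for S
  proof -
    have [measurable]: "(\<lambda>r::real. r\<^sup>2) -` {..<S} \<in> sets borel"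
      by (rule measurable_sets_borel[where M = borel]) auto
    have "emeasure ?N {..<S} =
        (\<integral>\<^sup>+r. 2 * (ennreal r * indicator {0<..} r) * indicator ((\<lambda>r. r\<^sup>2) -` {..<S}) r \<partial>lborel)"
      by (subst emeasure_distr) (auto simp: emeasure_density)
    also have "\<dots> = (\<integral>\<^sup>+r. 2 * (ennreal (r ^ (2 - 1)) * indicator {0<..} r * indicator {..<sqrt S} r) \<partial>lborel)"
    proof (intro nn_integral_cong)
      fix r :: real
      have "r\<^sup>2 < S \<longleftrightarrow> r < sqrt S" if "r > 0"
        using real_sqrt_less_iff[of "r\<^sup>2" S] that by simp
      then show "2 * (ennreal r * indicator {0<..} r) * indicator ((\<lambda>r. r\<^sup>2) -` {..<S}) r =
          2 * (ennreal (r ^ (2 - 1)) * indicator {0<..} r * indicator {..<sqrt S} r)"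
        by (auto split: split_indicator)
    qed
    also have "\<dots> = 2 * emeasure (radial_measure 2) {..<sqrt S}"
      by (subst nn_integral_cmult) (auto simp: radial_measure_def emeasure_density)
    also have "\<dots> = ennreal (max 0 S)"
    proof -
      have "(max 0 (sqrt S))\<^sup>2 = max 0 S" by (auto simp: max_def)
      then have "2 * emeasure (radial_measure 2) {..<sqrt S} = ennreal 2 * ennreal (max 0 S / 2)"
        by (subst emeasure_radial_measure) auto
      also have "\<dots> = ennreal (2 * (max 0 S / 2))" by (rule ennreal_mult[symmetric]) auto
      finally show ?thesis by simp
    qed
    finally show ?thesis by (simp add: emeasure_radial_measure)
  qed
  have "?N = radial_measure 1"
    by (rule measure_eqI_lessThan_finite) (auto simp: em simp del: emeasure_distr, simp add: emeasure_radial_measure)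
  then have "(\<integral>\<^sup>+s. H s \<partial>?N) = (\<integral>\<^sup>+s. H s \<partial>radial_measure 1)" by simp
  then have "(\<integral>\<^sup>+r. 2 * (ennreal r * indicator {0<..} r) * H (r\<^sup>2) \<partial>lborel) =
      (\<integral>\<^sup>+s. indicator {0<..} s * H s \<partial>lborel)"
    by (simp add: nn_integral_distr nn_integral_density radial_measure_def)
  then show ?thesis
    by (subst (asm) mult.assoc) (simp add: nn_integral_cmult)
qed

text \<open>The two half-lines contribute equally, which absorbs the factor 2.\<close>

lemma nn_integral_square_line:
  fixes H :: "real \<Rightarrow> ennreal"
  assumes [measurable]: "H \<in> borel_measurable borel"
  shows "(\<integral>\<^sup>+t. ennreal \<bar>t\<bar> * H (t\<^sup>2) \<partial>lborel) = (\<integral>\<^sup>+s. indicator {0<..} s * H s \<partial>lborel)"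
proof -
  have "(\<integral>\<^sup>+t. ennreal \<bar>t\<bar> * H (t\<^sup>2) \<partial>lborel) =
      (\<integral>\<^sup>+t. ennreal t * indicator {0<..} t * H (t\<^sup>2) + ennreal (- t) * indicator {0<..} (- t) * H (t\<^sup>2) \<partial>lborel)"
    by (intro nn_integral_cong) (auto split: split_indicator)
  also have "\<dots> = (\<integral>\<^sup>+t. ennreal t * indicator {0<..} t * H (t\<^sup>2) \<partial>lborel) +
      (\<integral>\<^sup>+t. ennreal (- t) * indicator {0<..} (- t) * H (t\<^sup>2) \<partial>lborel)"
    by (rule nn_integral_add) auto
  also have "(\<integral>\<^sup>+t. ennreal (- t) * indicator {0<..} (- t) * H (t\<^sup>2) \<partial>lborel) =
      (\<integral>\<^sup>+t. ennreal t * indicator {0<..} t * H (t\<^sup>2) \<partial>lborel)"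
    by (subst nn_integral_real_affine[where c = "-1" and t = 0]) auto
  finally show ?thesis
    unfolding nn_integral_square_half_line[OF assms, symmetric] mult_2 .
qed

text \<open>\<open>axis\<close> and \<open>apex\<close> express q > -1 and p > -1, the integrability
  of the weight at x = 0 and at the origin. For small d they are stronger than lower bounds of -1 on
  the single exponents: for d = 1, \<open>axis\<close> means \<alpha> > -1/2.\<close>

locale cone_weight =
  fixes space_type :: "'a::euclidean_space itself" and \<alpha> \<beta> \<gamma> \<theta> :: real
  assumes \<beta>: "\<beta> > -1" and \<gamma>: "\<gamma> > -1"
    and axis: "2 * \<alpha> + real DIM('a) > 0"
    and apex: "2 * (\<alpha> + \<gamma> + \<theta>) + real DIM('a) + 1 > 0"
begin

text \<open>With s = |x|^2 = u v, the exponent q of s collects |x|^(2\<alpha>) and the radial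
  Jacobian. Then p = 1 + q + \<gamma> + (\<theta> - 1/2), where the 1 comes from ds = u dv.\<close>

definition "p_exp = \<alpha> + \<gamma> + \<theta> + (real DIM('a) - 1) / 2"
definition "q_exp = \<alpha> + (real DIM('a) - 2) / 2"

lemma p_exp: "p_exp > -1" and q_exp: "q_exp > -1"
  using axis apex by (auto simp: p_exp_def q_exp_def field_simps)

definition "sep_measure = beta_measure p_exp \<beta> \<Otimes>\<^sub>M
  ((sphere_measure :: 'a measure) \<Otimes>\<^sub>M beta_measure q_exp \<gamma>)"

definition sep_map :: "real \<times> 'a \<times> real \<Rightarrow> 'a \<times> real" where
  "sep_map = (\<lambda>(u, \<omega>, v). (sqrt (u * v) *\<^sub>R \<omega>, u))"

lemma sep_map_measurable [measurable]: "sep_map \<in> sep_measure \<rightarrow>\<^sub>M borel"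
proof -
  have "sets sep_measure = sets (borel \<Otimes>\<^sub>M (borel \<Otimes>\<^sub>M borel))"
    unfolding sep_measure_def by (intro sets_pair_measure_cong) auto
  note sets = this
  have "sep_map \<in> (borel \<Otimes>\<^sub>M (borel \<Otimes>\<^sub>M borel)) \<rightarrow>\<^sub>M (borel :: ('a \<times> real) measure)"
    unfolding sep_map_def borel_prod[symmetric] by measurable
  then show ?thesis by (subst measurable_cong_sets[OF sets refl])
qed

text \<open>With x fixed, substitute s = t^2, which uses up the factor |t| of the weight, and then s
  = (1 - a)|x|^2 + a u. The three remaining factors each become a times a factor free of a; together
  they give a^(\<beta>+\<gamma>+\<theta>-1/2), and ds = a du gives the last a.\<close>

lemma inner_t_integral:
  fixes G :: "'a \<times> real \<Rightarrow> ennreal"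
  assumes [measurable]: "G \<in> borel_measurable borel" and a: "a > 0"
  shows "(\<integral>\<^sup>+t. G (x, tau_sq a (x, t)) * ennreal (weight_Wa a \<alpha> \<beta> \<gamma> \<theta> (x, t)) *
      indicator (cone_Xa a) (x, t) \<partial>lborel) =
    ennreal (a powr (\<beta> + \<gamma> + \<theta> + 1/2)) *
    (\<integral>\<^sup>+u. G (x, u) * ennreal (norm x powr (2 * \<alpha>) * (1 - u) powr \<beta> * (u - (norm x)\<^sup>2) powr \<gamma> *
      u powr (\<theta> - 1/2)) * indicator {(norm x)\<^sup>2..1} u \<partial>lborel)"
proof -
  define r2 where "r2 = (norm x)\<^sup>2"
  define w where "w s = norm x powr (2 * \<alpha>) * (a + (1 - a) * r2 - s) powr \<beta> * (s - r2) powr \<gamma> *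
    (s - (1 - a) * r2) powr (\<theta> - 1/2)" for s
  define H where "H s = G (x, r2 + (s - r2) / a) * ennreal (w s) *
    indicator {s. r2 \<le> s \<and> r2 + (s - r2) / a \<le> 1} s" for s
  have [measurable]: "w \<in> borel_measurable borel" "H \<in> borel_measurable borel"
    unfolding w_def H_def by measurable
  have "(\<integral>\<^sup>+t. G (x, tau_sq a (x, t)) * ennreal (weight_Wa a \<alpha> \<beta> \<gamma> \<theta> (x, t)) *
      indicator (cone_Xa a) (x, t) \<partial>lborel) = (\<integral>\<^sup>+t. ennreal \<bar>t\<bar> * H (t\<^sup>2) \<partial>lborel)"
  proof (intro nn_integral_cong)
    fix t :: real
    have "weight_Wa a \<alpha> \<beta> \<gamma> \<theta> (x, t) = \<bar>t\<bar> * w (t\<^sup>2)"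
      by (simp add: w_def r2_def mult_ac)
    then have "ennreal (weight_Wa a \<alpha> \<beta> \<gamma> \<theta> (x, t)) = ennreal \<bar>t\<bar> * ennreal (w (t\<^sup>2))"
      by (simp only: ennreal_mult' abs_ge_zero)
    then show "G (x, tau_sq a (x, t)) * ennreal (weight_Wa a \<alpha> \<beta> \<gamma> \<theta> (x, t)) *
      indicator (cone_Xa a) (x, t) = ennreal \<bar>t\<bar> * H (t\<^sup>2)"
      by (auto simp: H_def cone_Xa_eq[OF a] tau_sq_def r2_def mult_ac simp del: weight_Wa.simps split: split_indicator)
  qed
  also have "\<dots> = (\<integral>\<^sup>+s. indicator {0<..} s * H s \<partial>lborel)"
    by (rule nn_integral_square_line) measurable
  also have "\<dots> = ennreal a * (\<integral>\<^sup>+u. indicator {0<..} ((1 - a) * r2 + a * u) * H ((1 - a) * r2 + a * u) \<partial>lborel)"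
    using a by (subst nn_integral_real_affine[where c = a and t = "(1 - a) * r2"]) auto
  also have "\<dots> = (\<integral>\<^sup>+u. ennreal a * (indicator {0<..} ((1 - a) * r2 + a * u) * H ((1 - a) * r2 + a * u)) \<partial>lborel)"
    by (rule nn_integral_cmult[symmetric]) measurable
  also have "\<dots> = (\<integral>\<^sup>+u. ennreal (a powr (\<beta> + \<gamma> + \<theta> + 1/2)) * (G (x, u) * ennreal (norm x powr (2 * \<alpha>) * (1 - u) powr \<beta> * (u - r2) powr \<gamma> *
      u powr (\<theta> - 1/2)) * indicator {r2..1} u) \<partial>lborel)"
  proof (intro nn_integral_cong)
    fix u :: real
    let ?s = "(1 - a) * r2 + a * u"
    have s: "r2 + (?s - r2) / a = u" "?s - r2 = a * (u - r2)" "a + (1 - a) * r2 - ?s = a * (1 - u)"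
      "?s - (1 - a) * r2 = a * u"
      using a by (auto simp: field_simps)
    have le: "r2 \<le> ?s \<longleftrightarrow> r2 \<le> u"
      using s(2) a by (metis diff_ge_0_iff_ge mult_le_cancel_left_pos mult_zero_right)
    have H: "H ?s = G (x, u) * ennreal (w ?s) * indicator {r2..1} u"
      by (simp add: H_def s(1) le indicator_def)
    show "ennreal a * (indicator {0<..} ?s * H ?s) =
      ennreal (a powr (\<beta> + \<gamma> + \<theta> + 1/2)) * (G (x, u) * ennreal (norm x powr (2 * \<alpha>) * (1 - u) powr \<beta> * (u - r2) powr \<gamma> *
        u powr (\<theta> - 1/2)) * indicator {r2..1} u)"
    proof (cases "u \<in> {r2..1}")
      case True
      then have u: "r2 \<le> u" "u \<le> 1" "0 \<le> r2" by (auto simp: r2_def)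
      have w: "a * w ?s = a powr (\<beta> + \<gamma> + \<theta> + 1/2) *
          (norm x powr (2 * \<alpha>) * (1 - u) powr \<beta> * (u - r2) powr \<gamma> * u powr (\<theta> - 1/2))"
      proof -
        have "a powr (\<beta> + \<gamma> + \<theta> + 1/2) = a * a powr \<beta> * a powr \<gamma> * a powr (\<theta> - 1/2)"
          using a powr_add[of a "\<beta> + \<gamma> + (\<theta> - 1/2)" 1]
          by (simp add: powr_add[symmetric] powr_mult_base mult_ac add_ac)
        then show ?thesis
          unfolding w_def s using u a by (simp add: powr_mult mult_ac)
      qed
      have "?s \<ge> 0" using u le by linarith
      show ?thesis
      \<comment> \<open>The indicator drops the point where s = 0. There |x| and u are 0 too, so the
        power of u makes the right-hand side vanish as well.\<close>
      proof (cases "?s = 0")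
        case True
        then have "u = 0" using u le s(2) a by auto
        then show ?thesis unfolding True by simp
      next
        case False
        then have "?s > 0" using \<open>?s \<ge> 0\<close> by simp
        moreover have "ennreal a * ennreal (w ?s) = ennreal (a powr (\<beta> + \<gamma> + \<theta> + 1/2)) *
          ennreal (norm x powr (2 * \<alpha>) * (1 - u) powr \<beta> * (u - r2) powr \<gamma> * u powr (\<theta> - 1/2))"
          using w a by (simp add: ennreal_mult'[symmetric])
        moreover from this have "ennreal a * (G (x, u) * ennreal (w ?s)) =
          ennreal (a powr (\<beta> + \<gamma> + \<theta> + 1/2)) * (G (x, u) *
          ennreal (norm x powr (2 * \<alpha>) * (1 - u) powr \<beta> * (u - r2) powr \<gamma> * u powr (\<theta> - 1/2)))"
          by (simp only: mult.left_commute[of _ "G (x, u)"])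
        ultimately show ?thesis unfolding H using True by simp
      qed
    qed (simp add: H)
  qed
  finally show ?thesis
    by (subst (asm) nn_integral_cmult) (auto simp: r2_def)
qed

text \<open>With u fixed: polar coordinates, then s = r^2, then s = u v. The second substitution is
  the source of the factor 2.\<close>

lemma inner_x_integral:
  fixes G :: "'a \<times> real \<Rightarrow> ennreal"
  assumes [measurable]: "G \<in> borel_measurable borel"
  shows "2 * (\<integral>\<^sup>+x. G (x, u) * ennreal (norm x powr (2 * \<alpha>) * (1 - u) powr \<beta> * (u - (norm x)\<^sup>2) powr \<gamma> *
      u powr (\<theta> - 1/2)) * indicator {(norm x)\<^sup>2..1} u \<partial>lborel) =
    ennreal (u powr p_exp * (1 - u) powr \<beta> * indicator {0..1} u) *
    (\<integral>\<^sup>+\<omega>. \<integral>\<^sup>+v. G (sqrt (u * v) *\<^sub>R \<omega>, u) \<partial>beta_measure q_exp \<gamma> \<partial>sphere_measure)"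
proof -
  have "2 * (\<integral>\<^sup>+x. G (x, u) * ennreal (norm x powr (2 * \<alpha>) * (1 - u) powr \<beta> * (u - (norm x)\<^sup>2) powr \<gamma> *
      u powr (\<theta> - 1/2)) * indicator {(norm x)\<^sup>2..1} u \<partial>lborel) =
    2 * (\<integral>\<^sup>+\<omega>. \<integral>\<^sup>+r. ennreal (r ^ (DIM('a) - 1)) * indicator {0<..} r * (G (r *\<^sub>R \<omega>, u) *
      ennreal (norm (r *\<^sub>R \<omega>) powr (2 * \<alpha>) * (1 - u) powr \<beta> * (u - (norm (r *\<^sub>R \<omega>))\<^sup>2) powr \<gamma> *
      u powr (\<theta> - 1/2)) * indicator {(norm (r *\<^sub>R \<omega>))\<^sup>2..1} u) \<partial>lborel \<partial>sphere_measure)"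
    by (subst nn_integral_polar) (auto simp: indicator_def)
  also have "\<dots> = (\<integral>\<^sup>+\<omega>. 2 * (\<integral>\<^sup>+r. ennreal (r ^ (DIM('a) - 1)) * indicator {0<..} r * (G (r *\<^sub>R \<omega>, u) *
      ennreal (norm (r *\<^sub>R \<omega>) powr (2 * \<alpha>) * (1 - u) powr \<beta> * (u - (norm (r *\<^sub>R \<omega>))\<^sup>2) powr \<gamma> *
      u powr (\<theta> - 1/2)) * indicator {(norm (r *\<^sub>R \<omega>))\<^sup>2..1} u) \<partial>lborel) \<partial>sphere_measure)"
    by (rule nn_integral_cmult[symmetric]) (auto simp: indicator_def)
  also have "\<dots> = (\<integral>\<^sup>+\<omega>. ennreal (u powr p_exp * (1 - u) powr \<beta> * indicator {0..1} u) *
    (\<integral>\<^sup>+v. G (sqrt (u * v) *\<^sub>R \<omega>, u) \<partial>beta_measure q_exp \<gamma>) \<partial>sphere_measure)"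
  proof (rule nn_integral_cong_AE, rule AE_mp[OF AE_sphere_measure_norm], rule AE_I2, rule impI)
    \<comment> \<open>The sphere measure lives on the whole space, so |\<omega>| = 1 is available
      only almost everywhere.\<close>
    fix \<omega> :: 'a assume \<omega>: "norm \<omega> = 1"
    define H where "H s = G (sqrt s *\<^sub>R \<omega>, u) * ennreal (s powr q_exp * (1 - u) powr \<beta> *
      (u - s) powr \<gamma> * u powr (\<theta> - 1/2)) * indicator {..u} s * indicator {..1} u" for s
    have [measurable]: "H \<in> borel_measurable borel"
      unfolding H_def by measurable
    have "2 * (\<integral>\<^sup>+r. ennreal (r ^ (DIM('a) - 1)) * indicator {0<..} r * (G (r *\<^sub>R \<omega>, u) *
      ennreal (norm (r *\<^sub>R \<omega>) powr (2 * \<alpha>) * (1 - u) powr \<beta> * (u - (norm (r *\<^sub>R \<omega>))\<^sup>2) powr \<gamma> *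
      u powr (\<theta> - 1/2)) * indicator {(norm (r *\<^sub>R \<omega>))\<^sup>2..1} u) \<partial>lborel) =
      2 * (\<integral>\<^sup>+r. ennreal r * indicator {0<..} r * H (r\<^sup>2) \<partial>lborel)"
    proof (intro arg_cong[where f = "\<lambda>x. 2 * x"] nn_integral_cong)
      fix r :: real
      show "ennreal (r ^ (DIM('a) - 1)) * indicator {0<..} r * (G (r *\<^sub>R \<omega>, u) *
        ennreal (norm (r *\<^sub>R \<omega>) powr (2 * \<alpha>) * (1 - u) powr \<beta> * (u - (norm (r *\<^sub>R \<omega>))\<^sup>2) powr \<gamma> *
        u powr (\<theta> - 1/2)) * indicator {(norm (r *\<^sub>R \<omega>))\<^sup>2..1} u) =
        ennreal r * indicator {0<..} r * H (r\<^sup>2)"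
      proof (cases "r > 0")
        case True
        have "r ^ (DIM('a) - 1) * r powr (2 * \<alpha>) = r * (r\<^sup>2) powr q_exp"
        proof -
          have "r ^ (DIM('a) - 1) = r powr (real DIM('a) - 1)"
            using True DIM_positive[where 'a = 'a] by (simp add: powr_realpow[symmetric] of_nat_diff Suc_leI)
          moreover have "r\<^sup>2 = r powr 2" using True by simp
          moreover have "r = r powr 1" using True by simp
          ultimately have "r ^ (DIM('a) - 1) * r powr (2 * \<alpha>) = r powr (real DIM('a) - 1 + 2 * \<alpha>)"
            "r * (r\<^sup>2) powr q_exp = r powr (1 + 2 * q_exp)"
            by (metis powr_add, metis powr_add powr_powr)
          moreover have "1 + 2 * q_exp = real DIM('a) - 1 + 2 * \<alpha>"
            by (simp add: q_exp_def field_simps)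
          ultimately show ?thesis by (simp only:)
        qed
        then have "ennreal (r ^ (DIM('a) - 1)) * ennreal (r powr (2 * \<alpha>) * (1 - u) powr \<beta> * (u - r\<^sup>2) powr \<gamma> * u powr (\<theta> - 1/2)) =
          ennreal r * ennreal ((r\<^sup>2) powr q_exp * (1 - u) powr \<beta> * (u - r\<^sup>2) powr \<gamma> * u powr (\<theta> - 1/2))"
          using True by (simp add: ennreal_mult'[symmetric] mult.assoc[symmetric])
        then show ?thesis
          using True \<omega> by (simp add: H_def mult_ac split: split_indicator)
      qed simp
    qed
    also have "\<dots> = (\<integral>\<^sup>+s. indicator {0<..} s * H s \<partial>lborel)"
      by (rule nn_integral_square_half_line) measurable
    also have "\<dots> = ennreal (u powr p_exp * (1 - u) powr \<beta> * indicator {0..1} u) *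
      (\<integral>\<^sup>+v. G (sqrt (u * v) *\<^sub>R \<omega>, u) \<partial>beta_measure q_exp \<gamma>)"
    proof (cases "u > 0")
      case False
      have "indicator {0<..} s * H s = 0" for s
        using False by (simp add: H_def split: split_indicator)
      moreover have "u powr p_exp * indicator {0..1} u = 0"
        using False by (simp split: split_indicator)
      ultimately show ?thesis by (simp only: mult.assoc mult.left_commute[of "u powr p_exp"]) simp
    next
      case True
      have "(\<integral>\<^sup>+s. indicator {0<..} s * H s \<partial>lborel) =
          ennreal u * (\<integral>\<^sup>+v. indicator {0<..} (u * v) * H (u * v) \<partial>lborel)"
        using True by (subst nn_integral_real_affine[where c = u and t = 0]) auto
      also have "\<dots> = (\<integral>\<^sup>+v. ennreal u * (indicator {0<..} (u * v) * H (u * v)) \<partial>lborel)"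
        by (rule nn_integral_cmult[symmetric]) measurable
      also have "\<dots> = (\<integral>\<^sup>+v. ennreal (u powr p_exp * (1 - u) powr \<beta> * indicator {0..1} u) *
          (ennreal (v powr q_exp * (1 - v) powr \<gamma> * indicator {0..1} v) * G (sqrt (u * v) *\<^sub>R \<omega>, u)) \<partial>lborel)"
      proof (intro nn_integral_cong)
        fix v :: real
        show "ennreal u * (indicator {0<..} (u * v) * H (u * v)) =
          ennreal (u powr p_exp * (1 - u) powr \<beta> * indicator {0..1} u) *
          (ennreal (v powr q_exp * (1 - v) powr \<gamma> * indicator {0..1} v) * G (sqrt (u * v) *\<^sub>R \<omega>, u))"
        proof (cases "0 < v \<and> v \<le> 1 \<and> u \<le> 1")
          case v: True
          have "u * ((u * v) powr q_exp * (1 - u) powr \<beta> * (u - u * v) powr \<gamma> * u powr (\<theta> - 1/2)) =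
            u powr p_exp * (1 - u) powr \<beta> * (v powr q_exp * (1 - v) powr \<gamma>)"
          proof -
            have "u - u * v = u * (1 - v)" by (simp add: algebra_simps)
            moreover have "u powr p_exp = u * u powr q_exp * u powr \<gamma> * u powr (\<theta> - 1/2)"
            proof -
              have "p_exp = 1 + q_exp + \<gamma> + (\<theta> - 1/2)"
                by (simp add: p_exp_def q_exp_def field_simps)
              then have "u powr p_exp = u powr 1 * u powr q_exp * u powr \<gamma> * u powr (\<theta> - 1/2)"
                by (simp only: powr_add)
              then show ?thesis using True by simp
            qed
            ultimately show ?thesis using True v by (simp add: powr_mult mult_ac)
          qed
          then have "ennreal u * ennreal ((u * v) powr q_exp * (1 - u) powr \<beta> * (u - u * v) powr \<gamma> * u powr (\<theta> - 1/2)) =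
            ennreal (u powr p_exp * (1 - u) powr \<beta>) * ennreal (v powr q_exp * (1 - v) powr \<gamma>)"
            using True by (simp add: ennreal_mult'[symmetric])
          then have "ennreal u * (G (sqrt (u * v) *\<^sub>R \<omega>, u) * ennreal ((u * v) powr q_exp * (1 - u) powr \<beta> * (u - u * v) powr \<gamma> * u powr (\<theta> - 1/2))) =
            ennreal (u powr p_exp * (1 - u) powr \<beta>) * (ennreal (v powr q_exp * (1 - v) powr \<gamma>) * G (sqrt (u * v) *\<^sub>R \<omega>, u))"
            by (simp only: mult.left_commute[of _ "G (sqrt (u * v) *\<^sub>R \<omega>, u)"] mult.commute[of _ "G (sqrt (u * v) *\<^sub>R \<omega>, u)"])
          moreover have "u * v \<le> u" using True v by simp
          ultimately show ?thesis using True v by (simp add: H_def)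
        next
          case v: False
          have "v powr q_exp * indicator {0..1} v = 0" if "\<not> (0 < v \<and> v \<le> 1)"
            using that by (auto split: split_indicator)
          moreover have "indicator {0<..} (u * v) * H (u * v) = 0"
            using v True by (auto simp: H_def zero_less_mult_iff split: split_indicator)
          ultimately show ?thesis using v True
            by (cases "u \<le> 1") (auto simp: mult.assoc mult.left_commute[of "v powr q_exp"])
        qed
      qed
      also have "\<dots> = ennreal (u powr p_exp * (1 - u) powr \<beta> * indicator {0..1} u) *
          (\<integral>\<^sup>+v. ennreal (v powr q_exp * (1 - v) powr \<gamma> * indicator {0..1} v) * G (sqrt (u * v) *\<^sub>R \<omega>, u) \<partial>lborel)"
        by (rule nn_integral_cmult) measurable
      finally show ?thesis by (simp add: beta_measure_def nn_integral_density)
    qed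
    finally show "2 * (\<integral>\<^sup>+r. ennreal (r ^ (DIM('a) - 1)) * indicator {0<..} r * (G (r *\<^sub>R \<omega>, u) *
      ennreal (norm (r *\<^sub>R \<omega>) powr (2 * \<alpha>) * (1 - u) powr \<beta> * (u - (norm (r *\<^sub>R \<omega>))\<^sup>2) powr \<gamma> *
      u powr (\<theta> - 1/2)) * indicator {(norm (r *\<^sub>R \<omega>))\<^sup>2..1} u) \<partial>lborel) =
      ennreal (u powr p_exp * (1 - u) powr \<beta> * indicator {0..1} u) *
      (\<integral>\<^sup>+v. G (sqrt (u * v) *\<^sub>R \<omega>, u) \<partial>beta_measure q_exp \<gamma>)" .
  qed
  also have "\<dots> = ennreal (u powr p_exp * (1 - u) powr \<beta> * indicator {0..1} u) *
    (\<integral>\<^sup>+\<omega>. \<integral>\<^sup>+v. G (sqrt (u * v) *\<^sub>R \<omega>, u) \<partial>beta_measure q_exp \<gamma> \<partial>sphere_measure)"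
  proof (rule nn_integral_cmult)
    interpret V: finite_measure "beta_measure q_exp \<gamma>"
      by (rule finite_measure_beta_measure[OF q_exp \<gamma>])
    show "(\<lambda>\<omega>. \<integral>\<^sup>+v. G (sqrt (u * v) *\<^sub>R \<omega>, u) \<partial>beta_measure q_exp \<gamma>) \<in> borel_measurable sphere_measure"
      by measurable
  qed
  finally show ?thesis .
qed

text \<open>The integral over t is transformed with x fixed and the one over x with u fixed, so the
  order of integration is exchanged between the two.\<close>

lemma nn_integral_cone:
  fixes G :: "'a \<times> real \<Rightarrow> ennreal"
  assumes [measurable]: "G \<in> borel_measurable borel" and a: "a > 0"
  shows "2 * (\<integral>\<^sup>+z. G (fst z, tau_sq a z) * ennreal (weight_Wa a \<alpha> \<beta> \<gamma> \<theta> z) * indicator (cone_Xa a) z \<partial>lborel) =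
    ennreal (a powr (\<beta> + \<gamma> + \<theta> + 1/2)) * (\<integral>\<^sup>+z. G (sep_map z) \<partial>sep_measure)"
proof -
  note [measurable] = cone_Xa_measurable[OF a]
  interpret S: finite_measure "sphere_measure :: 'a measure" by (rule finite_measure_sphere_measure)
  interpret V: finite_measure "beta_measure q_exp \<gamma>"
    by (rule finite_measure_beta_measure[OF q_exp \<gamma>])
  interpret SV: pair_sigma_finite "sphere_measure :: 'a measure" "beta_measure q_exp \<gamma>" ..
  let ?K = "ennreal (a powr (\<beta> + \<gamma> + \<theta> + 1/2))"
  define w where "w x u = G (x, u) * ennreal (norm x powr (2 * \<alpha>) * (1 - u) powr \<beta> * (u - (norm x)\<^sup>2) powr \<gamma> *
      u powr (\<theta> - 1/2)) * indicator {(norm x)\<^sup>2..1} u" for x u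
  have wm: "case_prod w \<in> borel_measurable (lborel \<Otimes>\<^sub>M lborel)"
    unfolding w_def[abs_def] indicator_def atLeastAtMost_iff by measurable
  have [measurable]: "(\<lambda>z. (fst z :: 'a, tau_sq a z)) \<in> borel_measurable borel"
    unfolding borel_prod[symmetric] by measurable (simp add: borel_prod)
  have zm: "(\<lambda>z. G (fst z, tau_sq a z) * ennreal (weight_Wa a \<alpha> \<beta> \<gamma> \<theta> z) * indicator (cone_Xa a) z)
      \<in> borel_measurable (lborel \<Otimes>\<^sub>M lborel)"
    unfolding lborel_prod by measurable
  have "2 * (\<integral>\<^sup>+z. G (fst z, tau_sq a z) * ennreal (weight_Wa a \<alpha> \<beta> \<gamma> \<theta> z) * indicator (cone_Xa a) z \<partial>lborel) =
      2 * (\<integral>\<^sup>+x. \<integral>\<^sup>+t. G (x, tau_sq a (x, t)) * ennreal (weight_Wa a \<alpha> \<beta> \<gamma> \<theta> (x, t)) *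
      indicator (cone_Xa a) (x, t) \<partial>lborel \<partial>lborel)"
    unfolding lborel_prod[symmetric]
    by (subst lborel.nn_integral_fst[OF zm, symmetric]) simp
  also have "\<dots> = 2 * (\<integral>\<^sup>+x. ?K * (\<integral>\<^sup>+u. w x u \<partial>lborel) \<partial>lborel)"
    by (simp only: inner_t_integral[OF assms] w_def)
  also have "\<dots> = ?K * (2 * (\<integral>\<^sup>+x. \<integral>\<^sup>+u. w x u \<partial>lborel \<partial>lborel))"
  proof -
    have *: "(\<integral>\<^sup>+x. ?K * (\<integral>\<^sup>+u. w x u \<partial>lborel) \<partial>lborel) = ?K * (\<integral>\<^sup>+x. \<integral>\<^sup>+u. w x u \<partial>lborel \<partial>lborel)"
      by (rule nn_integral_cmult) (rule lborel.borel_measurable_nn_integral[OF wm])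
    show ?thesis unfolding * by (rule mult.left_commute)
  qed
  finally have 1: "2 * (\<integral>\<^sup>+z. G (fst z, tau_sq a z) * ennreal (weight_Wa a \<alpha> \<beta> \<gamma> \<theta> z) * indicator (cone_Xa a) z \<partial>lborel) =
    ?K * (2 * (\<integral>\<^sup>+x. \<integral>\<^sup>+u. w x u \<partial>lborel \<partial>lborel))" .
  have 2: "(\<integral>\<^sup>+x. \<integral>\<^sup>+u. w x u \<partial>lborel \<partial>lborel) = (\<integral>\<^sup>+u. \<integral>\<^sup>+x. w x u \<partial>lborel \<partial>lborel)"
    by (rule lborel_pair.Fubini'[symmetric, OF wm])
  have "2 * (\<integral>\<^sup>+u. \<integral>\<^sup>+x. w x u \<partial>lborel \<partial>lborel) = (\<integral>\<^sup>+u. 2 * (\<integral>\<^sup>+x. w x u \<partial>lborel) \<partial>lborel)"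
  proof (rule nn_integral_cmult[symmetric])
    show "(\<lambda>u. \<integral>\<^sup>+x. w x u \<partial>lborel) \<in> borel_measurable lborel"
      using measurable_pair_swap[OF wm] by (intro lborel.borel_measurable_nn_integral) (simp add: case_prod_beta)
  qed
  also have "\<dots> = (\<integral>\<^sup>+u. ennreal (u powr p_exp * (1 - u) powr \<beta> * indicator {0..1} u) *
    (\<integral>\<^sup>+\<omega>. \<integral>\<^sup>+v. G (sqrt (u * v) *\<^sub>R \<omega>, u) \<partial>beta_measure q_exp \<gamma> \<partial>sphere_measure) \<partial>lborel)"
    by (simp only: inner_x_integral[OF assms(1)] w_def)
  also have "\<dots> = (\<integral>\<^sup>+u. \<integral>\<^sup>+\<omega>. \<integral>\<^sup>+v. G (sqrt (u * v) *\<^sub>R \<omega>, u) \<partial>beta_measure q_exp \<gamma> \<partial>sphere_measure \<partial>beta_measure p_exp \<beta>)"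
    unfolding beta_measure_def[of p_exp \<beta>] by (subst nn_integral_density) auto
  also have "\<dots> = (\<integral>\<^sup>+u. \<integral>\<^sup>+y. G (sep_map (u, y)) \<partial>(sphere_measure \<Otimes>\<^sub>M beta_measure q_exp \<gamma>) \<partial>beta_measure p_exp \<beta>)"
    by (subst V.nn_integral_fst[symmetric]) (auto simp: sep_map_def)
  also have "\<dots> = (\<integral>\<^sup>+z. G (sep_map z) \<partial>sep_measure)"
    unfolding sep_measure_def
  proof (rule SV.P.nn_integral_fst)
    show "(\<lambda>z. G (sep_map z)) \<in> borel_measurable (beta_measure p_exp \<beta> \<Otimes>\<^sub>M (sphere_measure \<Otimes>\<^sub>M beta_measure q_exp \<gamma>))"
      using measurable_compose[OF sep_map_measurable assms(1)] by (simp add: sep_measure_def)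
  qed
  finally show ?thesis unfolding 1 2 by (rule arg_cong)
qed

text \<open>As an equality of measures on (x, u)-space, the separation transfers real integrals and
  integrability alike, without a splitting by sign.\<close>

lemma cone_measure_eq:
  assumes a: "a > 0"
  shows "distr (density lborel (\<lambda>z. ennreal (weight_Wa a \<alpha> \<beta> \<gamma> \<theta> z * indicator (cone_Xa a) z)))
      borel (\<lambda>z. (fst z :: 'a, tau_sq a z)) =
    density (distr sep_measure borel sep_map) (\<lambda>_. ennreal (a powr (\<beta> + \<gamma> + \<theta> + 1/2) / 2))"
    (is "?L = ?R")
proof (rule measure_eqI)
  note [measurable] = cone_Xa_measurable[OF a]
  fix A assume "A \<in> sets ?L"
  then have A[measurable]: "A \<in> sets borel" by simp
  have T[measurable]: "(\<lambda>z. (fst z :: 'a, tau_sq a z)) \<in> borel_measurable borel"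
    unfolding borel_prod[symmetric] by measurable (simp add: borel_prod)
  have "emeasure ?L A = (\<integral>\<^sup>+z. indicator A z \<partial>?L)" by simp
  also have "\<dots> = (\<integral>\<^sup>+z. indicator A (fst z, tau_sq a z) * ennreal (weight_Wa a \<alpha> \<beta> \<gamma> \<theta> z) *
      indicator (cone_Xa a) z \<partial>lborel)" (is "_ = ?I")
    by (subst nn_integral_distr)
       (auto simp: nn_integral_density intro!: nn_integral_cong split: split_indicator)
  finally have L: "emeasure ?L A = ?I" .
  have "emeasure ?R A = ennreal (a powr (\<beta> + \<gamma> + \<theta> + 1/2) / 2) * (\<integral>\<^sup>+z. indicator A z \<partial>distr sep_measure borel sep_map)"
    by (subst emeasure_density_const) auto
  also have "\<dots> = ennreal (a powr (\<beta> + \<gamma> + \<theta> + 1/2) / 2) * (\<integral>\<^sup>+z. indicator A (sep_map z) \<partial>sep_measure)"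
    by (subst nn_integral_distr) auto
  also have "2 * \<dots> = 2 * ?I"
  proof -
    have "2 * ennreal (a powr (\<beta> + \<gamma> + \<theta> + 1/2) / 2) = ennreal (a powr (\<beta> + \<gamma> + \<theta> + 1/2))"
      using ennreal_mult[of 2 "a powr (\<beta> + \<gamma> + \<theta> + 1/2) / 2"] by simp
    then show ?thesis
      using nn_integral_cone[of "indicator A", OF _ a] by (simp add: mult.assoc[symmetric])
  qed
  finally have "2 * emeasure ?R A = 2 * emeasure ?L A" unfolding L .
  then show "emeasure ?L A = emeasure ?R A"
    by (simp add: ennreal_mult_cancel_left)
qed simp

lemma integral_cone:
  fixes F :: "'a \<times> real \<Rightarrow> real"
  assumes [measurable]: "F \<in> borel_measurable borel" and a: "a > 0"
  shows "(LINT z:cone_Xa a|lborel. F (fst z, tau_sq a z) * weight_Wa a \<alpha> \<beta> \<gamma> \<theta> z) =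
    a powr (\<beta> + \<gamma> + \<theta> + 1/2) / 2 * (\<integral>z. F (sep_map z) \<partial>sep_measure)"
    and "integrable sep_measure (\<lambda>z. F (sep_map z)) \<Longrightarrow>
      set_integrable lborel (cone_Xa a) (\<lambda>z. F (fst z, tau_sq a z) * weight_Wa a \<alpha> \<beta> \<gamma> \<theta> z)"
proof -
  note [measurable] = cone_Xa_measurable[OF a]
  let ?D = "density lborel (\<lambda>z::'a \<times> real. ennreal (weight_Wa a \<alpha> \<beta> \<gamma> \<theta> z * indicator (cone_Xa a) z))"
  let ?T = "\<lambda>z. (fst z :: 'a, tau_sq a z)"
  let ?K = "a powr (\<beta> + \<gamma> + \<theta> + 1/2) / 2"
  have K: "?K > 0" using a by simp
  have T[measurable]: "?T \<in> borel_measurable borel"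
    unfolding borel_prod[symmetric] by measurable (simp add: borel_prod)
  have nn: "AE z in lborel. 0 \<le> weight_Wa a \<alpha> \<beta> \<gamma> \<theta> z * indicator (cone_Xa a) (z :: 'a \<times> real)"
    by (auto simp: weight_Wa_nonneg)
  have eq: "(weight_Wa a \<alpha> \<beta> \<gamma> \<theta> z * indicator (cone_Xa a) z) *\<^sub>R F (?T z) =
      indicator (cone_Xa a) z *\<^sub>R (F (?T z) * weight_Wa a \<alpha> \<beta> \<gamma> \<theta> z)" for z
    by (simp add: mult_ac)
  have "(LINT z:cone_Xa a|lborel. F (?T z) * weight_Wa a \<alpha> \<beta> \<gamma> \<theta> z) = (\<integral>z. F (?T z) \<partial>?D)"
    unfolding set_lebesgue_integral_def eq[symmetric]
    by (rule integral_density[symmetric, OF _ _ nn]) measurable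
  also have "\<dots> = (\<integral>z. F z \<partial>distr ?D borel ?T)" by (rule integral_distr[symmetric]) auto
  also have "\<dots> = (\<integral>z. ?K *\<^sub>R F z \<partial>distr sep_measure borel sep_map)"
    unfolding cone_measure_eq[OF a] using K by (subst integral_density) auto
  also have "\<dots> = ?K * (\<integral>z. F (sep_map z) \<partial>sep_measure)"
    by (subst integral_distr) auto
  finally show "(LINT z:cone_Xa a|lborel. F (?T z) * weight_Wa a \<alpha> \<beta> \<gamma> \<theta> z) =
    ?K * (\<integral>z. F (sep_map z) \<partial>sep_measure)" .
  assume "integrable sep_measure (\<lambda>z. F (sep_map z))"
  then have "integrable (distr sep_measure borel sep_map) (\<lambda>z. ?K *\<^sub>R F z)"
    by (subst integrable_distr_eq) auto
  then have "integrable (distr ?D borel ?T) F"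
    unfolding cone_measure_eq[OF a]
    by (subst integrable_density[where g = "\<lambda>_. ?K"]) (use K in \<open>simp_all add: less_imp_le\<close>)
  then have "integrable ?D (\<lambda>z. F (?T z))"
    by (subst (asm) integrable_distr_eq) auto
  then have "integrable lborel (\<lambda>z. (weight_Wa a \<alpha> \<beta> \<gamma> \<theta> z * indicator (cone_Xa a) z) *\<^sub>R F (?T z))"
    by (rule integrable_density[OF _ _ nn, THEN iffD1, rotated -1]) measurable
  then show "set_integrable lborel (cone_Xa a) (\<lambda>z. F (?T z) * weight_Wa a \<alpha> \<beta> \<gamma> \<theta> z)"
    unfolding set_integrable_def eq .
qed

end

section \<open>The bases in separated coordinates\<close>

lemma (in pair_sigma_finite) integrable_mult_pair:
  fixes f :: "'a \<Rightarrow> real" and g :: "'b \<Rightarrow> real"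
  assumes f: "integrable M1 f" and g: "integrable M2 g"
  shows "integrable (M1 \<Otimes>\<^sub>M M2) (\<lambda>z. f (fst z) * g (snd z))"
    and "(\<integral>z. f (fst z) * g (snd z) \<partial>(M1 \<Otimes>\<^sub>M M2)) = (\<integral>x. f x \<partial>M1) * (\<integral>y. g y \<partial>M2)"
proof -
  have [measurable]: "f \<in> borel_measurable M1" "g \<in> borel_measurable M2" using f g by auto
  show int: "integrable (M1 \<Otimes>\<^sub>M M2) (\<lambda>z. f (fst z) * g (snd z))"
  proof (rule Fubini_integrable)
    show "integrable M1 (\<lambda>x. \<integral>y. norm (f (fst (x, y)) * g (snd (x, y))) \<partial>M2)"
      using f by (simp add: abs_mult)
    show "AE x in M1. integrable M2 (\<lambda>y. f (fst (x, y)) * g (snd (x, y)))"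
      using g by simp
  qed measurable
  show "(\<integral>z. f (fst z) * g (snd z) \<partial>(M1 \<Otimes>\<^sub>M M2)) = (\<integral>x. f x \<partial>M1) * (\<integral>y. g y \<partial>M2)"
    using integral_fst'[OF int] by simp
qed

lemma integrable_sphere_measure:
  fixes f :: "'a::euclidean_space \<Rightarrow> real"
  assumes f: "continuous_on UNIV f"
  shows "integrable sphere_measure f"
proof -
  interpret finite_measure "sphere_measure :: 'a measure" by (rule finite_measure_sphere_measure)
  have "compact (f ` sphere 0 1)"
    using f by (intro compact_continuous_image) (auto intro: continuous_on_subset)
  then obtain B where B: "\<And>v. v \<in> sphere 0 1 \<Longrightarrow> norm (f v) \<le> B"
    using compact_imp_bounded bounded_iff[of "f ` sphere 0 1"] by blast
  have "f \<in> borel_measurable borel" using f by (rule borel_measurable_continuous_onI)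
  moreover have "AE v in sphere_measure. norm (f v) \<le> B"
    using AE_sphere_measure_norm by eventually_elim (use B in auto)
  ultimately show ?thesis by (intro integrable_const_bound) auto
qed

text \<open>Triangularity: the leading coefficient is removed at each step. Nonvanishing is a
  separate assumption because degree 0 by itself admits the zero polynomial.\<close>

lemma poly_expansion_by_degrees:
  fixes P :: "nat \<Rightarrow> 'f::field poly"
  assumes P: "\<And>m. degree (P m) = m" "\<And>m. P m \<noteq> 0" and r: "degree r \<le> N"
  shows "\<exists>c. r = (\<Sum>m\<le>N. smult (c m) (P m))"
  using r
proof (induction N arbitrary: r)
  case 0
  obtain p where p: "P 0 = [:p:]" using P(1)[of 0] degree_0_id by metis
  then have "p \<noteq> 0" using P(2)[of 0] by auto
  obtain r0 where "r = [:r0:]" using 0 degree_0_id by (metis le_0_eq)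
  then show ?case using p \<open>p \<noteq> 0\<close> by (intro exI[of _ "\<lambda>_. r0 / p"]) simp
next
  case (Suc N)
  let ?c = "coeff r (Suc N) / coeff (P (Suc N)) (Suc N)"
  have nz: "coeff (P (Suc N)) (Suc N) \<noteq> 0"
    using P[of "Suc N"] by (metis leading_coeff_0_iff)
  have "degree (r - smult ?c (P (Suc N))) \<le> N"
  proof (rule degree_le, intro allI impI)
    fix i assume "N < i"
    show "coeff (r - smult ?c (P (Suc N))) i = 0"
    proof (cases "i = Suc N")
      case False
      then have "degree r < i" "degree (P (Suc N)) < i" using Suc.prems P(1) \<open>N < i\<close> by auto
      then show ?thesis by (simp add: coeff_eq_0)
    qed (use nz in simp)
  qed
  from Suc.IH[OF this] obtain c where
    c: "r - smult ?c (P (Suc N)) = (\<Sum>m\<le>N. smult (c m) (P m))" by blast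
  have "(\<Sum>m\<le>N. smult ((c(Suc N := ?c)) m) (P m)) = (\<Sum>m\<le>N. smult (c m) (P m))"
    by (rule sum.cong) auto
  then have "r = (\<Sum>m\<le>Suc N. smult ((c(Suc N := ?c)) m) (P m))"
    using c by (simp add: algebra_simps)
  then show ?case by blast
qed

text \<open>\<open>hom_eval p N r u\<close> is the homogenization $u^N p(r/u)$.\<close>

definition hom_eval :: "real poly \<Rightarrow> nat \<Rightarrow> real \<Rightarrow> real \<Rightarrow> real" where
  "hom_eval p N r u = (\<Sum>s\<le>N. coeff p s * r ^ s * u ^ (N - s))"

text \<open>With r = u v the powers of u combine to u^N without any division, so u = 0 is
  included.\<close>

lemma hom_eval_mult:
  assumes "degree p \<le> N"
  shows "hom_eval p N (u * v) u = u ^ N * poly p v"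
proof -
  have "hom_eval p N (u * v) u = (\<Sum>s\<le>N. u ^ N * (coeff p s * v ^ s))"
    unfolding hom_eval_def
    by (intro sum.cong) (auto simp: power_mult_distrib power_add[symmetric] mult_ac)
  also have "\<dots> = u ^ N * (\<Sum>s\<le>degree p. coeff p s * v ^ s)"
    unfolding sum_distrib_left
    by (rule sum.mono_neutral_right) (use assms in \<open>auto simp: coeff_eq_0\<close>)
  finally show ?thesis by (simp add: poly_altdef)
qed

text \<open>Polynomials of different degrees can be homogenized to a common degree, the lower ones
  picking up powers of u.\<close>

lemma hom_eval_shift:
  assumes "degree p \<le> N"
  shows "hom_eval p (N + e) r u = hom_eval p N r u * u ^ e"
proof -
  have "hom_eval p (N + e) r u = (\<Sum>s\<le>N. coeff p s * r ^ s * u ^ (N + e - s))"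
    unfolding hom_eval_def
    by (rule sum.mono_neutral_right) (use assms in \<open>auto simp: coeff_eq_0\<close>)
  also have "\<dots> = hom_eval p N r u * u ^ e"
    unfolding hom_eval_def sum_distrib_right
    by (rule sum.cong) (auto simp: power_add[symmetric] mult.assoc)
  finally show ?thesis .
qed

lemma hom_eval_sum_smult:
  "hom_eval (\<Sum>i\<in>I. smult (c i) (p i)) N r u = (\<Sum>i\<in>I. c i * hom_eval (p i) N r u)"
  unfolding hom_eval_def coeff_sum coeff_smult sum_distrib_right sum_distrib_left
  by (subst sum.swap) (simp add: mult.assoc)

lemma hom_eval_monom: "k \<le> N \<Longrightarrow> hom_eval (monom 1 k) N r u = r ^ k * u ^ (N - k)"
  by (simp add: hom_eval_def sum.delta if_distribR if_distrib[of "\<lambda>c. c * _"] cong: if_cong)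

lemma integral_beta_measure_shift:
  fixes f :: "real \<Rightarrow> real"
  assumes [measurable]: "f \<in> borel_measurable borel"
  shows "(\<integral>v. f v * v ^ k \<partial>beta_measure p q) = (\<integral>v. f v \<partial>beta_measure (p + real k) q)"
proof -
  have "(\<integral>v. f v * v ^ k \<partial>beta_measure p q) =
      (\<integral>v. v powr p * (1 - v) powr q * indicator {0..1} v * (f v * v ^ k) \<partial>lborel)"
    by (rule integral_beta_measure) measurable
  also have "\<dots> = (\<integral>v. v powr (p + real k) * (1 - v) powr q * indicator {0..1} v * f v \<partial>lborel)"
  proof (intro Bochner_Integration.integral_cong refl)
    fix v :: real
    show "v powr p * (1 - v) powr q * indicator {0..1} v * (f v * v ^ k) =
        v powr (p + real k) * (1 - v) powr q * indicator {0..1} v * f v"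
    proof (cases "v > 0")
      case True
      then show ?thesis by (simp add: powr_add powr_realpow)
    qed (auto split: split_indicator)
  qed
  also have "\<dots> = (\<integral>v. f v \<partial>beta_measure (p + real k) q)"
    by (rule integral_beta_measure[symmetric]) measurable
  finally show ?thesis .
qed

section \<open>Product integrals and the Jacobi factors in u and v\<close>

context cone_weight
begin

lemma sep_integral:
  fixes f h :: "real \<Rightarrow> real" and g :: "'a \<Rightarrow> real"
  assumes "continuous_on UNIV f" "continuous_on UNIV g" "continuous_on UNIV h"
  shows "integrable sep_measure (\<lambda>z. f (fst z) * (g (fst (snd z)) * h (snd (snd z))))"
    and "(\<integral>z. f (fst z) * (g (fst (snd z)) * h (snd (snd z))) \<partial>sep_measure) =
      (\<integral>u. f u \<partial>beta_measure p_exp \<beta>) * ((\<integral>\<omega>. g \<omega> \<partial>sphere_measure) * (\<integral>v. h v \<partial>beta_measure q_exp \<gamma>))"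
proof -
  interpret S: finite_measure "sphere_measure :: 'a measure" by (rule finite_measure_sphere_measure)
  interpret V: finite_measure "beta_measure q_exp \<gamma>" by (rule finite_measure_beta_measure[OF q_exp \<gamma>])
  interpret U: finite_measure "beta_measure p_exp \<beta>" by (rule finite_measure_beta_measure[OF p_exp \<beta>])
  interpret SV: pair_sigma_finite "sphere_measure :: 'a measure" "beta_measure q_exp \<gamma>" ..
  interpret USV: pair_sigma_finite "beta_measure p_exp \<beta>" "(sphere_measure :: 'a measure) \<Otimes>\<^sub>M beta_measure q_exp \<gamma>" ..
  note f = integrable_beta_measure[OF p_exp \<beta> assms(1)]
  note g = integrable_sphere_measure[OF assms(2)]
  note h = integrable_beta_measure[OF q_exp \<gamma> assms(3)]
  note gh = SV.integrable_mult_pair[OF g h]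
  note fgh = USV.integrable_mult_pair[OF f gh(1)]
  show "integrable sep_measure (\<lambda>z. f (fst z) * (g (fst (snd z)) * h (snd (snd z))))"
    using fgh(1) by (simp add: sep_measure_def)
  show "(\<integral>z. f (fst z) * (g (fst (snd z)) * h (snd (snd z))) \<partial>sep_measure) =
      (\<integral>u. f u \<partial>beta_measure p_exp \<beta>) * ((\<integral>\<omega>. g \<omega> \<partial>sphere_measure) * (\<integral>v. h v \<partial>beta_measure q_exp \<gamma>))"
    using fgh(2) gh(2) by (simp add: sep_measure_def)
qed

lemma AE_sep_measure:
  "AE z in sep_measure. 0 < fst z \<and> norm (fst (snd z)) = 1 \<and> 0 < snd (snd z)"
proof -
  interpret S: finite_measure "sphere_measure :: 'a measure" by (rule finite_measure_sphere_measure)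
  interpret V: finite_measure "beta_measure q_exp \<gamma>" by (rule finite_measure_beta_measure[OF q_exp \<gamma>])
  interpret U: finite_measure "beta_measure p_exp \<beta>" by (rule finite_measure_beta_measure[OF p_exp \<beta>])
  interpret SV: pair_sigma_finite "sphere_measure :: 'a measure" "beta_measure q_exp \<gamma>" ..
  interpret USV: pair_sigma_finite "beta_measure p_exp \<beta>" "(sphere_measure :: 'a measure) \<Otimes>\<^sub>M beta_measure q_exp \<gamma>" ..
  have 1: "AE y in (sphere_measure :: 'a measure) \<Otimes>\<^sub>M beta_measure q_exp \<gamma>. norm (fst y) = 1 \<and> 0 < snd y"
  proof (rule SV.AE_pair_measure)
    show "AE \<omega> in (sphere_measure :: 'a measure). AE v in beta_measure q_exp \<gamma>. norm (fst (\<omega>, v)) = 1 \<and> 0 < snd (\<omega>, v)"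
      using AE_sphere_measure_norm
    proof eventually_elim
      case (elim \<omega>)
      show ?case using AE_beta_measure by eventually_elim (use elim in auto)
    qed
  qed measurable
  show ?thesis
    unfolding sep_measure_def
  proof (rule USV.AE_pair_measure)
    show "AE u in beta_measure p_exp \<beta>. AE y in (sphere_measure :: 'a measure) \<Otimes>\<^sub>M beta_measure q_exp \<gamma>.
        0 < fst (u, y) \<and> norm (fst (snd (u, y))) = 1 \<and> 0 < snd (snd (u, y))"
      using AE_beta_measure
    proof eventually_elim
      case (elim u)
      show ?case using 1 by eventually_elim (use elim in auto)
    qed
  qed measurable
qed

text \<open>The factor (\<lambda>+\<mu>)_m / (\<mu>+1/2)_m of the even generalized Gegenbauer
  polynomial, for \<lambda> = \<beta> + 1/2 and \<mu> = k + p + 1/2.\<close>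

definition gegenbauer_const :: "nat \<Rightarrow> nat \<Rightarrow> real" where
  "gegenbauer_const k m =
     pochhammer (real k + p_exp + \<beta> + 1) m / pochhammer (real k + p_exp + 1) m"

text \<open>
  The constant may vanish in degrees other than the one under consideration. It is then replaced
  by 1, since the completeness argument needs a basis in every degree.
\<close>

definition U_poly :: "nat \<Rightarrow> nat \<Rightarrow> real poly" where
  "U_poly k m = smult (if gegenbauer_const k m = 0 then 1 else gegenbauer_const k m)
     (jacobi_unit_poly \<beta> (real k + p_exp) m)"

definition V_poly :: "nat \<Rightarrow> nat \<Rightarrow> real poly" where
  "V_poly i j = jacobi_unit_poly \<gamma> (real i + q_exp) j"

lemma degree_U_poly: "degree (U_poly k m) = m"
  using degree_jacobi_unit_poly[of \<beta> "real k + p_exp" m] p_exp \<beta> by (simp add: U_poly_def)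

lemma degree_V_poly: "degree (V_poly i j) = j"
  using degree_jacobi_unit_poly[of \<gamma> "real i + q_exp" j] q_exp \<gamma> by (simp add: V_poly_def)

lemma jacobi_unit_poly_nonzero: "a > -1 \<Longrightarrow> b > -1 \<Longrightarrow> jacobi_unit_poly a b n \<noteq> 0"
proof (cases n)
  case 0
  then show ?thesis by (simp add: jacobi_unit_poly_def jacobi_coeff_def)
next
  case (Suc m)
  then show "a > -1 \<Longrightarrow> b > -1 \<Longrightarrow> ?thesis" using degree_jacobi_unit_poly[of a b n] by auto
qed

lemma U_poly_nonzero: "U_poly k m \<noteq> 0"
  using jacobi_unit_poly_nonzero[of \<beta> "real k + p_exp" m] p_exp \<beta> by (simp add: U_poly_def)

lemma V_poly_nonzero: "V_poly i j \<noteq> 0"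
  using jacobi_unit_poly_nonzero[of \<gamma> "real i + q_exp" j] q_exp \<gamma> by (simp add: V_poly_def)

lemma U_poly_orthogonal:
  assumes "m \<noteq> m'"
  shows "(\<integral>u. poly (U_poly k m) u * poly (U_poly k m') u \<partial>beta_measure (p_exp + real k) \<beta>) = 0"
proof -
  have *: "(\<integral>u. poly (jacobi_unit_poly \<beta> (real k + p_exp) m) u * poly (jacobi_unit_poly \<beta> (real k + p_exp) m') u
      \<partial>beta_measure (p_exp + real k) \<beta>) = 0"
    using jacobi_unit_poly_orthogonal[OF \<beta> _ assms, of "real k + p_exp"] p_exp by (simp add: add.commute)
  have "(\<integral>u. (c * f u) * (c' * g u) \<partial>M) = c * c' * (\<integral>u. f u * g u \<partial>M)" for c c' :: real and f g and M :: "real measure"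
    by (simp add: mult_ac flip: integral_mult_right_zero)
  then show ?thesis using * by (simp only: U_poly_def poly_smult mult_zero_right)
qed

lemma V_poly_orthogonal:
  assumes "j \<noteq> j'"
  shows "(\<integral>v. poly (V_poly i j) v * poly (V_poly i j') v \<partial>beta_measure (q_exp + real i) \<gamma>) = 0"
  using jacobi_unit_poly_orthogonal[OF \<gamma> _ assms, of "real i + q_exp"] q_exp
  by (simp add: V_poly_def add.commute)

end

section \<open>Even polynomials\<close>

lemma Basis_prod_sum:
  fixes e :: "'a::euclidean_space \<times> real \<Rightarrow> nat"
  shows "sum e Basis = (\<Sum>b\<in>Basis. e (b, 0)) + e (0, 1)"
proof -
  have "(\<lambda>b::'a. (b, 0::real)) ` Basis \<inter> (\<lambda>c. (0, c)) ` Basis = {}" by auto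
  then show ?thesis
    by (simp add: Basis_prod_def sum.union_disjoint sum.reindex inj_on_def)
qed

lemma monomial_fun_prod:
  fixes e :: "'a::euclidean_space \<times> real \<Rightarrow> nat"
  shows "monomial_fun e (x, t) = monomial_fun (\<lambda>b. e (b, 0)) x * t ^ e (0, 1)"
proof -
  have "(\<lambda>b::'a. (b, 0::real)) ` Basis \<inter> (\<lambda>c. (0, c)) ` Basis = {}" by auto
  then show ?thesis
    by (simp add: monomial_fun_def Basis_prod_def prod.union_disjoint prod.reindex inj_on_def)
qed

lemma poly_space_fst:
  fixes f :: "'a::euclidean_space \<Rightarrow> real"
  assumes "f \<in> poly_space S"
  shows "(\<lambda>z::'a \<times> real. f (fst z)) \<in> poly_space S"
proof -
  have "poly_space S \<subseteq> {f. (\<lambda>z::'a \<times> real. f (fst z)) \<in> poly_space S}"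
  proof (rule poly_space_subset)
    fix e :: "'a \<Rightarrow> nat" assume e: "sum e Basis \<in> S"
    define e' where "e' = (\<lambda>z::'a \<times> real. if snd z = 0 then e (fst z) else 0)"
    have "(\<lambda>z::'a \<times> real. monomial_fun e (fst z)) = monomial_fun e'"
    proof
      fix z :: "'a \<times> real"
      show "monomial_fun e (fst z) = monomial_fun e' z"
        by (cases z) (simp add: monomial_fun_prod e'_def)
    qed
    moreover have "sum e' Basis \<in> S" using e by (simp add: Basis_prod_sum e'_def)
    ultimately show "monomial_fun e \<in> {f. (\<lambda>z::'a \<times> real. f (fst z)) \<in> poly_space S}"
      by (simp add: monomial_in_poly_space)
  qed (auto intro!: subspace_funI intro: poly_space_zero poly_space_add poly_space_scale)
  then show ?thesis using assms by blast
qed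

lemma poly_space_snd: "(\<lambda>z::'a::euclidean_space \<times> real. snd z) \<in> poly_space {1}"
proof -
  have "(0, 1) \<in> (Basis :: ('a \<times> real) set)" by (simp add: Basis_prod_def)
  from poly_space_inner[OF this] show ?thesis by (simp add: inner_prod_def)
qed

lemma poly_space_tau_sq: "(tau_sq a :: 'a::euclidean_space \<times> real \<Rightarrow> real) \<in> poly_space {2}"
proof -
  have x: "(\<lambda>z::'a \<times> real. (norm (fst z))\<^sup>2) \<in> poly_space {2}"
    by (rule poly_space_fst[OF poly_space_norm_power2])
  have t: "(\<lambda>z::'a \<times> real. (snd z)\<^sup>2) \<in> poly_space {2}"
    using poly_space_power[OF poly_space_snd, of 2] by simp
  have "(\<lambda>z::'a \<times> real. (norm (fst z))\<^sup>2 + 1 / a * ((snd z)\<^sup>2 - (norm (fst z))\<^sup>2)) \<in> poly_space {2}"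
    by (intro poly_space_add poly_space_scale poly_space_diff x t)
  then show ?thesis by (simp add: tau_sq_def[abs_def])
qed

definition even_part :: "('a \<times> real \<Rightarrow> real) \<Rightarrow> 'a \<times> real \<Rightarrow> real" where
  "even_part f z = (f z + f (fst z, - snd z)) / 2"

lemma even_part_eq: "(\<And>x t. f (x, - t) = f (x, t)) \<Longrightarrow> even_part f = f"
  by (auto simp: even_part_def fun_eq_iff)

text \<open>Only even powers of t survive in the even part, and t^2 = (1 - a)|x|^2 + a u is expanded
  by the binomial theorem. This keeps the total degree, as u counts 2.\<close>

lemma even_part_poly_space:
  fixes a :: real
  assumes a: "a > 0"
  defines "G n \<equiv> {\<lambda>z::'a::euclidean_space \<times> real. norm (fst z) ^ (2 * p) * tau_sq a z ^ q * h (fst z) | p q h i.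
      h \<in> harmonics i \<and> 2 * p + 2 * q + i \<le> n}"
  shows "f \<in> poly_space {..n} \<Longrightarrow> even_part f \<in> span (G n)"
proof -
  \<comment> \<open>The harmonic decomposition is applied to the factor in x alone; its powers of
    |x|^2 merge with those that come from t.\<close>
  have factor: "(\<lambda>z. g (fst z) * (norm (fst z) ^ (2 * s) * tau_sq a z ^ q)) \<in> span (G n)"
    if g: "g \<in> poly_space {c}" and deg: "c + 2 * s + 2 * q \<le> n" for g :: "'a \<Rightarrow> real" and c s q
  proof -
    have "span {\<lambda>x. norm x ^ (2 * p) * h x | p h i. h \<in> harmonics i \<and> 2 * p + i = c} \<subseteq>
        {g::'a \<Rightarrow> real. (\<lambda>z. g (fst z) * (norm (fst z) ^ (2 * s) * tau_sq a z ^ q)) \<in> span (G n)}"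
    proof (rule span_minimal)
      show "{\<lambda>x. norm x ^ (2 * p) * h x | p h i. h \<in> harmonics i \<and> 2 * p + i = c} \<subseteq>
        {g::'a \<Rightarrow> real. (\<lambda>z. g (fst z) * (norm (fst z) ^ (2 * s) * tau_sq a z ^ q)) \<in> span (G n)}"
      proof clarify
        fix p i and h :: "'a \<Rightarrow> real" assume h: "h \<in> harmonics i" "c = 2 * p + i"
        have "(\<lambda>z. norm (fst z) ^ (2 * p) * h (fst z) * (norm (fst z) ^ (2 * s) * tau_sq a z ^ q)) =
            (\<lambda>z. norm (fst z) ^ (2 * (p + s)) * tau_sq a z ^ q * h (fst z))"
          by (simp add: fun_eq_iff power_add distrib_left mult_ac)
        moreover have "\<dots> \<in> G n"
          unfolding G_def using h deg
          by (intro CollectI exI[of _ "p + s"] exI[of _ q] exI[of _ h] exI[of _ i]) simp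
        ultimately show "(\<lambda>z. norm (fst z) ^ (2 * p) * h (fst z) * (norm (fst z) ^ (2 * s) * tau_sq a z ^ q)) \<in> span (G n)"
          by (simp add: span_base)
      qed
      show "subspace {g::'a \<Rightarrow> real. (\<lambda>z. g (fst z) * (norm (fst z) ^ (2 * s) * tau_sq a z ^ q)) \<in> span (G n)}"
      proof (rule subspace_funI)
        fix c g assume "g \<in> {g::'a \<Rightarrow> real. (\<lambda>z. g (fst z) * (norm (fst z) ^ (2 * s) * tau_sq a z ^ q)) \<in> span (G n)}"
        from subspace_fun_scale[OF subspace_span this[unfolded mem_Collect_eq], of c]
        show "(\<lambda>x. c * g x) \<in> {g::'a \<Rightarrow> real. (\<lambda>z. g (fst z) * (norm (fst z) ^ (2 * s) * tau_sq a z ^ q)) \<in> span (G n)}"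
          by (simp add: mult.assoc)
      qed (auto simp: distrib_right intro: subspace_fun_zero subspace_fun_add)
    qed
    then show ?thesis using harmonic_decomposition[of c] g by blast
  qed
  have "poly_space {..n} \<subseteq> {f. even_part f \<in> span (G n)}"
  proof (rule poly_space_subset)
    fix e :: "'a \<times> real \<Rightarrow> nat" assume e: "sum e Basis \<in> {..n}"
    define e' where "e' = (\<lambda>b. e (b, 0))"
    define k where "k = e (0, 1)"
    have mon: "monomial_fun e = (\<lambda>z. monomial_fun e' (fst z) * snd z ^ k)"
      by (simp add: fun_eq_iff monomial_fun_prod e'_def k_def)
    have deg: "sum e' Basis + k \<le> n" using e by (simp add: Basis_prod_sum e'_def k_def)
    show "monomial_fun e \<in> {f. even_part f \<in> span (G n)}"
    proof (cases "even k")
      case False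
      then have "even_part (monomial_fun e) = (\<lambda>z. 0)"
        by (simp add: mon even_part_def fun_eq_iff)
      then show ?thesis by (simp add: subspace_fun_zero)
    next
      case True
      then obtain q where k: "k = 2 * q" by blast
      have "even_part (monomial_fun e) = (\<lambda>z. \<Sum>s\<le>q. (real (q choose s) * (1 - a) ^ s * a ^ (q - s)) *
        (monomial_fun e' (fst z) * (norm (fst z) ^ (2 * s) * tau_sq a z ^ (q - s))))"
      proof
        fix z :: "'a \<times> real"
        have "(snd z)\<^sup>2 = (1 - a) * (norm (fst z))\<^sup>2 + a * tau_sq a z"
          using a by (simp add: tau_sq_def field_simps)
        then have "snd z ^ k = ((1 - a) * (norm (fst z))\<^sup>2 + a * tau_sq a z) ^ q"
          by (simp add: k power_mult)
        also have "\<dots> = (\<Sum>s\<le>q. real (q choose s) * ((1 - a) * (norm (fst z))\<^sup>2) ^ s * (a * tau_sq a z) ^ (q - s))"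
          by (rule binomial_ring)
        finally have snd_power: "snd z ^ k = \<dots>" .
        have norm_power: "norm (fst z) ^ (2 * s) = ((norm (fst z))\<^sup>2) ^ s" for s by (rule power_mult)
        show "even_part (monomial_fun e) z = (\<Sum>s\<le>q. (real (q choose s) * (1 - a) ^ s * a ^ (q - s)) *
          (monomial_fun e' (fst z) * (norm (fst z) ^ (2 * s) * tau_sq a z ^ (q - s))))"
          using True unfolding norm_power
          by (simp add: snd_power even_part_def mon sum_distrib_left power_mult_distrib mult_ac)
      qed
      also have "\<dots> \<in> span (G n)"
      proof (rule subspace_fun_sum[OF subspace_span])
        fix s assume "s \<in> {..q}"
        then have "sum e' Basis + 2 * s + 2 * (q - s) \<le> n" using deg k by auto
        from factor[OF monomial_in_poly_space[of e' "{sum e' Basis}"] this]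
        show "(\<lambda>z. (real (q choose s) * (1 - a) ^ s * a ^ (q - s)) *
          (monomial_fun e' (fst z) * (norm (fst z) ^ (2 * s) * tau_sq a z ^ (q - s)))) \<in> span (G n)"
          by (intro subspace_fun_scale[OF subspace_span]) simp
      qed
      finally show ?thesis by simp
    qed
  next
    show "subspace {f. even_part f \<in> span (G n)}"
    proof (rule subspace_funI)
      fix f g assume "f \<in> {f. even_part f \<in> span (G n)}" "g \<in> {f. even_part f \<in> span (G n)}"
      moreover have "even_part (\<lambda>x. f x + g x) = (\<lambda>x. even_part f x + even_part g x)"
        by (simp add: even_part_def fun_eq_iff add_divide_distrib)
      ultimately show "(\<lambda>x. f x + g x) \<in> {f. even_part f \<in> span (G n)}"
        by (simp add: subspace_fun_add)
    next
      fix c f assume "f \<in> {f. even_part f \<in> span (G n)}"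
      moreover have "even_part (\<lambda>x. c * f x) = (\<lambda>x. c * even_part f x)"
        by (simp add: even_part_def fun_eq_iff algebra_simps)
      ultimately show "(\<lambda>x. c * f x) \<in> {f. even_part f \<in> span (G n)}"
        by (simp add: subspace_fun_scale)
    next
      have "even_part (\<lambda>x. 0) = (\<lambda>x::'a \<times> real. 0)" by (simp add: even_part_def fun_eq_iff)
      then show "(\<lambda>x. 0) \<in> {f. even_part f \<in> span (G n)}" by (simp add: subspace_fun_zero)
    qed
  qed
  then show "f \<in> poly_space {..n} \<Longrightarrow> even_part f \<in> span (G n)" by blast
qed

section \<open>Orthogonality and completeness\<close>

locale cone_basis = cone_weight space_type \<alpha> \<beta> \<gamma> \<theta>
  for space_type :: "'a::euclidean_space itself" and \<alpha> \<beta> \<gamma> \<theta> :: real +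
  fixes a :: real and Y :: "nat \<Rightarrow> nat \<Rightarrow> 'a \<Rightarrow> real"
  assumes a: "a > 0"
    and Y: "\<And>i. orthonormal_basis sphere_inner
              {1..dim (harmonics i :: ('a \<Rightarrow> real) set)} (Y i) (harmonics i)"
begin

abbreviation "cn \<equiv> cone_Xa a :: ('a \<times> real) set"
abbreviation "wt \<equiv> weight_Wa a \<alpha> \<beta> \<gamma> \<theta> :: 'a \<times> real \<Rightarrow> real"
abbreviation "ip \<equiv> L2_inner wt cn"

text \<open>All degrees at once, with the harmonic degree i as a free index, so that independence
  and spanning can be stated for one family.\<close>

definition idx :: "(nat \<times> nat \<times> nat \<times> nat) set" where
  "idx = {(m, j, i, l). l \<in> {1..dim (harmonics i :: ('a \<Rightarrow> real) set)}}"

fun deg_idx :: "nat \<times> nat \<times> nat \<times> nat \<Rightarrow> nat" where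
  "deg_idx (m, j, i, l) = 2 * m + 2 * j + i"

fun sep_fun :: "nat \<times> nat \<times> nat \<times> nat \<Rightarrow> 'a \<times> real \<Rightarrow> real" where
  "sep_fun (m, j, i, l) (x, u) =
     poly (U_poly (2 * j + i) m) u * hom_eval (V_poly i j) j ((norm x)\<^sup>2) u * Y i l x"

declare sep_fun.simps [simp del]

definition basis_fun :: "nat \<times> nat \<times> nat \<times> nat \<Rightarrow> 'a \<times> real \<Rightarrow> real" where
  "basis_fun \<iota> z = sep_fun \<iota> (fst z, tau_sq a z)"

lemma Y_span: "span (Y i ` {1..dim (harmonics i :: ('a \<Rightarrow> real) set)}) = harmonics i"
  using Y[of i] by (simp add: orthonormal_basis_def orthogonal_basis_def)

lemma Y_harmonic: "l \<in> {1..dim (harmonics i :: ('a \<Rightarrow> real) set)} \<Longrightarrow> Y i l \<in> harmonics i"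
  using Y_span[of i] by (metis imageI span_base)

lemma Y_continuous: "(m, j, i, l) \<in> idx \<Longrightarrow> continuous_on A (Y i l)"
  by (rule continuous_on_poly_space[OF harmonics_poly_space[OF Y_harmonic]]) (simp add: idx_def)

text \<open>Different degrees fall under the orthogonality of harmonics. Within one degree the
  normalising constant of \<open>sphere_inner\<close> cannot be 0, because some inner product equals
  1; hence \<open>sphere_inner\<close> and the plain integral vanish together.\<close>

lemma Y_integral:
  assumes "l \<in> {1..dim (harmonics i :: ('a \<Rightarrow> real) set)}" "l' \<in> {1..dim (harmonics i' :: ('a \<Rightarrow> real) set)}"
  shows "(\<integral>\<omega>. Y i l \<omega> * Y i' l' \<omega> \<partial>sphere_measure) = 0 \<longleftrightarrow> (i, l) \<noteq> (i', l')"
proof -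
  have nz: "sphere_inner (Y i l) (Y i l) = 1"
    using Y[of i] assms(1) by (simp add: orthonormal_basis_def)
  show ?thesis
  proof (cases "i = i'")
    case False
    then show ?thesis using harmonics_sphere_orthogonal[OF assms[THEN Y_harmonic]] by simp
  next
    case True
    show ?thesis
    proof (cases "l = l'")
      case True
      then show ?thesis using nz \<open>i = i'\<close> unfolding sphere_inner_def by auto
    next
      case False
      then have "sphere_inner (Y i l) (Y i l') = 0"
        using Y[of i] assms \<open>i = i'\<close> by (auto simp: orthonormal_basis_def orthogonal_basis_def)
      then show ?thesis using nz \<open>i = i'\<close> False unfolding sphere_inner_def by auto
    qed
  qed
qed

lemma sep_fun_measurable: "\<iota> \<in> idx \<Longrightarrow> sep_fun \<iota> \<in> borel_measurable borel"
proof -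
  assume \<iota>: "\<iota> \<in> idx"
  obtain m j i l where eq: "\<iota> = (m, j, i, l)" by (cases \<iota>) auto
  have "sep_fun \<iota> = (\<lambda>z. poly (U_poly (2 * j + i) m) (snd z) *
      hom_eval (V_poly i j) j ((norm (fst z))\<^sup>2) (snd z) * Y i l (fst z))"
    by (simp add: eq fun_eq_iff sep_fun.simps)
  moreover have "continuous_on UNIV \<dots>"
    unfolding hom_eval_def
    by (intro continuous_intros continuous_on_compose2[OF Y_continuous[OF \<iota>[unfolded eq], of UNIV]]) auto
  ultimately show ?thesis by (simp add: borel_measurable_continuous_onI)
qed

text \<open>The harmonic factor contributes the power i of the root of u v. A single basis function
  thus carries half-integer powers of u and v, which become integral in products with equal
  i.\<close>

lemma sep_fun_sep_map:
  assumes "0 < u" "norm \<omega> = 1" "0 < v" and l: "l \<in> {1..dim (harmonics i :: ('a \<Rightarrow> real) set)}"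
  shows "sep_fun (m, j, i, l) (sep_map (u, \<omega>, v)) =
    (poly (U_poly (2 * j + i) m) u * u ^ j * sqrt u ^ i) * (Y i l \<omega> * (poly (V_poly i j) v * sqrt v ^ i))"
proof -
  have "Y i l (sqrt (u * v) *\<^sub>R \<omega>) = sqrt (u * v) ^ i * Y i l \<omega>"
    by (rule poly_space_homogeneous[OF harmonics_poly_space[OF Y_harmonic[OF l]]])
  moreover have "(norm (sqrt (u * v) *\<^sub>R \<omega>))\<^sup>2 = u * v" using assms by simp
  ultimately show ?thesis
    using assms by (simp add: sep_fun.simps sep_map_def hom_eval_mult degree_V_poly real_sqrt_mult power_mult_distrib)
qed

lemma integral_sep_fun:
  assumes "(m, j, i, l) \<in> idx" "(m', j', i', l') \<in> idx"
  shows "integrable sep_measure (\<lambda>z. sep_fun (m, j, i, l) (sep_map z) * sep_fun (m', j', i', l') (sep_map z))"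
    and "(\<integral>z. sep_fun (m, j, i, l) (sep_map z) * sep_fun (m', j', i', l') (sep_map z) \<partial>sep_measure) =
      (\<integral>u. (poly (U_poly (2 * j + i) m) u * u ^ j * sqrt u ^ i) *
            (poly (U_poly (2 * j' + i') m') u * u ^ j' * sqrt u ^ i') \<partial>beta_measure p_exp \<beta>) *
      ((\<integral>\<omega>. Y i l \<omega> * Y i' l' \<omega> \<partial>sphere_measure) *
       (\<integral>v. (poly (V_poly i j) v * sqrt v ^ i) * (poly (V_poly i' j') v * sqrt v ^ i') \<partial>beta_measure q_exp \<gamma>))"
proof -
  let ?f = "\<lambda>u. (poly (U_poly (2 * j + i) m) u * u ^ j * sqrt u ^ i) *
            (poly (U_poly (2 * j' + i') m') u * u ^ j' * sqrt u ^ i')"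
  let ?g = "\<lambda>\<omega>. Y i l \<omega> * Y i' l' \<omega>"
  let ?h = "\<lambda>v. (poly (V_poly i j) v * sqrt v ^ i) * (poly (V_poly i' j') v * sqrt v ^ i')"
  have l: "l \<in> {1..dim (harmonics i :: ('a \<Rightarrow> real) set)}" "l' \<in> {1..dim (harmonics i' :: ('a \<Rightarrow> real) set)}"
    using assms by (auto simp: idx_def)
  have eq: "AE z in sep_measure. sep_fun (m, j, i, l) (sep_map z) * sep_fun (m', j', i', l') (sep_map z) =
      ?f (fst z) * (?g (fst (snd z)) * ?h (snd (snd z)))"
    using AE_sep_measure
  proof eventually_elim
    case (elim z)
    obtain u \<omega> v where z: "z = (u, \<omega>, v)" by (cases z)
    show ?case
      using elim sep_fun_sep_map[OF _ _ _ l(1), of u \<omega> v m j] sep_fun_sep_map[OF _ _ _ l(2), of u \<omega> v m' j']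
      by (simp add: z mult_ac)
  qed
  have cont: "continuous_on UNIV ?f" "continuous_on UNIV ?g" "continuous_on UNIV ?h"
    by (intro continuous_intros Y_continuous[OF assms(1)] Y_continuous[OF assms(2)])+
  note sep = sep_integral[OF cont]
  have meas: "(\<lambda>z. sep_fun (m, j, i, l) (sep_map z) * sep_fun (m', j', i', l') (sep_map z)) \<in> borel_measurable sep_measure"
    by (intro borel_measurable_times measurable_compose[OF sep_map_measurable] sep_fun_measurable assms)
  note meas' = borel_measurable_integrable[OF sep(1)]
  show "integrable sep_measure (\<lambda>z. sep_fun (m, j, i, l) (sep_map z) * sep_fun (m', j', i', l') (sep_map z))"
    using sep(1) integrable_cong_AE[OF meas meas' eq] by simp
  show "(\<integral>z. sep_fun (m, j, i, l) (sep_map z) * sep_fun (m', j', i', l') (sep_map z) \<partial>sep_measure) =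
    (\<integral>u. ?f u \<partial>beta_measure p_exp \<beta>) * ((\<integral>\<omega>. ?g \<omega> \<partial>sphere_measure) * (\<integral>v. ?h v \<partial>beta_measure q_exp \<gamma>))"
    unfolding integral_cong_AE[OF meas meas' eq] by (rule sep(2))
qed

text \<open>The common powers of two basis functions move into the weight and raise its exponent.
  This is the origin of the index-dependent Jacobi parameters: 2j + i + p in u and, with j = 0 here,
  i + q in v.\<close>

lemma integral_power_weight:
  assumes "continuous_on UNIV f" "continuous_on UNIV g"
  shows "(\<integral>v. (f v * v ^ j * sqrt v ^ i) * (g v * v ^ j * sqrt v ^ i) \<partial>beta_measure p q) =
    (\<integral>v. f v * g v \<partial>beta_measure (p + real (2 * j + i)) q)"
proof -
  have [measurable]: "f \<in> borel_measurable borel" "g \<in> borel_measurable borel"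
    using assms by (simp_all add: borel_measurable_continuous_onI)
  have "(\<integral>v. (f v * v ^ j * sqrt v ^ i) * (g v * v ^ j * sqrt v ^ i) \<partial>beta_measure p q) =
      (\<integral>v. (f v * g v) * v ^ (2 * j + i) \<partial>beta_measure p q)"
  proof (rule integral_cong_AE)
    show "AE v in beta_measure p q. (f v * v ^ j * sqrt v ^ i) * (g v * v ^ j * sqrt v ^ i) =
        (f v * g v) * v ^ (2 * j + i)"
      using AE_beta_measure
    proof eventually_elim
      case (elim v)
      have "v ^ (2 * j + i) = (v ^ j * v ^ j) * (sqrt v ^ i * sqrt v ^ i)"
        using elim by (simp add: power_add mult_2 power_mult_distrib[symmetric])
      then show ?case by (simp only: mult_ac)
    qed
  qed measurable
  also have "\<dots> = (\<integral>v. f v * g v \<partial>beta_measure (p + real (2 * j + i)) q)"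
    by (rule integral_beta_measure_shift) measurable
  finally show ?thesis .
qed

text \<open>The parameters of the v-factor depend on i and those of the u-factor on 2j + i. So (i,
  l) is compared first, by the sphere; equal i puts the v-factors into one Jacobi family, which
  separates j; equal j then does the same for u and m.\<close>

lemma sep_fun_orthogonal:
  assumes "\<iota> \<in> idx" "\<iota>' \<in> idx" "\<iota> \<noteq> \<iota>'"
  shows "(\<integral>z. sep_fun \<iota> (sep_map z) * sep_fun \<iota>' (sep_map z) \<partial>sep_measure) = 0"
proof -
  obtain m j i l m' j' i' l' where \<iota>: "\<iota> = (m, j, i, l)" "\<iota>' = (m', j', i', l')"
    by (cases \<iota>, cases \<iota>') auto
  note int = integral_sep_fun(2)[OF assms(1,2)[unfolded \<iota>]]
  show ?thesis
  proof (cases "(i, l) = (i', l')")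
    case False
    then show ?thesis using assms Y_integral[of l i l' i'] unfolding \<iota> int by (simp add: idx_def)
  next
    case il: True
    show ?thesis
    proof (cases "j = j'")
      case False
      have "(\<integral>v. (poly (V_poly i j) v * sqrt v ^ i) * (poly (V_poly i j') v * sqrt v ^ i) \<partial>beta_measure q_exp \<gamma>) = 0"
        using integral_power_weight[where f = "poly (V_poly i j)" and g = "poly (V_poly i j')" and j = 0
              and i = i and p = q_exp and q = \<gamma>] V_poly_orthogonal[OF False]
        by (simp add: continuous_intros)
      then show ?thesis using il unfolding \<iota> int by simp
    next
      case True
      then have "m \<noteq> m'" using assms(3) il \<iota> by auto
      have "(\<integral>u. (poly (U_poly (2 * j + i) m) u * u ^ j * sqrt u ^ i) *
            (poly (U_poly (2 * j + i) m') u * u ^ j * sqrt u ^ i) \<partial>beta_measure p_exp \<beta>) =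
          (\<integral>u. poly (U_poly (2 * j + i) m) u * poly (U_poly (2 * j + i) m') u
          \<partial>beta_measure (p_exp + real (2 * j + i)) \<beta>)"
        by (intro integral_power_weight continuous_intros)
      also have "\<dots> = 0" using U_poly_orthogonal[OF \<open>m \<noteq> m'\<close>] .
      finally show ?thesis using il True unfolding \<iota> int by simp
    qed
  qed
qed

lemma sep_fun_norm_nonzero:
  assumes "\<iota> \<in> idx"
  shows "(\<integral>z. sep_fun \<iota> (sep_map z) * sep_fun \<iota> (sep_map z) \<partial>sep_measure) \<noteq> 0"
proof -
  obtain m j i l where \<iota>: "\<iota> = (m, j, i, l)" by (cases \<iota>) auto
  have "(\<integral>v. (poly (V_poly i j) v * sqrt v ^ i) * (poly (V_poly i j) v * sqrt v ^ i) \<partial>beta_measure q_exp \<gamma>) =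
      (\<integral>v. poly (V_poly i j) v * poly (V_poly i j) v \<partial>beta_measure (q_exp + real i) \<gamma>)"
    using integral_power_weight[where f = "poly (V_poly i j)" and g = "poly (V_poly i j)" and j = 0
        and i = i and p = q_exp and q = \<gamma>] by (simp add: continuous_intros)
  also have "\<dots> > 0"
    using q_exp by (intro integral_beta_measure_poly_square_pos \<gamma> V_poly_nonzero) simp
  finally have V: "(\<integral>v. (poly (V_poly i j) v * sqrt v ^ i) * (poly (V_poly i j) v * sqrt v ^ i) \<partial>beta_measure q_exp \<gamma>) > 0" .
  have "(\<integral>u. (poly (U_poly (2 * j + i) m) u * u ^ j * sqrt u ^ i) *
        (poly (U_poly (2 * j + i) m) u * u ^ j * sqrt u ^ i) \<partial>beta_measure p_exp \<beta>) =
      (\<integral>u. poly (U_poly (2 * j + i) m) u * poly (U_poly (2 * j + i) m) u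
      \<partial>beta_measure (p_exp + real (2 * j + i)) \<beta>)"
    by (intro integral_power_weight continuous_intros)
  also have "\<dots> > 0"
    using p_exp by (intro integral_beta_measure_poly_square_pos \<beta> U_poly_nonzero) simp
  finally have U: "(\<integral>u. (poly (U_poly (2 * j + i) m) u * u ^ j * sqrt u ^ i) *
        (poly (U_poly (2 * j + i) m) u * u ^ j * sqrt u ^ i) \<partial>beta_measure p_exp \<beta>) > 0" .
  show ?thesis
    using U V integral_sep_fun(2)[OF assms[unfolded \<iota>] assms[unfolded \<iota>]] Y_integral[of l i l i] assms
    unfolding \<iota> by (simp add: idx_def)
qed

lemma sep_measure_total_pos: "(\<integral>z. 1 \<partial>sep_measure) > (0 :: real)"
proof -
  interpret S: finite_measure "sphere_measure :: 'a measure" by (rule finite_measure_sphere_measure)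
  have "{x::'a. norm x < 1} = ball 0 1" by auto
  then have "emeasure (sphere_measure :: 'a measure) UNIV = ennreal (real DIM('a)) * emeasure lborel (ball (0::'a) 1)"
    by (simp add: emeasure_sphere_measure)
  moreover have "emeasure lborel (ball (0::'a) 1) \<noteq> 0"
    using content_ball_pos[of 1 "0::'a"] by (auto simp: measure_def)
  ultimately have "emeasure (sphere_measure :: 'a measure) UNIV \<noteq> 0" by simp
  then have "measure (sphere_measure :: 'a measure) UNIV > 0"
    by (auto simp: S.emeasure_eq_measure zero_less_measure_iff)
  moreover have "(\<integral>v. 1 \<partial>beta_measure p q) > (0::real)" if "p > -1" "q > -1" for p q
    using integral_beta_measure_poly_square_pos[OF that, of 1] by simp
  ultimately show ?thesis
    using sep_integral(2)[of "\<lambda>_. 1" "\<lambda>_. 1" "\<lambda>_. 1"] p_exp q_exp \<beta> \<gamma>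
    by (simp add: zero_less_mult_iff)
qed

end

section \<open>The basis functions span the even polynomials\<close>

context cone_basis
begin

lemma basis_fun_eq:
  "basis_fun (m, j, i, l) = (\<lambda>z. poly (U_poly (2 * j + i) m) (tau_sq a z) *
     hom_eval (V_poly i j) j ((norm (fst z))\<^sup>2) (tau_sq a z) * Y i l (fst z))"
  by (simp add: fun_eq_iff basis_fun_def sep_fun.simps)

lemma basis_fun_poly_space:
  assumes "\<iota> \<in> idx"
  shows "basis_fun \<iota> \<in> poly_space {..deg_idx \<iota>}"
proof -
  obtain m j i l where \<iota>: "\<iota> = (m, j, i, l)" by (cases \<iota>) auto
  have tau: "(\<lambda>z::'a \<times> real. tau_sq a z ^ s) \<in> poly_space {s * 2}" for s
    by (rule poly_space_power[OF poly_space_tau_sq])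
  have nrm: "(\<lambda>z::'a \<times> real. ((norm (fst z))\<^sup>2) ^ s) \<in> poly_space {s * 2}" for s
    by (rule poly_space_power[OF poly_space_fst[OF poly_space_norm_power2]])
  have "(\<lambda>z::'a \<times> real. poly (U_poly (2 * j + i) m) (tau_sq a z)) \<in> poly_space {..2 * m}"
    unfolding poly_altdef degree_U_poly
  proof (intro poly_space_sum poly_space_scale)
    fix s assume "s \<in> {..m}"
    then show "(\<lambda>z::'a \<times> real. tau_sq a z ^ s) \<in> poly_space {..2 * m}"
      using tau[of s] poly_space_mono[of "{s * 2}" "{..2 * m}"] by auto
  qed
  moreover have "(\<lambda>z::'a \<times> real. hom_eval (V_poly i j) j ((norm (fst z))\<^sup>2) (tau_sq a z)) \<in> poly_space {..2 * j}"
    unfolding hom_eval_def mult.assoc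
  proof (intro poly_space_sum poly_space_scale)
    fix s assume "s \<in> {..j}"
    then show "(\<lambda>z::'a \<times> real. ((norm (fst z))\<^sup>2) ^ s * tau_sq a z ^ (j - s)) \<in> poly_space {..2 * j}"
      by (intro poly_space_mult[OF nrm tau]) auto
  qed
  ultimately have "(\<lambda>z::'a \<times> real. poly (U_poly (2 * j + i) m) (tau_sq a z) *
      hom_eval (V_poly i j) j ((norm (fst z))\<^sup>2) (tau_sq a z)) \<in> poly_space {..2 * m + 2 * j}"
    by (rule poly_space_mult) auto
  moreover have "(\<lambda>z::'a \<times> real. Y i l (fst z)) \<in> poly_space {i}"
    by (rule poly_space_fst[OF harmonics_poly_space[OF Y_harmonic]]) (use assms in \<open>simp add: \<iota> idx_def\<close>)
  ultimately have "(\<lambda>z. poly (U_poly (2 * j + i) m) (tau_sq a z) *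
     hom_eval (V_poly i j) j ((norm (fst z))\<^sup>2) (tau_sq a z) * Y i l (fst z)) \<in> poly_space {..deg_idx \<iota>}"
    by (rule poly_space_mult) (auto simp: \<iota>)
  then show ?thesis by (simp add: \<iota> basis_fun_eq)
qed

lemma basis_fun_even: "basis_fun \<iota> (x, - t) = basis_fun \<iota> (x, t)"
  by (simp add: basis_fun_def tau_sq_def)

definition "basis_upto n = basis_fun ` {\<iota> \<in> idx. deg_idx \<iota> \<le> n}"

text \<open>For fixed i and j, u^q is a combination of the u-factors with m at most q, as these have
  exact degree m.\<close>

lemma hom_basis_in_span:
  assumes l: "l \<in> {1..dim (harmonics i :: ('a \<Rightarrow> real) set)}" and deg: "2 * j + 2 * q + i \<le> n"
  shows "(\<lambda>z. tau_sq a z ^ q * hom_eval (V_poly i j) j ((norm (fst z))\<^sup>2) (tau_sq a z) * Y i l (fst z))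
    \<in> span (basis_upto n)"
proof -
  obtain c where c: "monom 1 q = (\<Sum>m\<le>q. smult (c m) (U_poly (2 * j + i) m))"
    using poly_expansion_by_degrees[of "U_poly (2 * j + i)" "monom 1 q" q] degree_U_poly U_poly_nonzero
    by (auto simp: degree_monom_eq)
  have "u ^ q = (\<Sum>m\<le>q. c m * poly (U_poly (2 * j + i) m) u)" for u
    using arg_cong[OF c, of "\<lambda>p. poly p u"] by (simp add: poly_monom poly_sum)
  then have "(\<lambda>z. tau_sq a z ^ q * hom_eval (V_poly i j) j ((norm (fst z))\<^sup>2) (tau_sq a z) * Y i l (fst z)) =
      (\<lambda>z. \<Sum>m\<le>q. c m * basis_fun (m, j, i, l) z)"
    by (simp add: basis_fun_eq sum_distrib_right mult.assoc)
  also have "\<dots> \<in> span (basis_upto n)"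
  proof (intro subspace_fun_sum subspace_fun_scale subspace_span span_base)
    fix m assume "m \<in> {..q}"
    then show "basis_fun (m, j, i, l) \<in> basis_upto n"
      unfolding basis_upto_def using l deg by (intro imageI) (auto simp: idx_def)
  qed
  finally show ?thesis .
qed

text \<open>Expanding v^p in the v-factors and homogenizing writes |x|^(2p) as a sum of homogenized
  factors of degree j times u^(p-j). The extra powers of u join u^q, and the previous expansion in u
  applies for each j.\<close>

lemma monomial_basis_in_span:
  assumes l: "l \<in> {1..dim (harmonics i :: ('a \<Rightarrow> real) set)}" and deg: "2 * p + 2 * q + i \<le> n"
  shows "(\<lambda>z. Y i l (fst z) * (norm (fst z) ^ (2 * p) * tau_sq a z ^ q)) \<in> span (basis_upto n)"
proof -
  obtain c where c: "monom 1 p = (\<Sum>j\<le>p. smult (c j) (V_poly i j))"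
    using poly_expansion_by_degrees[of "V_poly i" "monom 1 p" p] degree_V_poly V_poly_nonzero
    by (auto simp: degree_monom_eq)
  have power_eq: "r ^ p = (\<Sum>j\<le>p. c j * (hom_eval (V_poly i j) j r u * u ^ (p - j)))" for r u
  proof -
    have "r ^ p = (\<Sum>j\<le>p. c j * hom_eval (V_poly i j) p r u)"
      using arg_cong[OF c, of "\<lambda>f. hom_eval f p r u"] by (simp add: hom_eval_monom hom_eval_sum_smult)
    also have "\<dots> = (\<Sum>j\<le>p. c j * (hom_eval (V_poly i j) j r u * u ^ (p - j)))"
    proof (rule sum.cong[OF refl])
      fix j assume "j \<in> {..p}"
      then show "c j * hom_eval (V_poly i j) p r u = c j * (hom_eval (V_poly i j) j r u * u ^ (p - j))"
        using hom_eval_shift[of "V_poly i j" j "p - j" r u] by (simp add: degree_V_poly)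
    qed
    finally show ?thesis .
  qed
  have "(\<lambda>z. Y i l (fst z) * (norm (fst z) ^ (2 * p) * tau_sq a z ^ q)) =
      (\<lambda>z. \<Sum>j\<le>p. c j * (tau_sq a z ^ (p - j + q) *
        hom_eval (V_poly i j) j ((norm (fst z))\<^sup>2) (tau_sq a z) * Y i l (fst z)))"
  proof
    fix z :: "'a \<times> real"
    show "Y i l (fst z) * (norm (fst z) ^ (2 * p) * tau_sq a z ^ q) =
      (\<Sum>j\<le>p. c j * (tau_sq a z ^ (p - j + q) *
        hom_eval (V_poly i j) j ((norm (fst z))\<^sup>2) (tau_sq a z) * Y i l (fst z)))"
      unfolding power_mult power_eq[of "(norm (fst z))\<^sup>2" "tau_sq a z"]
      by (simp only: sum_distrib_left sum_distrib_right power_add mult_ac)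
  qed
  also have "\<dots> \<in> span (basis_upto n)"
  proof (intro subspace_fun_sum subspace_fun_scale subspace_span)
    fix j assume "j \<in> {..p}"
    then have "2 * j + 2 * (p - j + q) + i \<le> n" using deg by auto
    from hom_basis_in_span[OF l this]
    show "(\<lambda>z. tau_sq a z ^ (p - j + q) * hom_eval (V_poly i j) j ((norm (fst z))\<^sup>2) (tau_sq a z) *
      Y i l (fst z)) \<in> span (basis_upto n)" .
  qed
  finally show ?thesis .
qed

lemma even_part_in_span:
  assumes "f \<in> poly_space {..n}"
  shows "even_part f \<in> span (basis_upto n)"
proof -
  have "{\<lambda>z::'a \<times> real. norm (fst z) ^ (2 * p) * tau_sq a z ^ q * h (fst z) | p q h i.
      h \<in> harmonics i \<and> 2 * p + 2 * q + i \<le> n} \<subseteq> span (basis_upto n)"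
  proof clarify
    fix p q i and h :: "'a \<Rightarrow> real" assume h: "h \<in> harmonics i" and deg: "2 * p + 2 * q + i \<le> n"
    have "span (Y i ` {1..dim (harmonics i :: ('a \<Rightarrow> real) set)}) \<subseteq>
        {h. (\<lambda>z. h (fst z) * (norm (fst z) ^ (2 * p) * tau_sq a z ^ q)) \<in> span (basis_upto n)}"
    proof (rule span_minimal)
      show "subspace {h. (\<lambda>z. h (fst z) * (norm (fst z) ^ (2 * p) * tau_sq a z ^ q)) \<in> span (basis_upto n)}"
      proof (rule subspace_funI)
        fix c g assume "g \<in> {h. (\<lambda>z. h (fst z) * (norm (fst z) ^ (2 * p) * tau_sq a z ^ q)) \<in> span (basis_upto n)}"
        from subspace_fun_scale[OF subspace_span this[unfolded mem_Collect_eq], of c]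
        show "(\<lambda>x. c * g x) \<in> {h. (\<lambda>z. h (fst z) * (norm (fst z) ^ (2 * p) * tau_sq a z ^ q)) \<in> span (basis_upto n)}"
          by (simp add: mult.assoc)
      qed (auto simp: distrib_right intro: subspace_fun_zero subspace_fun_add)
    qed (use monomial_basis_in_span[OF _ deg] in auto)
    then have "h \<in> {h. (\<lambda>z. h (fst z) * (norm (fst z) ^ (2 * p) * tau_sq a z ^ q)) \<in> span (basis_upto n)}"
      using h unfolding Y_span by blast
    then show "(\<lambda>z. norm (fst z) ^ (2 * p) * tau_sq a z ^ q * h (fst z)) \<in> span (basis_upto n)"
      by (simp add: mult.commute)
  qed
  then show ?thesis
    using even_part_poly_space[OF a assms] span_minimal[OF _ subspace_span] by blast
qed

end

section \<open>Inner products on the domain\<close>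

context cone_weight
begin

lemma weight_integral:
  assumes a: "a > 0"
  shows "(LINT z:cone_Xa a|lborel. weight_Wa a \<alpha> \<beta> \<gamma> \<theta> (z :: 'a \<times> real)) =
      a powr (\<beta> + \<gamma> + \<theta> + 1/2) / 2 * (\<integral>z. 1 \<partial>sep_measure)"
    and "set_integrable lborel (cone_Xa a) (weight_Wa a \<alpha> \<beta> \<gamma> \<theta> :: 'a \<times> real \<Rightarrow> real)"
proof -
  show "(LINT z:cone_Xa a|lborel. weight_Wa a \<alpha> \<beta> \<gamma> \<theta> (z :: 'a \<times> real)) =
      a powr (\<beta> + \<gamma> + \<theta> + 1/2) / 2 * (\<integral>z. 1 \<partial>sep_measure)"
    using integral_cone(1)[of "\<lambda>_. 1" a, OF _ a] by simp
  have "integrable sep_measure (\<lambda>z. 1 :: real)"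
    using sep_integral(1)[of "\<lambda>_. 1" "\<lambda>_. 1" "\<lambda>_. 1"] by simp
  then have "set_integrable lborel (cone_Xa a) (\<lambda>z::'a \<times> real. 1 * weight_Wa a \<alpha> \<beta> \<gamma> \<theta> z)"
    by (rule integral_cone(2)[where F = "\<lambda>_. 1", OF borel_measurable_const a])
  then show "set_integrable lborel (cone_Xa a) (weight_Wa a \<alpha> \<beta> \<gamma> \<theta> :: 'a \<times> real \<Rightarrow> real)"
    by (simp only: mult_1)
qed

text \<open>The constant with a stands in numerator and denominator and cancels; the equality of
  norms rests on this. Agreement on the domain suffices, so the printed formulas may be used for f
  and g although they are not polynomials elsewhere.\<close>

lemma L2_inner_cone:
  fixes f g F G :: "'a \<times> real \<Rightarrow> real"
  assumes a: "a > 0" and [measurable]: "F \<in> borel_measurable borel" "G \<in> borel_measurable borel"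
    and f: "\<And>z. z \<in> cone_Xa a \<Longrightarrow> f z = F (fst z, tau_sq a z)"
    and g: "\<And>z. z \<in> cone_Xa a \<Longrightarrow> g z = G (fst z, tau_sq a z)"
  shows "L2_inner (weight_Wa a \<alpha> \<beta> \<gamma> \<theta>) (cone_Xa a) f g =
    (\<integral>z. F (sep_map z) * G (sep_map z) \<partial>sep_measure) / (\<integral>z. 1 \<partial>sep_measure)"
proof -
  have "(LINT z:cone_Xa a|lborel. f z * g z * weight_Wa a \<alpha> \<beta> \<gamma> \<theta> z) =
      (LINT z:cone_Xa a|lborel. (F (fst z, tau_sq a z) * G (fst z, tau_sq a z)) * weight_Wa a \<alpha> \<beta> \<gamma> \<theta> z)"
    by (rule set_lebesgue_integral_cong) (auto simp: f g cone_Xa_measurable[OF a])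
  also have "\<dots> = a powr (\<beta> + \<gamma> + \<theta> + 1/2) / 2 * (\<integral>z. F (sep_map z) * G (sep_map z) \<partial>sep_measure)"
    using a by (intro integral_cone(1)) auto
  finally show ?thesis
    unfolding L2_inner_def weight_integral(1)[OF a] using a by simp
qed

end

context cone_basis
begin

text \<open>On the domain |x|^2 \<le> u \<le> 1, and t^2 = |x|^2 - a |x|^2 + a u is at most 1 +
  a.\<close>

lemma bounded_cone: "bounded cn"
proof (rule boundedI)
  fix z assume "z \<in> cn"
  then have *: "(norm (fst z))\<^sup>2 \<le> (snd z)\<^sup>2" "tau_sq a z \<le> 1" using cone_Xa_eq[OF a] by auto
  have t: "(snd z)\<^sup>2 = (1 - a) * (norm (fst z))\<^sup>2 + a * tau_sq a z"
    using a by (simp add: tau_sq_def field_simps)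
  have "(norm (fst z))\<^sup>2 \<le> tau_sq a z" using * a by (simp add: tau_sq_def)
  then have x: "(norm (fst z))\<^sup>2 \<le> 1" using * by linarith
  have "a * tau_sq a z \<le> a" "a * (norm (fst z))\<^sup>2 \<ge> 0" using * a by auto
  then have "(snd z)\<^sup>2 \<le> 1 + a" using t x by (simp add: algebra_simps)
  then have "(norm z)\<^sup>2 \<le> 2 + a" using x by (cases z) (simp add: norm_Pair)
  then show "norm z \<le> sqrt (2 + a)" by (rule real_le_rsqrt)
qed

lemma compact_cone: "compact cn"
proof -
  have "closed cn"
    unfolding cone_Xa_eq[OF a] tau_sq_def using a
    by (intro closed_Collect_conj closed_Collect_le continuous_intros) auto
  then show ?thesis using bounded_cone by (simp add: compact_eq_bounded_closed)
qed

text \<open>Polynomials with odd powers of t are not functions of (x, u), so the separation does not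
  reach them; here compactness of the domain and integrability of the weight do.\<close>

lemma set_integrable_cone:
  assumes "continuous_on UNIV f"
  shows "set_integrable lborel cn (\<lambda>z. f z * wt z)"
proof -
  have "compact (f ` cn)"
    using assms by (intro compact_continuous_image compact_cone) (auto intro: continuous_on_subset)
  then obtain B where B: "\<And>z. z \<in> cn \<Longrightarrow> norm (f z) \<le> B"
    using compact_imp_bounded bounded_iff[of "f ` cn"] by blast
  have [measurable]: "f \<in> borel_measurable borel" using assms by (rule borel_measurable_continuous_onI)
  note [measurable] = cone_Xa_measurable[OF a]
  have "integrable lborel (\<lambda>z. B * (indicator cn z *\<^sub>R wt z))"
    using weight_integral(2)[OF a] by (simp add: set_integrable_def)
  then show ?thesis
    unfolding set_integrable_def
  proof (rule Bochner_Integration.integrable_bound)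
    show "AE z in lborel. norm (indicator cn z *\<^sub>R (f z * wt z)) \<le> norm (B * (indicator cn z *\<^sub>R wt z))"
    proof (rule AE_I2)
      fix z
      show "norm (indicator cn z *\<^sub>R (f z * wt z)) \<le> norm (B * (indicator cn z *\<^sub>R wt z))"
      proof (cases "z \<in> cn")
        case True
        then have "\<bar>f z\<bar> \<le> \<bar>B\<bar>" using B[OF True] by simp
        then show ?thesis using True weight_Wa_nonneg by (simp add: abs_mult mult_right_mono)
      qed simp
    qed
  qed measurable
qed

lemma ip_add_left:
  assumes "continuous_on UNIV f" "continuous_on UNIV g" "continuous_on UNIV h"
  shows "ip (f + g) h = ip f h + ip g h"
proof -
  have "(LINT z:cn|lborel. (f + g) z * h z * wt z) =
      (LINT z:cn|lborel. f z * h z * wt z + g z * h z * wt z)"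
    by (simp add: distrib_right)
  also have "\<dots> = (LINT z:cn|lborel. f z * h z * wt z) + (LINT z:cn|lborel. g z * h z * wt z)"
    by (rule set_integral_add) (intro set_integrable_cone continuous_intros assms)+
  finally show ?thesis by (simp add: L2_inner_def add_divide_distrib)
qed

lemma ip_scale_left: "ip (c *\<^sub>R f) h = c * ip f h"
  by (simp add: L2_inner_def scaleR_fun_def mult.assoc)

lemma ip_commute: "ip f g = ip g f"
  by (simp add: L2_inner_def mult.commute)

lemma ip_zero_left: "ip 0 h = 0"
  using ip_scale_left[of 0 0 h] by simp

lemma subspace_continuous: "subspace {f :: 'a \<times> real \<Rightarrow> real. continuous_on UNIV f}"
  by (rule subspace_funI) (auto intro: continuous_intros)

lemma ip_sum_left:
  assumes "\<And>v. v \<in> T \<Longrightarrow> continuous_on UNIV v" "continuous_on UNIV h"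
  shows "ip (\<Sum>v\<in>T. r v *\<^sub>R v) h = (\<Sum>v\<in>T. r v * ip v h)"
  using assms(1)
proof (induction T rule: infinite_finite_induct)
  case (insert v T)
  have "r v *\<^sub>R v \<in> {f. continuous_on UNIV f}"
    by (rule subspace_scale[OF subspace_continuous]) (use insert.prems in simp)
  moreover have "(\<Sum>v\<in>T. r v *\<^sub>R v) \<in> {f. continuous_on UNIV f}"
    by (rule subspace_sum[OF subspace_continuous], rule subspace_scale[OF subspace_continuous])
       (use insert.prems in simp)
  ultimately have "ip (r v *\<^sub>R v + (\<Sum>v\<in>T. r v *\<^sub>R v)) h = ip (r v *\<^sub>R v) h + ip (\<Sum>v\<in>T. r v *\<^sub>R v) h"
    using assms(2) by (intro ip_add_left) auto
  moreover have "ip (\<Sum>v\<in>T. r v *\<^sub>R v) h = (\<Sum>v\<in>T. r v * ip v h)"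
    using insert.prems by (intro insert.IH) simp
  ultimately show ?case by (simp only: sum.insert[OF insert.hyps] ip_scale_left)
qed (simp_all add: ip_zero_left)

text \<open>The product of \<open>f\<close> with the odd part of \<open>g\<close> integrates to 0 by reflection in \<open>t\<close>.\<close>

lemma ip_even_part:
  assumes f: "continuous_on UNIV f" "\<And>x t. f (x, - t) = f (x, t)" and g: "continuous_on UNIV g"
  shows "ip f g = ip f (even_part g)"
proof -
  have cont_refl: "continuous_on UNIV (\<lambda>z. g (fst z, - snd z))"
    by (intro continuous_on_compose2[OF g] continuous_intros) auto
  have cont_even: "continuous_on UNIV (even_part g)"
    unfolding even_part_def[abs_def] by (intro continuous_intros g cont_refl) simp
  define h where "h z = indicator cn z *\<^sub>R (f z * (g z - even_part g z) * wt z)" for z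
  have h_int: "integrable lborel h"
    unfolding h_def set_integrable_def[symmetric]
    by (intro set_integrable_cone continuous_intros f g cont_even)
  have h_odd: "h (x, - t) = - h (x, t)" for x t
  proof -
    have g_odd: "g (x, - t) - even_part g (x, - t) = - (g (x, t) - even_part g (x, t))"
      by (simp add: even_part_def field_simps)
    have cn_even: "indicator cn (x, - t) = (indicator cn (x, t) :: real)"
      by (simp add: cone_Xa_eq[OF a] tau_sq_def indicator_def)
    have wt_even: "wt (x, - t) = wt (x, t)" by simp
    show ?thesis
      unfolding h_def f(2) g_odd cn_even wt_even
      by (simp only: mult_minus_left mult_minus_right scaleR_minus_right)
  qed
  have "(\<integral>t. h (x, t) \<partial>lborel) = 0" for x
  proof -
    have "(\<integral>t. h (x, t) \<partial>lborel) = (\<integral>t. h (x, - t) \<partial>lborel)"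
      using lborel_integral_real_affine[of "-1" "\<lambda>t. h (x, t)" 0] by simp
    then show ?thesis unfolding h_odd by simp
  qed
  moreover have "(\<integral>x. \<integral>t. h (x, t) \<partial>lborel \<partial>lborel) = (\<integral>z. h z \<partial>lborel)"
    using h_int unfolding lborel_prod[symmetric] by (rule lborel_pair.integral_fst')
  ultimately have "(\<integral>z. h z \<partial>lborel) = 0" by simp
  moreover have "(\<integral>z. h z \<partial>lborel) =
      (LINT z:cn|lborel. f z * g z * wt z - f z * even_part g z * wt z)"
    by (simp add: h_def set_lebesgue_integral_def algebra_simps)
  moreover have "\<dots> = (LINT z:cn|lborel. f z * g z * wt z) - (LINT z:cn|lborel. f z * even_part g z * wt z)"
    by (rule set_integral_diff) (intro set_integrable_cone continuous_intros f g cont_even)+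
  ultimately show ?thesis by (simp add: L2_inner_def)
qed

lemma basis_fun_continuous: "\<iota> \<in> idx \<Longrightarrow> continuous_on A (basis_fun \<iota>)"
  by (rule continuous_on_poly_space[OF basis_fun_poly_space])

lemma ip_basis_fun:
  assumes "\<iota> \<in> idx" "\<iota>' \<in> idx"
  shows "ip (basis_fun \<iota>) (basis_fun \<iota>') = 0 \<longleftrightarrow> \<iota> \<noteq> \<iota>'"
proof -
  have "ip (basis_fun \<iota>) (basis_fun \<iota>') =
      (\<integral>z. sep_fun \<iota> (sep_map z) * sep_fun \<iota>' (sep_map z) \<partial>sep_measure) / (\<integral>z. 1 \<partial>sep_measure)"
    by (rule L2_inner_cone[OF a sep_fun_measurable sep_fun_measurable])
       (use assms in \<open>auto simp: basis_fun_def\<close>)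
  then show ?thesis
    using sep_fun_orthogonal[OF assms] sep_fun_norm_nonzero[OF assms(1)] sep_measure_total_pos by auto
qed

lemma inj_basis_fun: "inj_on basis_fun idx"
proof (rule inj_onI)
  fix \<iota> \<iota>' assume "\<iota> \<in> idx" "\<iota>' \<in> idx" "basis_fun \<iota> = basis_fun \<iota>'"
  then show "\<iota> = \<iota>'" using ip_basis_fun[of \<iota> \<iota>'] ip_basis_fun[of \<iota> \<iota>] by auto
qed

lemma orthogonal_coefficient:
  assumes "T \<subseteq> basis_fun ` idx" "finite T" "w \<in> T"
  shows "ip (\<Sum>v\<in>T. r v *\<^sub>R v) w = r w * ip w w" and "ip w w \<noteq> 0"
proof -
  have cont: "continuous_on UNIV v" if "v \<in> T" for v
    using that assms(1) basis_fun_continuous by auto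
  have "ip (\<Sum>v\<in>T. r v *\<^sub>R v) w = (\<Sum>v\<in>T. r v * ip v w)"
    by (rule ip_sum_left) (use cont assms(3) in auto)
  also have "\<dots> = (\<Sum>v\<in>T. if v = w then r w * ip w w else 0)"
  proof (rule sum.cong[OF refl])
    fix v assume "v \<in> T"
    then obtain \<iota> \<iota>' where "\<iota> \<in> idx" "v = basis_fun \<iota>" "\<iota>' \<in> idx" "w = basis_fun \<iota>'"
      using assms by (meson image_iff subsetD)
    then show "r v * ip v w = (if v = w then r w * ip w w else 0)" using ip_basis_fun by auto
  qed
  finally show "ip (\<Sum>v\<in>T. r v *\<^sub>R v) w = r w * ip w w" using assms by simp
  show "ip w w \<noteq> 0" using assms ip_basis_fun by auto
qed

lemma independent_basis_fun: "independent (basis_fun ` idx)"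
proof (rule independent_explicit_module[THEN iffD2], intro allI impI)
  fix T u w assume *: "finite T" "T \<subseteq> basis_fun ` idx" "(\<Sum>v\<in>T. u v *\<^sub>R v) = 0" "w \<in> T"
  then show "u w = 0" using orthogonal_coefficient(1)[of T w u] orthogonal_coefficient(2)[of T w] ip_zero_left[of w] by simp
qed

section \<open>The space of orthogonal polynomials of degree n\<close>

definition "basis_exact n = basis_fun ` {\<iota> \<in> idx. deg_idx \<iota> = n}"
definition "basis_below n = basis_fun ` {\<iota> \<in> idx. deg_idx \<iota> < n}"

text \<open>As v is even in t, g may be replaced by its even part, a combination of basis functions
  of degree below n. For n = 0 there is only g = 0.\<close>

lemma basis_exact_orthogonal_lower:
  assumes v: "v \<in> basis_exact n" and g: "g \<in> poly_space {..<n}"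
  shows "ip v g = 0"
proof -
  obtain \<iota> where \<iota>: "\<iota> \<in> idx" "deg_idx \<iota> = n" "v = basis_fun \<iota>"
    using v by (auto simp: basis_exact_def)
  note cont = basis_fun_continuous[OF \<iota>(1), of UNIV]
  have "ip v g = ip v (even_part g)"
    unfolding \<iota>(3) by (rule ip_even_part) (auto simp: basis_fun_even intro: cont continuous_on_poly_space[OF g])
  also have "\<dots> = 0"
  proof (cases n)
    case 0
    then have "g = (\<lambda>x. 0)" using g by (simp add: poly_space_def zero_fun_def)
    then have "even_part g = 0" by (simp add: even_part_def zero_fun_def fun_eq_iff)
    then show ?thesis using ip_zero_left ip_commute by metis
  next
    case (Suc k)
    then have "even_part g \<in> span (basis_upto k)"
      using even_part_in_span[of g k] g by (simp add: lessThan_Suc_atMost)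
    then obtain T r where T: "finite T" "T \<subseteq> basis_upto k" "even_part g = (\<Sum>w\<in>T. r w *\<^sub>R w)"
      unfolding span_explicit by auto
    have "ip w v = 0" if "w \<in> T" for w
    proof -
      obtain \<iota>' where "\<iota>' \<in> idx" "deg_idx \<iota>' \<le> k" "w = basis_fun \<iota>'"
        using \<open>w \<in> T\<close> T(2) by (auto simp: basis_upto_def)
      moreover from this have "\<iota>' \<noteq> \<iota>" using \<iota>(2) Suc by auto
      ultimately show ?thesis using ip_basis_fun \<iota> by blast
    qed
    moreover have "ip (even_part g) v = (\<Sum>w\<in>T. r w * ip w v)"
      unfolding T(3)
      by (rule ip_sum_left) (use T(2) \<iota>(3) cont basis_fun_continuous in \<open>auto simp: basis_upto_def\<close>)
    ultimately show ?thesis by (simp add: ip_commute)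
  qed
  finally show ?thesis .
qed

text \<open>An even f of degree at most n is x + y with x spanned in degree n and y in lower
  degrees. Then y = f - x is orthogonal to every lower polynomial, among them its own terms, so all
  its coefficients vanish.\<close>

lemma orth_polys_even_eq_span: "orth_polys_even n wt cn = span (basis_exact n)"
proof
  have sub: "subspace (orth_polys_even n wt cn)"
  proof -
    have cont: "continuous_on UNIV f" if "f \<in> orth_polys_even n wt cn" for f
      using that by (auto simp: orth_polys_even_def orth_polys_def intro: continuous_on_poly_space)
    have add: "f + g \<in> orth_polys_even n wt cn"
      if "f \<in> orth_polys_even n wt cn" "g \<in> orth_polys_even n wt cn" for f g
      using that cont[OF that(1)] cont[OF that(2)]
      by (auto simp: orth_polys_even_def orth_polys_def subspace_add[OF subspace_poly_space]
          ip_add_left continuous_on_poly_space)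
    have scale: "c *\<^sub>R f \<in> orth_polys_even n wt cn" if "f \<in> orth_polys_even n wt cn" for c f
      using that by (auto simp: orth_polys_even_def orth_polys_def subspace_scale[OF subspace_poly_space]
          ip_scale_left) (simp_all add: scaleR_fun_def)
    have "0 \<in> orth_polys_even n wt cn"
      by (auto simp: orth_polys_even_def orth_polys_def subspace_0[OF subspace_poly_space] ip_zero_left)
    then show ?thesis using add scale by (auto simp: subspace_def)
  qed
  have "basis_exact n \<subseteq> orth_polys_even n wt cn"
  proof
    fix v assume v: "v \<in> basis_exact n"
    then obtain \<iota> where \<iota>: "\<iota> \<in> idx" "deg_idx \<iota> = n" "v = basis_fun \<iota>"
      by (auto simp: basis_exact_def)
    then show "v \<in> orth_polys_even n wt cn"
      using basis_exact_orthogonal_lower[OF v] basis_fun_poly_space[OF \<iota>(1)]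
      by (simp add: orth_polys_even_def orth_polys_def basis_fun_even)
  qed
  then show "span (basis_exact n) \<subseteq> orth_polys_even n wt cn" using sub by (rule span_minimal)
  show "orth_polys_even n wt cn \<subseteq> span (basis_exact n)"
  proof
    fix f assume f: "f \<in> orth_polys_even n wt cn"
    then have fp: "f \<in> poly_space {..n}" and orth: "\<And>g. g \<in> poly_space {..<n} \<Longrightarrow> ip f g = 0"
      and ev: "\<And>x t. f (x, - t) = f (x, t)"
      by (auto simp: orth_polys_even_def orth_polys_def)
    have "f \<in> span (basis_upto n)"
      using even_part_in_span[OF fp] even_part_eq[of f] ev by simp
    also have "basis_upto n = basis_exact n \<union> basis_below n"
    proof -
      have "{\<iota> \<in> idx. deg_idx \<iota> \<le> n} = {\<iota> \<in> idx. deg_idx \<iota> = n} \<union> {\<iota> \<in> idx. deg_idx \<iota> < n}"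
        by (auto simp: le_less)
      then show ?thesis by (simp only: basis_upto_def basis_exact_def basis_below_def image_Un)
    qed
    finally obtain x y where xy: "f = x + y" "x \<in> span (basis_exact n)" "y \<in> span (basis_below n)"
      unfolding span_Un by blast
    obtain T r where T: "finite T" "T \<subseteq> basis_below n" "y = (\<Sum>v\<in>T. r v *\<^sub>R v)"
      using xy(3) unfolding span_explicit by auto
    have x: "x \<in> orth_polys_even n wt cn"
      using xy(2) \<open>span (basis_exact n) \<subseteq> orth_polys_even n wt cn\<close> by blast
    have "r w = 0" if w: "w \<in> T" for w
    proof -
      obtain \<iota> where \<iota>: "\<iota> \<in> idx" "deg_idx \<iota> < n" "w = basis_fun \<iota>"
        using w T(2) by (auto simp: basis_below_def)
      have wp: "w \<in> poly_space {..<n}"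
      proof -
        have "{..deg_idx \<iota>} \<subseteq> {..<n}" using \<iota>(2) by auto
        from poly_space_mono[OF this] show ?thesis using basis_fun_poly_space[OF \<iota>(1)] \<iota>(3) by auto
      qed
      have "y = f - x" using xy(1) by simp
      then have "y \<in> orth_polys_even n wt cn" using subspace_diff[OF sub f x] by simp
      then have "ip y w = 0" using wp by (auto simp: orth_polys_even_def orth_polys_def)
      moreover have "T \<subseteq> basis_fun ` idx" using T(2) by (auto simp: basis_below_def)
      ultimately show ?thesis using orthogonal_coefficient(1)[of T w r] orthogonal_coefficient(2)[of T w] T w by simp
    qed
    then have "y = 0" unfolding T(3) by (intro sum.neutral) auto
    then show "f \<in> span (basis_exact n)" using xy by simp
  qed
qed

section \<open>The index set and the explicit formulas\<close>

definition idx_of :: "nat \<Rightarrow> nat \<times> nat \<times> nat \<Rightarrow> nat \<times> nat \<times> nat \<times> nat" where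
  "idx_of n = (\<lambda>(m, j, l). (m, j, n - 2 * m - 2 * j, l))"

lemma idx_of_bij: "bij_betw (idx_of n) (basis_index TYPE('a) n) {\<iota> \<in> idx. deg_idx \<iota> = n}"
proof (rule bij_betwI')
  fix \<iota> assume "\<iota> \<in> {\<iota> \<in> idx. deg_idx \<iota> = n}"
  moreover obtain m j i l where "\<iota> = (m, j, i, l)" by (cases \<iota>) auto
  ultimately show "\<exists>x\<in>basis_index TYPE('a) n. \<iota> = idx_of n x"
    by (intro bexI[of _ "(m, j, l)"]) (auto simp: idx_of_def basis_index_def idx_def)
qed (auto simp: idx_of_def basis_index_def idx_def)

lemma orthogonal_basis_basis_fun:
  "orthogonal_basis ip (basis_index TYPE('a) n) (basis_fun \<circ> idx_of n) (orth_polys_even n wt cn)"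
proof -
  let ?I = "basis_index TYPE('a) n"
  have img: "idx_of n ` ?I = {\<iota> \<in> idx. deg_idx \<iota> = n}" and inj: "inj_on (idx_of n) ?I"
    using idx_of_bij by (auto simp: bij_betw_def)
  have im: "(basis_fun \<circ> idx_of n) ` ?I = basis_exact n"
    by (simp only: image_comp[symmetric] img basis_exact_def)
  have "inj_on (basis_fun \<circ> idx_of n) ?I"
    using inj inj_on_subset[OF inj_basis_fun] by (intro comp_inj_on) (auto simp: img)
  moreover have "independent (basis_exact n)"
    by (rule independent_mono[OF independent_basis_fun]) (auto simp: basis_exact_def)
  moreover have "ip (basis_fun (idx_of n x)) (basis_fun (idx_of n y)) = 0"
    if "x \<in> ?I" "y \<in> ?I" "x \<noteq> y" for x y
  proof -
    have "idx_of n x \<noteq> idx_of n y" using that inj by (auto dest: inj_onD)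
    moreover have "idx_of n x \<in> idx" "idx_of n y \<in> idx" using that img by auto
    ultimately show ?thesis using ip_basis_fun by blast
  qed
  ultimately show ?thesis
    unfolding orthogonal_basis_def im orth_polys_even_eq_span by auto
qed

text \<open>A factor of the numerator is k + s + p + \<beta> + 1 with k = n - 2m, and p + \<beta> +
  1 > -1. It can vanish only for k = s = 0, that is for n = 2m > 0, and then p + \<beta> + 1 is the
  quantity excluded by the assumption.\<close>

lemma gegenbauer_const_nonzero:
  assumes "2 * m \<le> n" and "even n \<Longrightarrow> n > 0 \<Longrightarrow> \<alpha> + \<beta> + \<gamma> + \<theta> + (real DIM('a) + 1) / 2 \<noteq> 0"
  shows "gegenbauer_const (n - 2 * m) m \<noteq> 0"
proof -
  let ?k = "n - 2 * m"
  have "pochhammer (real ?k + p_exp + 1) m > 0" using p_exp by (intro pochhammer_pos) auto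
  moreover have "pochhammer (real ?k + p_exp + \<beta> + 1) m \<noteq> 0"
  proof
    assume "pochhammer (real ?k + p_exp + \<beta> + 1) m = 0"
    then obtain s where s: "s < m" "real ?k + p_exp + \<beta> + 1 = - real s"
      by (auto simp: pochhammer_eq_0_iff)
    have "real ?k + real s < 1" using s(2) p_exp \<beta> by linarith
    then have "real (?k + s) < real 1" by simp
    then have "?k + s < 1" by (simp only: of_nat_less_iff)
    then have "?k = 0" "s = 0" by auto
    then have "even n" "n > 0" using assms(1) s(1) by auto
    moreover have "\<alpha> + \<beta> + \<gamma> + \<theta> + (real DIM('a) + 1) / 2 = 0"
      using s(2) \<open>?k = 0\<close> \<open>s = 0\<close> by (simp add: p_exp_def field_simps)
    ultimately show False using assms(2) by blast
  qed
  ultimately show ?thesis by (simp add: gegenbauer_const_def)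
qed

text \<open>Since n - k = 2m is even, only the even generalized Gegenbauer polynomials occur, and
  these are Jacobi polynomials in t^2. As the constant is nonzero, \<open>U_poly\<close> carries the
  true normalisation and not the substitute 1.\<close>

lemma Q_cone_eq_sep_fun:
  assumes I: "(m, j, l) \<in> basis_index TYPE('a) n" and x: "(norm x)\<^sup>2 \<le> t\<^sup>2"
    and nz: "gegenbauer_const (n - 2 * m) m \<noteq> 0"
  shows "Q_cone \<alpha> \<beta> \<gamma> \<theta> Y n j (n - 2 * m) l (x, t) = sep_fun (idx_of n (m, j, l)) (x, t\<^sup>2)"
proof -
  define k where "k = n - 2 * m"
  define i where "i = k - 2 * j"
  have I': "2 * m \<le> n" "2 * j \<le> k" using I by (auto simp: basis_index_def k_def)
  have nk: "n - k = 2 * m" "2 * j + i = k" using I' by (auto simp: k_def i_def)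
  have "gen_gegenbauer (\<beta> + 1/2) (real k + \<alpha> + \<gamma> + \<theta> + real DIM('a) / 2) (n - k) t = poly (U_poly k m) (t\<^sup>2)"
  proof -
    have gg: "gen_gegenbauer lam mu (2 * m) t = pochhammer (lam + mu) m / pochhammer (mu + 1/2) m *
        jacobi_P (lam - 1/2) (mu - 1/2) m (2 * t\<^sup>2 - 1)" for lam mu
      by (simp add: gen_gegenbauer_def Let_def)
    have eqs: "\<beta> + 1/2 - 1/2 = \<beta>" "\<beta> + 1/2 + (real k + \<alpha> + \<gamma> + \<theta> + real DIM('a) / 2) = real k + p_exp + \<beta> + 1"
      "real k + \<alpha> + \<gamma> + \<theta> + real DIM('a) / 2 + 1/2 = real k + p_exp + 1"
      "real k + \<alpha> + \<gamma> + \<theta> + real DIM('a) / 2 - 1/2 = real k + p_exp"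
      by (simp_all add: p_exp_def field_simps)
    show ?thesis
      unfolding nk gg eqs using nz
      by (simp add: U_poly_def poly_jacobi_unit_poly gegenbauer_const_def k_def[symmetric])
  qed
  moreover have "t ^ (2 * j) * jacobi_P \<gamma> (real i + \<alpha> + (real DIM('a) - 2) / 2) j (2 * (norm x)\<^sup>2 / t\<^sup>2 - 1) =
      hom_eval (V_poly i j) j ((norm x)\<^sup>2) (t\<^sup>2)"
  proof -
    have q_eq: "real i + \<alpha> + (real DIM('a) - 2) / 2 = real i + q_exp" by (simp add: q_exp_def)
    have "jacobi_P \<gamma> (real i + \<alpha> + (real DIM('a) - 2) / 2) j (2 * (norm x)\<^sup>2 / t\<^sup>2 - 1) =
        poly (V_poly i j) ((norm x)\<^sup>2 / t\<^sup>2)"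
      unfolding q_eq by (simp add: V_poly_def poly_jacobi_unit_poly)
    \<comment> \<open>For t = 0 the assumption forces x = 0, and the identity holds with quotient 0.
      So the convention for division by zero selects the value of the polynomial.\<close>
    moreover have "(norm x)\<^sup>2 = t\<^sup>2 * ((norm x)\<^sup>2 / t\<^sup>2)" using x by (cases "t = 0") auto
    then have "hom_eval (V_poly i j) j ((norm x)\<^sup>2) (t\<^sup>2) = (t\<^sup>2) ^ j * poly (V_poly i j) ((norm x)\<^sup>2 / t\<^sup>2)"
      using hom_eval_mult[of "V_poly i j" j "t\<^sup>2" "(norm x)\<^sup>2 / t\<^sup>2"] degree_V_poly by simp
    ultimately show ?thesis by (simp only: power_mult)
  qed
  moreover have "sep_fun (idx_of n (m, j, l)) (x, t\<^sup>2) =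
      poly (U_poly k m) (t\<^sup>2) * hom_eval (V_poly i j) j ((norm x)\<^sup>2) (t\<^sup>2) * Y i l x"
    unfolding idx_of_def prod.case k_def[symmetric] i_def[symmetric] sep_fun.simps nk(2) ..
  ultimately show ?thesis
    unfolding Q_cone.simps k_def[symmetric] i_def[symmetric] by (metis mult.assoc)
qed

end

lemma tau_sq_on_cone:
  assumes "a > 0" "z \<in> cone_Xa a"
  shows "(norm (fst z))\<^sup>2 \<le> tau_sq a z" "(tau a (fst z) (snd z))\<^sup>2 = tau_sq a z"
proof -
  show le: "(norm (fst z))\<^sup>2 \<le> tau_sq a z"
  proof -
    have "(norm (fst z))\<^sup>2 \<le> (snd z)\<^sup>2" using assms cone_Xa_eq[OF assms(1)] by blast
    then show ?thesis using assms(1) by (simp add: tau_sq_def)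
  qed
  have "tau_sq a z \<ge> 0" using le zero_le_power2[of "norm (fst z)"] by linarith
  moreover have "tau a (fst z) (snd z) = sqrt (tau_sq a z)" by (simp add: tau_def tau_sq_def)
  ultimately show "(tau a (fst z) (snd z))\<^sup>2 = tau_sq a z" by simp
qed

lemma cone_X_eq: "cone_X = cone_Xa 1"
proof -
  have "(norm x \<le> \<bar>t\<bar> \<and> \<bar>t\<bar> \<le> 1) \<longleftrightarrow> ((norm x)\<^sup>2 \<le> t\<^sup>2 \<and> t\<^sup>2 \<le> 1)" for x :: 'a and t :: real
    using abs_le_square_iff[of "norm x" t] abs_le_square_iff[of t 1] by simp
  then show ?thesis unfolding cone_Xa_eq[OF zero_less_one] cone_X_def by (auto simp: tau_sq_def)
qed

text \<open>For a = 1 the last factor is |t| times the power \<theta> - 1/2 of t^2. At t = 0 both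
  weights are 0, since 0 to any real power is 0 here; so the equality holds everywhere.\<close>

lemma weight_W_eq: "weight_W \<alpha> \<beta> \<gamma> \<theta> = weight_Wa 1 \<alpha> \<beta> \<gamma> \<theta>"
proof (rule ext)
  fix z :: "'a \<times> real"
  obtain x t where z: "z = (x, t)" by (cases z)
  have "\<bar>t\<bar> powr (2 * \<theta>) = \<bar>t\<bar> * (t\<^sup>2) powr (\<theta> - 1/2)"
  proof (cases "t = 0")
    case False
    have "t\<^sup>2 = \<bar>t\<bar> powr 2" using False by simp
    then have "(t\<^sup>2) powr (\<theta> - 1/2) = \<bar>t\<bar> powr (2 * \<theta> - 1)"
      by (simp add: powr_powr algebra_simps del: powr_numeral)
    moreover have "\<bar>t\<bar> * \<bar>t\<bar> powr (2 * \<theta> - 1) = \<bar>t\<bar> powr (2 * \<theta>)"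
      using False powr_mult_base[of "\<bar>t\<bar>" "2 * \<theta> - 1"] by simp
    ultimately show ?thesis by simp
  qed simp
  then show "weight_W \<alpha> \<beta> \<gamma> \<theta> z = weight_Wa 1 \<alpha> \<beta> \<gamma> \<theta> z" by (simp add: z)
qed

text \<open>The orthogonal polynomials are functions on the whole space, so the basis is a family B
  that agrees with the printed formula on the domain. If the quantity in
  \<open>gegenbauer_nonzero\<close> were 0 for an even n > 0, the element with 2m = n would vanish
  identically on the domain.\<close>

theorem proposition5p8:
  fixes a \<alpha> \<beta> \<gamma> \<theta> :: real and n :: nat
    and Y :: "nat \<Rightarrow> nat \<Rightarrow> 'a::euclidean_space \<Rightarrow> real"
  assumes "a > 0"
    and "\<alpha> > -1" and "\<beta> > -1" and "\<gamma> > -1" and "\<theta> > -1"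
    and integrable_weight_at_axis: "2 * \<alpha> + real DIM('a) > 0"
    and integrable_weight_at_apex: "2 * (\<alpha> + \<gamma> + \<theta>) + real DIM('a) + 1 > 0"
    and gegenbauer_nonzero:
      "even n \<Longrightarrow> n > 0 \<Longrightarrow> \<alpha> + \<beta> + \<gamma> + \<theta> + (real DIM('a) + 1) / 2 \<noteq> 0"
    and Y: "\<And>i. orthonormal_basis sphere_inner
              {1..dim (harmonics i :: ('a \<Rightarrow> real) set)} (Y i) (harmonics i)"
  shows "(\<exists>B :: nat \<times> nat \<times> nat \<Rightarrow> 'a \<times> real \<Rightarrow> real.
            orthogonal_basis (L2_inner (weight_Wa a \<alpha> \<beta> \<gamma> \<theta>) (cone_Xa a))
              (basis_index TYPE('a) n) B
              (orth_polys_even n (weight_Wa a \<alpha> \<beta> \<gamma> \<theta>) (cone_Xa a)) \<and>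
            (\<forall>(m, j, l) \<in> basis_index TYPE('a) n. \<forall>z \<in> cone_Xa a.
               B (m, j, l) z = Qa_cone a \<alpha> \<beta> \<gamma> \<theta> Y n j m l z))
       \<and> (\<forall>(m, j, l) \<in> basis_index TYPE('a) n. \<forall>(x, t) \<in> cone_Xa a.
            Qa_cone a \<alpha> \<beta> \<gamma> \<theta> Y n j m l (x, t) =
            Q_cone \<alpha> \<beta> \<gamma> \<theta> Y n j (n - 2 * m) l (x, tau a x t))
       \<and> (\<forall>(m, j, l) \<in> basis_index TYPE('a) n.
            L2_norm (weight_Wa a \<alpha> \<beta> \<gamma> \<theta>) (cone_Xa a) (Qa_cone a \<alpha> \<beta> \<gamma> \<theta> Y n j m l) =
            L2_norm (weight_W \<alpha> \<beta> \<gamma> \<theta>) cone_X (Q_cone \<alpha> \<beta> \<gamma> \<theta> Y n j (n - 2 * m) l))"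
proof -
  interpret cone_basis "TYPE('a)" \<alpha> \<beta> \<gamma> \<theta> a Y
    by unfold_locales (use assms in auto)
  have Qa_Q: "Qa_cone a \<alpha> \<beta> \<gamma> \<theta> Y n j m l (x, t) =
      Q_cone \<alpha> \<beta> \<gamma> \<theta> Y n j (n - 2 * m) l (x, tau a x t)"
    if "(m, j, l) \<in> basis_index TYPE('a) n" for m j l x t
  proof -
    \<comment> \<open>Within the index set no subtraction is truncated, so the indices of the two
      formulas match.\<close>
    have *: "2 * j + (n - 2 * m - 2 * j) = n - 2 * m" "2 * m + 2 * j - 2 * j = n - (n - 2 * m)"
      using that by (auto simp: basis_index_def)
    show ?thesis unfolding Qa_cone.simps Q_cone.simps P_tri_def * ..
  qed
  have Q: "Q_cone \<alpha> \<beta> \<gamma> \<theta> Y n j (n - 2 * m) l (x, t) = sep_fun (idx_of n (m, j, l)) (x, t\<^sup>2)"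
    if "(m, j, l) \<in> basis_index TYPE('a) n" "(norm x)\<^sup>2 \<le> t\<^sup>2" for m j l x t
    using that gegenbauer_const_nonzero[OF _ gegenbauer_nonzero, of m]
    by (intro Q_cone_eq_sep_fun) (auto simp: basis_index_def)
  have Qa: "Qa_cone a \<alpha> \<beta> \<gamma> \<theta> Y n j m l z = sep_fun (idx_of n (m, j, l)) (fst z, tau_sq a z)"
    if I: "(m, j, l) \<in> basis_index TYPE('a) n" and z: "z \<in> cone_Xa a" for m j l z
    using Qa_Q[OF I, of "fst z" "snd z"] Q[OF I, of "fst z" "tau a (fst z) (snd z)"]
      tau_sq_on_cone[OF \<open>a > 0\<close> z] by simp
  have norms: "L2_norm (weight_Wa a \<alpha> \<beta> \<gamma> \<theta>) (cone_Xa a) (Qa_cone a \<alpha> \<beta> \<gamma> \<theta> Y n j m l) =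
      L2_norm (weight_W \<alpha> \<beta> \<gamma> \<theta>) cone_X (Q_cone \<alpha> \<beta> \<gamma> \<theta> Y n j (n - 2 * m) l)"
    if I: "(m, j, l) \<in> basis_index TYPE('a) n" for m j l
  proof -
    have "idx_of n (m, j, l) \<in> idx" using I idx_of_bij[of n] by (auto simp: bij_betw_def)
    note meas = sep_fun_measurable[OF this]
    \<comment> \<open>For a = 1 the coordinate u is t^2, so both norms are computed from the same
      function on (x, u)-space.\<close>
    have "Q_cone \<alpha> \<beta> \<gamma> \<theta> Y n j (n - 2 * m) l z = sep_fun (idx_of n (m, j, l)) (fst z, tau_sq 1 z)"
      if "z \<in> cone_Xa 1" for z
      using Q[OF I, of "fst z" "snd z"] that cone_Xa_eq[OF zero_less_one, where 'a = 'a]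
      by (auto simp: tau_sq_def simp del: Q_cone.simps)
    then have "L2_inner (weight_Wa 1 \<alpha> \<beta> \<gamma> \<theta>) (cone_Xa 1) (Q_cone \<alpha> \<beta> \<gamma> \<theta> Y n j (n - 2 * m) l)
        (Q_cone \<alpha> \<beta> \<gamma> \<theta> Y n j (n - 2 * m) l) =
      L2_inner (weight_Wa a \<alpha> \<beta> \<gamma> \<theta>) (cone_Xa a) (Qa_cone a \<alpha> \<beta> \<gamma> \<theta> Y n j m l) (Qa_cone a \<alpha> \<beta> \<gamma> \<theta> Y n j m l)"
      using L2_inner_cone[OF zero_less_one meas meas] L2_inner_cone[OF \<open>a > 0\<close> meas meas] Qa[OF I] by simp
    then show ?thesis by (simp add: L2_norm_def cone_X_eq weight_W_eq)
  qed
  have "\<forall>(m, j, l) \<in> basis_index TYPE('a) n. \<forall>z \<in> cone_Xa a.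
      (basis_fun \<circ> idx_of n) (m, j, l) z = Qa_cone a \<alpha> \<beta> \<gamma> \<theta> Y n j m l z"
    using Qa by (auto simp: basis_fun_def simp del: Qa_cone.simps)
  with orthogonal_basis_basis_fun[of n] have "\<exists>B :: nat \<times> nat \<times> nat \<Rightarrow> 'a \<times> real \<Rightarrow> real.
            orthogonal_basis ip (basis_index TYPE('a) n) B (orth_polys_even n wt cn) \<and>
            (\<forall>(m, j, l) \<in> basis_index TYPE('a) n. \<forall>z \<in> cone_Xa a.
               B (m, j, l) z = Qa_cone a \<alpha> \<beta> \<gamma> \<theta> Y n j m l z)"
    by blast
  moreover have "\<forall>(m, j, l) \<in> basis_index TYPE('a) n. \<forall>(x, t) \<in> cone_Xa a.
      Qa_cone a \<alpha> \<beta> \<gamma> \<theta> Y n j m l (x, t) = Q_cone \<alpha> \<beta> \<gamma> \<theta> Y n j (n - 2 * m) l (x, tau a x t)"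
    using Qa_Q by (auto simp del: Qa_cone.simps Q_cone.simps)
  moreover have "\<forall>(m, j, l) \<in> basis_index TYPE('a) n.
      L2_norm (weight_Wa a \<alpha> \<beta> \<gamma> \<theta>) (cone_Xa a) (Qa_cone a \<alpha> \<beta> \<gamma> \<theta> Y n j m l) =
      L2_norm (weight_W \<alpha> \<beta> \<gamma> \<theta>) cone_X (Q_cone \<alpha> \<beta> \<gamma> \<theta> Y n j (n - 2 * m) l)"
    using norms by auto
  ultimately show ?thesis by blast
qed

end
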